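(* Let $C\ge 1$ be given. The six-step algorithm described in the context (call it Algorithm A), which tests whether a given fractional ideal $I$ of a real quadratic field $F$ of discriminant $\Delta_F$ is $C$-reduced, runs in time polynomial in $\log|\Delta_F|$.
   Context: Setting. $C\ge 1$ is fixed and $F$ is a real quadratic field with real embeddings $\sigma_1,\sigma_2$, discriminant $\Delta_F$ and ring of integers $O_F$. An element $g\in F$ is identified with $(g_1,g_2)=(\sigma_1(g),\sigma_2(g))\in F_{\mathbb R}=F\otimes_{\mathbb Q}\mathbb R\cong\mathbb R^2$, with norm $\|x\|^2=x_1^2+x_2^2$. For $u=(u_1,u_2)\in(\mathbb R_{>0})^2$ put $\|g\|_u=\|ug\|=(u_1^2g_1^2+u_2^2g_2^2)^{1/2}$. A fractional ideal $I$ is a lattice in $\mathbb R^2$ of covolume $\mathrm{covol}(I)$; $N(I)$ is its norm. "$1$ is primitive in $I$" means that $1\in I$ and $1$ is not divisible in $I$ by any integer $d\ge2$ (i.e. $1/d\notin I$). The ideal $I$ is $C$-reduced if $1$ is primitive in $I$ and there is $u\in(\mathbb R_{>0})^2$ with $\|1\|_u\le C\|g\|_u$ for all $g\in I\setminus\{0\}$. Input. $I$ is represented by a matrix with rational entries, and the length of the input is assumed polynomial in $\log|\Delta_F|$. An LLL-reduced basis $\{b_1,b_2\}$ of $I$ is also assumed given, $b_1=(b_{11},b_{12})$, $b_2=(b_{21},b_{22})$, with sign changed if necessary so that $b_{11}>0$; the coordinates of $b_1,b_2$ have at most $O((\log|\Delta_F|)^a)$ digits for some integer $a>0$. Notation.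 Let $G=\{g\in I: (g_1^2-\frac1{C^2})(g_2^2-\frac1{C^2})<0 \text{ and } \|g\|<\frac4\pi C\,\mathrm{covol}(I)\}$, $G_1=\{g\in G: g_1^2<1/C^2\}$, $G_2=\{g\in G: g_2^2<1/C^2\}$, and $B(g)=\left(-\frac{C^2g_1^2-1}{C^2g_2^2-1}\right)^{1/4}$. Put $B_{min}=\max\{B(g):g\in G_1\}$ if $G_1\ne\emptyset$ and $B_{min}=\frac1{2\sqrt C}$ if $G_1=\emptyset$; put $B_{max}=\min\{B(g):g\in G_2\}$ if $G_2\neq\emptyset$ and $B_{max}=2\sqrt C$ if $G_2=\emptyset$. Let $G'=\{g\in G: B(g)=B_{max}\text{ or }B(g)=B_{min}\}$. Condition $(\star\star)$ on $g$: if $|g_2|<1/C$, then $g_1^2+16C^2g_2^2<16+\frac1{C^2}$ and $g_2^2+16C^2g_1^2>16+\frac1{C^2}$; if $|g_2|>1/C$, then $g_1^2+16C^2g_2^2>16+\frac1{C^2}$ and $g_2^2+16C^2g_1^2<16+\frac1{C^2}$. Algorithm A. Step 1. Check whether $1\in I$ and $N(I)^{-1}<C^2\sqrt{|\Delta_F|}$. Step 2. Test whether $1\in I$ is primitive. Step 3. Check whether there is no nonzero element of $I$ in $S_1=\{(x_1,x_2)\in\mathbb R^2: |x_1|\le 1/C,\ |x_2|\le 1/C,\ x_1^2+x_2^2<2/C^2\}$. (If one of these checks fails, $I$ is not $C$-reduced.) Step 4. If $\|b_1\|\ge\sqrt2/C$, then $I$ is $C$-reduced. If not, find all possible elements of $G'$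 as follows. If $0<b_{11}<1/C$ and $1/C<|b_{12}|<\sqrt2/C$, compute the integers $t_1\le t_2$ lying between $\frac{-1/C-b_{22}}{b_{12}}$ and $\frac{1/C-b_{22}}{b_{12}}$. If $1/C<b_{11}<\sqrt2/C$ and $0<|b_{12}|<1/C$, compute the integers $t_1\le t_2$ lying between $\frac{-1/C-b_{21}}{b_{11}}$ and $\frac{1/C-b_{21}}{b_{11}}$. Let $G_3=\{b_1,\ t_1b_1+b_2,\ t_2b_1+b_2,\ s_1b_1+b_2 \text{ with } s_1\in\mathbb Z,\ |s_1|\le2\}$. Step 5. Remove from $G_3$ all elements which do not satisfy $(\star\star)$. Step 6. Compute $B(g)$ for all $g\in G_3$, and then $B_{max}$ and $B_{min}$. Output: if $B_{min}\le B_{max}$ then $I$ is $C$-reduced; if not, then $I$ is not $C$-reduced. *)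

theory Defs
  imports
    "HOL-Analysis.Analysis"
    "HOL-Computational_Algebra.Computational_Algebra"
    "HOL-Library.Log_Nat"
    "HOL-Number_Theory.Cong"
begin

section \<open>Real quadratic fields and their fractional ideals\<close>

text \<open>
  A real quadratic field is \<open>F = \<rat>(\<surd>d)\<close> for a squarefree integer \<open>d > 1\<close>.  As usual in the
  theory of Arakelov divisors, \<open>g \<in> F\<close> is identified with \<open>(\<sigma>\<^sub>1 g, \<sigma>\<^sub>2 g) \<in> \<real>\<^sup>2\<close>; the library
  norm on \<open>real \<times> real\<close> is the Euclidean one.
\<close>

definition radicand :: "int \<Rightarrow> bool" where
  "radicand d \<longleftrightarrow> 1 < d \<and> squarefree d"

definition field_discr :: "int \<Rightarrow> int" where
  "field_discr d = (if [d = 1] (mod 4) then d else 4 * d)"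

definition quad_field :: "int \<Rightarrow> (real \<times> real) set" where
  "quad_field d =
    {(of_rat a + of_rat b * sqrt (of_int d), of_rat a - of_rat b * sqrt (of_int d)) | a b. True}"

definition int_ring :: "int \<Rightarrow> (real \<times> real) set" where
  "int_ring d = {g \<in> quad_field d. algebraic_int (fst g)}"

definition pmult :: "real \<times> real \<Rightarrow> real \<times> real \<Rightarrow> real \<times> real" where
  "pmult g h = (fst g * fst h, snd g * snd h)"

definition fractional_ideal :: "int \<Rightarrow> (real \<times> real) set \<Rightarrow> bool" where
  "fractional_ideal d I \<longleftrightarrow>
     I \<subseteq> quad_field d \<and> 0 \<in> I \<and> I \<noteq> {0} \<and>
     (\<forall>g\<in>I. \<forall>h\<in>I. g + h \<in> I) \<and>
     (\<forall>r\<in>int_ring d. \<forall>g\<in>I. pmult r g \<in> I) \<and>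
     (\<exists>n::nat. 0 < n \<and> (\<forall>g\<in>I. of_nat n *\<^sub>R g \<in> int_ring d))"

definition Z_basis :: "(real \<times> real) set \<Rightarrow> real \<times> real \<Rightarrow> real \<times> real \<Rightarrow> bool" where
  "Z_basis I x y \<longleftrightarrow>
     I = {of_int m *\<^sub>R x + of_int n *\<^sub>R y | m n. True} \<and> fst x * snd y - snd x * fst y \<noteq> 0"

text \<open>
  The element of \<open>F\<close> with rational coordinates \<open>v\<close> in the integral basis \<open>1, \<omega>\<close> of \<open>O\<^sub>F\<close>,
  where \<open>\<omega> = (\<Delta> + \<surd>\<Delta>) / 2\<close> and \<open>\<Delta>\<close> is the discriminant of \<open>F\<close>.
\<close>

definition elt :: "int \<Rightarrow> rat^2 \<Rightarrow> real \<times> real" where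
  "elt d v =
    (let D = real_of_int (field_discr d) in
      (of_rat (v $ 1) + of_rat (v $ 2) * ((D + sqrt D) / 2),
       of_rat (v $ 1) + of_rat (v $ 2) * ((D - sqrt D) / 2)))"

definition represents :: "int \<Rightarrow> rat^2^2 \<Rightarrow> (real \<times> real) set \<Rightarrow> bool" where
  "represents d M I \<longleftrightarrow> Z_basis I (elt d (column 1 M)) (elt d (column 2 M))"

text \<open>
  The norm is the generalised index \<open>[O\<^sub>F : I]\<close>: the absolute value of the determinant of the
  change of basis from an integral basis of \<open>O\<^sub>F\<close> to a \<open>\<int>\<close>-basis of \<open>I\<close>.
\<close>

definition ideal_norm :: "int \<Rightarrow> (real \<times> real) set \<Rightarrow> rat" where
  "ideal_norm d I = (THE r. \<exists>M. represents d M I \<and> r = \<bar>det M\<bar>)"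

text \<open>LLL-reduced with the usual parameter \<open>3/4\<close>.\<close>

definition LLL_reduced :: "real \<times> real \<Rightarrow> real \<times> real \<Rightarrow> bool" where
  "LLL_reduced x y \<longleftrightarrow>
     (let \<mu> = (y \<bullet> x) / (x \<bullet> x) in
       \<bar>\<mu>\<bar> \<le> 1 / 2 \<and> (norm (y - \<mu> *\<^sub>R x))\<^sup>2 \<ge> (3 / 4 - \<mu>\<^sup>2) * (norm x)\<^sup>2)"


section \<open>The six steps\<close>

definition step1_ok :: "real \<Rightarrow> int \<Rightarrow> (real \<times> real) set \<Rightarrow> bool" where
  "step1_ok C d I \<longleftrightarrow>
     (1, 1) \<in> I \<and> inverse (of_rat (ideal_norm d I)) < C\<^sup>2 * sqrt \<bar>of_int (field_discr d)\<bar>"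

definition step2_ok :: "(real \<times> real) set \<Rightarrow> bool" where
  "step2_ok I \<longleftrightarrow> (1, 1) \<in> I \<and> (\<forall>k::int. 2 \<le> k \<longrightarrow> (1 / of_int k, 1 / of_int k) \<notin> I)"

definition S1 :: "real \<Rightarrow> (real \<times> real) set" where
  "S1 C = {(x1, x2). \<bar>x1\<bar> \<le> 1 / C \<and> \<bar>x2\<bar> \<le> 1 / C \<and> x1\<^sup>2 + x2\<^sup>2 < 2 / C\<^sup>2}"

definition step3_ok :: "real \<Rightarrow> (real \<times> real) set \<Rightarrow> bool" where
  "step3_ok C I \<longleftrightarrow> \<not> (\<exists>g\<in>I. g \<noteq> 0 \<and> g \<in> S1 C)"

definition ints_between :: "real \<Rightarrow> real \<Rightarrow> int set" where
  "ints_between x y = {t. min x y \<le> of_int t \<and> of_int t \<le> max x y}"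

definition t_list :: "real \<Rightarrow> real \<times> real \<Rightarrow> real \<times> real \<Rightarrow> int list" where
  "t_list C b1 b2 =
    (if 0 < fst b1 \<and> fst b1 < 1 / C \<and> 1 / C < \<bar>snd b1\<bar> \<and> \<bar>snd b1\<bar> < sqrt 2 / C then
       (let Z = ints_between ((- 1 / C - snd b2) / snd b1) ((1 / C - snd b2) / snd b1)
        in [Min Z, Max Z])
     else if 1 / C < fst b1 \<and> fst b1 < sqrt 2 / C \<and> 0 < \<bar>snd b1\<bar> \<and> \<bar>snd b1\<bar> < 1 / C then
       (let Z = ints_between ((- 1 / C - fst b2) / fst b1) ((1 / C - fst b2) / fst b1)
        in [Min Z, Max Z])
     else [])"

text \<open>The candidates are recorded by their coefficients: \<open>(s, t)\<close> stands for \<open>s b\<^sub>1 + t b\<^sub>2\<close>.\<close>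

definition comb :: "real \<times> real \<Rightarrow> real \<times> real \<Rightarrow> int \<times> int \<Rightarrow> real \<times> real" where
  "comb b1 b2 st = of_int (fst st) *\<^sub>R b1 + of_int (snd st) *\<^sub>R b2"

definition G3_list :: "real \<Rightarrow> real \<times> real \<Rightarrow> real \<times> real \<Rightarrow> (int \<times> int) list" where
  "G3_list C b1 b2 = (1, 0) # map (\<lambda>t. (t, 1)) (t_list C b1 b2) @ map (\<lambda>s. (s, 1)) [-2..2]"

definition star_star :: "real \<Rightarrow> real \<times> real \<Rightarrow> bool" where
  "star_star C g \<longleftrightarrow>
     (\<bar>snd g\<bar> < 1 / C \<longrightarrow>
        (fst g)\<^sup>2 + 16 * C\<^sup>2 * (snd g)\<^sup>2 < 16 + 1 / C\<^sup>2 \<and>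
        (snd g)\<^sup>2 + 16 * C\<^sup>2 * (fst g)\<^sup>2 > 16 + 1 / C\<^sup>2) \<and>
     (\<bar>snd g\<bar> > 1 / C \<longrightarrow>
        (fst g)\<^sup>2 + 16 * C\<^sup>2 * (snd g)\<^sup>2 > 16 + 1 / C\<^sup>2 \<and>
        (snd g)\<^sup>2 + 16 * C\<^sup>2 * (fst g)\<^sup>2 < 16 + 1 / C\<^sup>2)"

definition Bval :: "real \<Rightarrow> real \<times> real \<Rightarrow> real" where
  "Bval C g = root 4 (- ((C\<^sup>2 * (fst g)\<^sup>2 - 1) / (C\<^sup>2 * (snd g)\<^sup>2 - 1)))"

text \<open>
  \<open>Bmin\<close> and \<open>Bmax\<close> are taken over a given finite set \<open>X\<close> of elements; Step 6 uses the
  elements of \<open>G\<^sub>3\<close> that survive Step 5.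
\<close>

definition Bmin :: "real \<Rightarrow> (real \<times> real) set \<Rightarrow> real" where
  "Bmin C X = (let X1 = {g \<in> X. (fst g)\<^sup>2 < 1 / C\<^sup>2} in
     if X1 \<noteq> {} then Max (Bval C ` X1) else 1 / (2 * sqrt C))"

definition Bmax :: "real \<Rightarrow> (real \<times> real) set \<Rightarrow> real" where
  "Bmax C X = (let X2 = {g \<in> X. (snd g)\<^sup>2 < 1 / C\<^sup>2} in
     if X2 \<noteq> {} then Min (Bval C ` X2) else 2 * sqrt C)"

text \<open>
  The record of a run of Algorithm A.  A completed run contains \<open>G\<^sub>3\<close> as found in Step 4, what
  is left of it after Step 5, the first remaining elements at which \<open>Bmin\<close> and \<open>Bmax\<close> are
  attained (\<open>None\<close> if the default value is used), and the answer of the final comparison.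
\<close>

datatype run =
    Rejected_at nat
  | Accepted_at_step4
  | Completed "(int \<times> int) list" "(int \<times> int) list"
      "(int \<times> int) option" "(int \<times> int) option" bool

definition algorithm_A ::
    "real \<Rightarrow> int \<Rightarrow> (real \<times> real) set \<Rightarrow> real \<times> real \<Rightarrow> real \<times> real \<Rightarrow> run" where
  "algorithm_A C d I b1 b2 =
    (if \<not> step1_ok C d I then Rejected_at 1
     else if \<not> step2_ok I then Rejected_at 2
     else if \<not> step3_ok C I then Rejected_at 3
     else if norm b1 \<ge> sqrt 2 / C then Accepted_at_step4
     else
       (let G3 = G3_list C b1 b2;
            G5 = filter (\<lambda>st. star_star C (comb b1 b2 st)) G3;
            X = comb b1 b2 ` set G5;
            at_min = find (\<lambda>st. (fst (comb b1 b2 st))\<^sup>2 < 1 / C\<^sup>2 \<and> Bval C (comb b1 b2 st) = Bmin C X) G5;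
            at_max = find (\<lambda>st. (snd (comb b1 b2 st))\<^sup>2 < 1 / C\<^sup>2 \<and> Bval C (comb b1 b2 st) = Bmax C X) G5
        in Completed G3 G5 at_min at_max (Bmin C X \<le> Bmax C X)))"

text \<open>
  In the integer encoding of a run the first entry is the verdict, 1 for ``reduced'' and 0 for
  ``not reduced'', and the second the number of the step at which the run ended.  The pair
  \<open>(0, 0)\<close>, which is never a candidate, encodes \<open>None\<close>.
\<close>

fun pair_code :: "(int \<times> int) option \<Rightarrow> int list" where
  "pair_code None = [0, 0]"
| "pair_code (Some (s, t)) = [s, t]"

fun run_code :: "run \<Rightarrow> int list" where
  "run_code (Rejected_at k) = [0, int k]"
| "run_code Accepted_at_step4 = [1, 4]"
| "run_code (Completed G3 G5 at_min at_max ans) =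
     [of_bool ans, 6] @ concat (map (\<lambda>st. pair_code (Some st)) G3)
       @ map (\<lambda>st. of_bool (st \<in> set G5)) G3 @ pair_code at_min @ pair_code at_max"


section \<open>The machine model\<close>

text \<open>
  Programs work on finitely many integer registers and every operation is charged in bit
  operations (logarithmic cost; schoolbook multiplication and division with remainder).

  The fixed real number \<open>C\<close> has in general no finite description.  As for any exact
  computation with a fixed real constant, programs access it by determining signs of
  expressions formed from \<open>C\<close>, here of integer polynomials at \<open>C\<close>: \<open>Sign x [y\<^sub>0, \<dots>, y\<^sub>n]\<close> stores the sign of
  \<open>y\<^sub>0 + y\<^sub>1 C + \<dots> + y\<^sub>n C\<^sup>n\<close> in register \<open>x\<close>.  The price \<open>\<kappa>\<close> of such a test is a parameter; for
  rational (or real algebraic) \<open>C\<close> it can be taken to be the polynomial cost of an actual sign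
  computation.
\<close>

type_synonym state = "nat \<Rightarrow> int"

datatype com =
    Skip
  | Const nat int
  | Plus nat nat nat
  | Minus nat nat nat
  | Times nat nat nat
  | Div nat nat nat
  | Sign nat "nat list"
  | Seq com com
  | If_pos nat com com
  | While_pos nat com

definition bits :: "int \<Rightarrow> nat" where
  "bits n = 1 + floorlog 2 (nat \<bar>n\<bar>)"

definition list_bits :: "int list \<Rightarrow> nat" where
  "list_bits xs = sum_list (map bits xs)"

definition eval_at :: "real \<Rightarrow> int list \<Rightarrow> real" where
  "eval_at C ys = (\<Sum>i<length ys. of_int (ys ! i) * C ^ i)"

text \<open>\<open>exec C \<kappa> p s t s'\<close>: started in \<open>s\<close>, the program \<open>p\<close> halts in \<open>s'\<close> at total cost \<open>t\<close>.\<close>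

inductive exec :: "real \<Rightarrow> (int list \<Rightarrow> nat) \<Rightarrow> com \<Rightarrow> state \<Rightarrow> nat \<Rightarrow> state \<Rightarrow> bool"
  for C :: real and \<kappa> :: "int list \<Rightarrow> nat" where
  Skip: "exec C \<kappa> Skip s 1 s"
| Const: "exec C \<kappa> (Const x n) s (bits n) (s(x := n))"
| Plus: "exec C \<kappa> (Plus x y z) s (bits (s y) + bits (s z)) (s(x := s y + s z))"
| Minus: "exec C \<kappa> (Minus x y z) s (bits (s y) + bits (s z)) (s(x := s y - s z))"
| Times: "exec C \<kappa> (Times x y z) s (bits (s y) * bits (s z)) (s(x := s y * s z))"
| Div: "exec C \<kappa> (Div x y z) s (bits (s y) * bits (s z)) (s(x := s y div s z))"
| Sign: "exec C \<kappa> (Sign x ys) s (1 + list_bits (map s ys) + \<kappa> (map s ys))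
           (s(x := (if eval_at C (map s ys) > 0 then 1
                    else if eval_at C (map s ys) < 0 then - 1 else 0)))"
| Seq: "\<lbrakk>exec C \<kappa> p s t s'; exec C \<kappa> q s' u s''\<rbrakk> \<Longrightarrow> exec C \<kappa> (Seq p q) s (t + u) s''"
| If_true: "\<lbrakk>s x > 0; exec C \<kappa> p s t s'\<rbrakk> \<Longrightarrow> exec C \<kappa> (If_pos x p q) s (bits (s x) + t) s'"
| If_false: "\<lbrakk>\<not> s x > 0; exec C \<kappa> q s t s'\<rbrakk> \<Longrightarrow> exec C \<kappa> (If_pos x p q) s (bits (s x) + t) s'"
| While_false: "\<not> s x > 0 \<Longrightarrow> exec C \<kappa> (While_pos x p) s (bits (s x)) s"
| While_true: "\<lbrakk>s x > 0; exec C \<kappa> p s t s'; exec C \<kappa> (While_pos x p) s' u s''\<rbrakk>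
    \<Longrightarrow> exec C \<kappa> (While_pos x p) s (bits (s x) + t + u) s''"

inductive_cases exec_elims:
  "exec C \<kappa> Skip s t s'" "exec C \<kappa> (Const x n) s t s'" "exec C \<kappa> (Plus x y z) s t s'"
  "exec C \<kappa> (Minus x y z) s t s'" "exec C \<kappa> (Times x y z) s t s'" "exec C \<kappa> (Div x y z) s t s'"
  "exec C \<kappa> (Sign x ys) s t s'" "exec C \<kappa> (Seq p q) s t s'" "exec C \<kappa> (If_pos x p q) s t s'"
  "exec C \<kappa> (While_pos x p) s t s'"

lemma exec_deterministic:
  "exec C \<kappa> p s t s' \<Longrightarrow> exec C \<kappa> p s u s'' \<Longrightarrow> u = t \<and> s'' = s'"
proof (induction arbitrary: u s'' rule: exec.induct)
  case (Skip s)
  then show ?case by (rule exec_elims(1)) simp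
next
  case (Const x n s)
  then show ?case by (rule exec_elims(2)) simp
next
  case (Plus x y z s)
  then show ?case by (rule exec_elims(3)) simp
next
  case (Minus x y z s)
  then show ?case by (rule exec_elims(4)) simp
next
  case (Times x y z s)
  then show ?case by (rule exec_elims(5)) simp
next
  case (Div x y z s)
  then show ?case by (rule exec_elims(6)) simp
next
  case (Sign x ys s)
  then show ?case by (rule exec_elims(7)) simp
next
  case (Seq p s t s' q v r)
  from Seq.prems show ?case by (rule exec_elims(8)) (use Seq.IH in blast)
next
  case (If_true s x p t s' q)
  from If_true.prems show ?case
    by (rule exec_elims(9)) (use If_true.IH If_true.hyps in blast)+
next
  case (If_false s x q t s' p)
  from If_false.prems show ?case
    by (rule exec_elims(9)) (use If_false.IH If_false.hyps in blast)+
next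
  case (While_false s x p)
  from While_false.prems show ?case
    by (rule exec_elims(10)) (use While_false.hyps in blast)+
next
  case (While_true s x p t s' v r)
  from While_true.prems show ?case
    by (rule exec_elims(10)) (use While_true.IH While_true.hyps in blast)+
qed

definition load :: "int list \<Rightarrow> state" where
  "load xs = (\<lambda>i. if i < length xs then xs ! i else 0)"

definition holds :: "state \<Rightarrow> int list \<Rightarrow> bool" where
  "holds s xs \<longleftrightarrow> (\<forall>i < length xs. s i = xs ! i)"

definition poly_cost :: "(int list \<Rightarrow> nat) \<Rightarrow> bool" where
  "poly_cost \<kappa> \<longleftrightarrow> (\<exists>A k. \<forall>ys. \<kappa> ys \<le> A * (1 + list_bits ys) ^ k)"


section \<open>The input\<close>

definition rat_code :: "rat \<Rightarrow> int list" where
  "rat_code q = [fst (quotient_of q), snd (quotient_of q)]"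

definition vec_code :: "rat^2 \<Rightarrow> int list" where
  "vec_code v = rat_code (v $ 1) @ rat_code (v $ 2)"

definition mat_code :: "rat^2^2 \<Rightarrow> int list" where
  "mat_code M = vec_code (column 1 M) @ vec_code (column 2 M)"

definition input_code :: "int \<Rightarrow> rat^2^2 \<Rightarrow> rat^2 \<Rightarrow> rat^2 \<Rightarrow> int list" where
  "input_code d M v1 v2 = [field_discr d] @ mat_code M @ vec_code v1 @ vec_code v2"

definition valid_input ::
    "int \<Rightarrow> (real \<times> real) set \<Rightarrow> rat^2^2 \<Rightarrow> rat^2 \<Rightarrow> rat^2 \<Rightarrow> bool" where
  "valid_input d I M v1 v2 \<longleftrightarrow>
     radicand d \<and> fractional_ideal d I \<and> represents d M I \<and>
     Z_basis I (elt d v1) (elt d v2) \<and> LLL_reduced (elt d v1) (elt d v2) \<and> 0 < fst (elt d v1)"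

end

theory Submission
  imports Defs
begin

text \<open>
  Nearly all numbers in Algorithm A lie in the field generated by \<open>C\<close> and \<open>\<surd>\<Delta>\<close>, and its decisions
  are divisibility tests on integers or comparisons in this field.  A quotient \<open>P / Q\<close> of elements
  of \<open>\<int>[C] + \<surd>\<Delta> \<int>[C]\<close> has the sign of \<open>P Q = a + b \<surd>\<Delta>\<close> with \<open>a, b \<in> \<int>[C]\<close>, and that sign
  follows from the signs of \<open>a\<close>, \<open>b\<close> and \<open>a\<^sup>2 - b\<^sup>2 \<Delta>\<close> (\<open>quad_pos_iff\<close>).  These are integer
  polynomials at \<open>C\<close>, which the machine can test.  The two exceptions are harmless: bounds with
  \<open>\<surd>2\<close> can be squared, and values of \<open>B\<close> are compared through their fourth powers
  (\<open>Bval_le_iff\<close>).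

  It remains to see that each step needs only boundedly many such comparisons, apart from two
  loops with a number of rounds linear in the input length.

  \<^item> With respect to the reduced basis \<open>b\<^sub>1, b\<^sub>2\<close> the coefficients of 1 are rational numbers given
    by Cramer's rule.  Then 1 lies in \<open>I\<close> if and only if they are integers, and it is primitive if
    and only if they are coprime, which the Euclidean algorithm decides.  The norm of \<open>I\<close> is a
    determinant.
  \<^item> If Step 1 succeeds, the covolume of \<open>I\<close> exceeds \<open>1 / C\<^sup>2\<close>.  For a reduced basis it
    then suffices to test four vectors in Step 3 (\<open>S1_meets_reduced_lattice\<close>).
  \<^item> The integers \<open>t\<^sub>1, t\<^sub>2\<close> of Step 4 can be exponentially large, but they differ by less than 1
    from a quadratic irrational \<open>(a + b \<surd>\<Delta>) / q\<close>.  The integer square root of \<open>b\<^sup>2 \<Delta>\<close>, found by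
    bisection, locates them up to four possibilities (\<open>t_range\<close>).
  \<^item> There are at most eight candidates, so the maximum, the minimum and the elements that attain
    them are found by testing all pairs.

  No program is written down explicitly.  Instead, \<open>polytime f\<close> says that some program computes
  the function \<open>f\<close> of the registers in time polynomial in the length of its input, with a result
  of polynomial length.  This property is closed under composition, arithmetic operations, case
  distinctions, greatest common divisors and integer square roots.  The algorithm, written as a
  function of the registers, is an expression built from these operations (\<open>algorithm_code\<close>).  Its
  entries are therefore computed by one program, which depends neither on \<open>C\<close> nor on \<open>\<kappa>\<close>.
\<close>

section \<open>Bit lengths and polynomial bounds\<close>

lemma bits_le_iff: "bits n \<le> Suc k \<longleftrightarrow> \<bar>n\<bar> < 2 ^ k"
proof -
  have "nat \<bar>n\<bar> < 2 ^ k \<longleftrightarrow> \<bar>n\<bar> < 2 ^ k"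
    by (simp add: nat_less_iff)
  then show ?thesis by (simp add: bits_def floorlog_le_iff)
qed

lemma obtain_bits:
  obtains k where "bits n = Suc k" "\<bar>n\<bar> < 2 ^ k"
  using bits_le_iff[of n "floorlog 2 (nat \<bar>n\<bar>)"] by (auto simp: bits_def)

lemma bits_mono: "\<bar>m\<bar> \<le> \<bar>n\<bar> \<Longrightarrow> bits m \<le> bits n"
  by (simp add: bits_def floorlog_mono nat_mono)

lemma bits_pos [simp]: "1 \<le> bits n"
  by (simp add: bits_def)

lemma bits_0 [simp]: "bits 0 = 1"
  by (simp add: bits_def floorlog_def)

lemma bits_abs [simp]: "bits \<bar>n\<bar> = bits n"
  by (simp add: bits_def)

lemma bits_add: "bits (m + n) \<le> bits m + bits n"
proof -
  obtain a b where ab: "bits m = Suc a" "\<bar>m\<bar> < 2 ^ a" "bits n = Suc b" "\<bar>n\<bar> < 2 ^ b"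
    using obtain_bits[of m] obtain_bits[of n] by metis
  have "(2::int) ^ a \<le> 2 ^ (a + b)" "(2::int) ^ b \<le> 2 ^ (a + b)" by simp_all
  then have "\<bar>m + n\<bar> < 2 ^ Suc (a + b)" using ab by (simp only: power_Suc)
  then show ?thesis using ab bits_le_iff[of "m + n" "Suc (a + b)"] by simp
qed

lemma bits_diff: "bits (m - n) \<le> bits m + bits n"
  using bits_add[of m "- n"] by (simp add: bits_def)

lemma bits_mult: "bits (m * n) \<le> bits m + bits n"
proof -
  obtain a b where ab: "bits m = Suc a" "\<bar>m\<bar> < 2 ^ a" "bits n = Suc b" "\<bar>n\<bar> < 2 ^ b"
    by (metis obtain_bits)
  have "\<bar>m * n\<bar> < 2 ^ (a + b)"
    using ab by (simp add: abs_mult power_add mult_strict_mono)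
  then show ?thesis using ab bits_le_iff[of "m * n" "a + b"] by simp
qed

lemma abs_div_le: "\<bar>m div n\<bar> \<le> \<bar>m :: int\<bar>"
proof (cases "n = 0")
  case False
  have "\<bar>real_of_int m / real_of_int n\<bar> \<le> \<bar>real_of_int m\<bar>"
    using False mult_left_mono[of 1 "\<bar>real_of_int n\<bar>" "\<bar>real_of_int m\<bar>"]
    by (simp add: abs_divide divide_le_eq)
  moreover have "m div n = \<lfloor>real_of_int m / real_of_int n\<rfloor>"
    by (simp add: floor_divide_of_int_eq)
  ultimately show ?thesis by linarith
qed simp

lemma bits_div: "bits (m div n) \<le> bits m"
  by (rule bits_mono) (rule abs_div_le)

lemma list_bits_simps [simp]:
  "list_bits [] = 0" "list_bits (x # xs) = bits x + list_bits xs"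
  "list_bits (xs @ ys) = list_bits xs + list_bits ys"
  by (simp_all add: list_bits_def)

text \<open>
  Monotonicity is part of the notion because bounds are composed: a bound on the length of an
  intermediate result is substituted into the bound for the next operation.
\<close>

definition poly_bounded :: "(nat \<Rightarrow> nat) \<Rightarrow> bool" where
  "poly_bounded T \<longleftrightarrow> mono T \<and> (\<exists>A k. \<forall>x. T x \<le> A * (1 + x) ^ k)"

lemma poly_bounded_mono: "poly_bounded T \<Longrightarrow> x \<le> y \<Longrightarrow> T x \<le> T y"
  by (auto simp: poly_bounded_def mono_def)

named_theorems poly_bounded_intros

lemma poly_bounded_id [poly_bounded_intros]: "poly_bounded (\<lambda>x. x)"
  unfolding poly_bounded_def by (auto simp: mono_def intro!: exI[of _ 1])

lemma poly_bounded_const [poly_bounded_intros]: "poly_bounded (\<lambda>x. c)"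
  unfolding poly_bounded_def
  by (intro conjI exI[of _ c] exI[of _ 0]) (auto simp: mono_def)

lemma poly_bounded_add [poly_bounded_intros]:
  assumes "poly_bounded S" "poly_bounded T"
  shows "poly_bounded (\<lambda>x. S x + T x)"
proof -
  obtain A k B l where S: "\<And>x. S x \<le> A * (1 + x) ^ k" and T: "\<And>x. T x \<le> B * (1 + x) ^ l"
    using assms unfolding poly_bounded_def by blast
  have "S x + T x \<le> (A + B) * (1 + x) ^ (k + l)" for x
  proof -
    have "(1 + x) ^ k \<le> (1 + x) ^ (k + l)" "(1 + x) ^ l \<le> (1 + x) ^ (k + l)"
      by (rule power_increasing; simp)+
    then have "A * (1 + x) ^ k \<le> A * (1 + x) ^ (k + l)" "B * (1 + x) ^ l \<le> B * (1 + x) ^ (k + l)"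
      by (simp_all add: mult_le_mono2)
    with S[of x] T[of x] show ?thesis unfolding distrib_right by linarith
  qed
  with assms show ?thesis unfolding poly_bounded_def mono_def by (blast intro: add_mono)
qed

lemma poly_bounded_mult [poly_bounded_intros]:
  assumes "poly_bounded S" "poly_bounded T"
  shows "poly_bounded (\<lambda>x. S x * T x)"
proof -
  obtain A k B l where S: "\<And>x. S x \<le> A * (1 + x) ^ k" and T: "\<And>x. T x \<le> B * (1 + x) ^ l"
    using assms unfolding poly_bounded_def by blast
  have "S x * T x \<le> (A * B) * (1 + x) ^ (k + l)" for x
    using mult_le_mono[OF S T, of x x] by (simp add: power_add algebra_simps)
  with assms show ?thesis unfolding poly_bounded_def mono_def by (blast intro: mult_le_mono)
qed

lemma poly_bounded_power [poly_bounded_intros]: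
  "poly_bounded T \<Longrightarrow> poly_bounded (\<lambda>x. T x ^ n)"
  by (induction n) (auto intro: poly_bounded_intros)

lemma poly_bounded_comp:
  assumes "poly_bounded S" "poly_bounded T"
  shows "poly_bounded (\<lambda>x. S (T x))"
proof -
  obtain A k where S: "\<And>x. S x \<le> A * (1 + x) ^ k"
    using assms unfolding poly_bounded_def by blast
  have "poly_bounded (\<lambda>x. A * (1 + T x) ^ k)"
    using assms by (intro poly_bounded_intros)
  then obtain B l where "\<And>x. A * (1 + T x) ^ k \<le> B * (1 + x) ^ l"
    unfolding poly_bounded_def by blast
  then have "S (T x) \<le> B * (1 + x) ^ l" for x using S le_trans by blast
  with assms show ?thesis unfolding poly_bounded_def mono_def by blast
qed

lemma poly_cost_bounded:
  assumes "poly_cost \<kappa>"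
  obtains T where "poly_bounded T" "\<And>ys. \<kappa> ys \<le> T (list_bits ys)"
proof -
  obtain A k where "\<And>ys. \<kappa> ys \<le> A * (1 + list_bits ys) ^ k"
    using assms unfolding poly_cost_def by blast
  moreover have "poly_bounded (\<lambda>x. A * (1 + x) ^ k)"
    by (intro poly_bounded_intros)
  ultimately show ?thesis using that by blast
qed


section \<open>Functions computed in polynomial time\<close>

text \<open>
  Two states occur: \<open>s\<close> is the actual state and \<open>s0\<close> the state of which the functions are
  evaluated.  They need only agree on the first \<open>N\<close> registers, so that the program may run after
  others that left arbitrary scratch values above \<open>N\<close>.  The time bound also depends on these \<open>N\<close>
  registers alone, and it covers the lengths of the results as well.
\<close>

definition computes ::
    "real \<Rightarrow> (int list \<Rightarrow> nat) \<Rightarrow> com \<Rightarrow> nat \<Rightarrow> nat \<Rightarrow> (real \<Rightarrow> state \<Rightarrow> int) list \<Rightarrow> (nat \<Rightarrow> nat) \<Rightarrow> bool"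
  where "computes C \<kappa> p N r fs T \<longleftrightarrow>
    (\<forall>s s0. (\<forall>i<N. s i = s0 i) \<longrightarrow> (\<exists>t s'. exec C \<kappa> p s t s' \<and> (\<forall>i<r. s' i = s i) \<and>
       (\<forall>j<length fs. s' (r + j) = (fs ! j) C s0) \<and>
       t + list_bits (map (\<lambda>f. f C s0) fs) \<le> T (list_bits (map s0 [0..<N]))))"

text \<open>
  The result base \<open>r\<close> may be any register beyond the inputs, and registers below it are preserved.
  Hence programs for several functions can be run one after the other with increasing \<open>r\<close>.  The
  program is chosen before \<open>C\<close> and \<open>\<kappa>\<close>; only the bound depends on them.
\<close>

definition polytime_list :: "(real \<Rightarrow> state \<Rightarrow> int) list \<Rightarrow> bool" where
  "polytime_list fs \<longleftrightarrow> (\<exists>N. \<forall>r\<ge>N. \<exists>p. \<forall>C \<kappa>. poly_cost \<kappa> \<longrightarrow>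
     (\<exists>T. poly_bounded T \<and> computes C \<kappa> p N r fs T))"

definition polytime :: "(real \<Rightarrow> state \<Rightarrow> int) \<Rightarrow> bool" where
  "polytime f \<longleftrightarrow> polytime_list [f]"

text \<open>
  An operation takes its \<open>n\<close> arguments from the registers \<open>r, \<dots>, r + n - 1\<close>, where programs for
  lists of functions leave their results, and puts its own result into \<open>r\<close>.
\<close>

definition applies ::
    "real \<Rightarrow> (int list \<Rightarrow> nat) \<Rightarrow> com \<Rightarrow> nat \<Rightarrow> nat \<Rightarrow> (real \<Rightarrow> int list \<Rightarrow> int) \<Rightarrow> (nat \<Rightarrow> nat) \<Rightarrow> bool"
  where "applies C \<kappa> p r n g T \<longleftrightarrow>
    (\<forall>s. \<exists>t s'. exec C \<kappa> p s t s' \<and> (\<forall>i<r. s' i = s i) \<and>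
       s' r = g C (map s [r..<r + n]) \<and> t + bits (s' r) \<le> T (list_bits (map s [r..<r + n])))"

definition register_op :: "nat \<Rightarrow> (real \<Rightarrow> int list \<Rightarrow> int) \<Rightarrow> bool" where
  "register_op n g \<longleftrightarrow> (\<forall>r. \<exists>p. \<forall>C \<kappa>. poly_cost \<kappa> \<longrightarrow>
     (\<exists>T. poly_bounded T \<and> applies C \<kappa> p r n g T))"

lemma list_bits_upt_mono:
  assumes "M \<le> N"
  shows "list_bits (map s [0..<M]) \<le> list_bits (map s [0..<N])"
proof -
  have "[0..<N] = [0..<M] @ [M..<N]" using assms by (metis le_add_diff_inverse upt_add_eq_append zero_le)
  then show ?thesis by simp
qed

lemma polytime_list_Nil: "polytime_list []"
  unfolding polytime_list_def
proof (intro exI[of _ 0] allI impI)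
  fix r :: nat
  show "\<exists>p. \<forall>C \<kappa>. poly_cost \<kappa> \<longrightarrow> (\<exists>T. poly_bounded T \<and> computes C \<kappa> p 0 r [] T)"
    by (intro exI[of _ Skip] allI impI exI[of _ "\<lambda>x. 1"] conjI poly_bounded_intros)
       (auto simp: computes_def intro!: exI[of _ "1::nat"] exec.Skip)
qed

text \<open>
  Running the second program with base \<open>r + 1\<close> protects the first result, and it still finds its
  inputs because the first program changed nothing below \<open>r\<close>.
\<close>

lemma computes_Seq_Cons:
  assumes p: "computes C \<kappa> p N1 r [f] T" and T: "poly_bounded T"
    and q: "computes C \<kappa> q N2 (Suc r) fs U" and U: "poly_bounded U" and r: "max N1 N2 \<le> r"
  shows "computes C \<kappa> (Seq p q) (max N1 N2) r (f # fs) (\<lambda>x. T x + U x)"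
  unfolding computes_def
proof (intro allI impI)
  fix s s0 :: state assume s: "\<forall>i<max N1 N2. s i = s0 i"
  have "\<forall>i<N1. s i = s0 i" using s by auto
  then obtain t s1 where 1: "exec C \<kappa> p s t s1" "\<forall>i<r. s1 i = s i" "s1 r = f C s0"
    "t + bits (f C s0) \<le> T (list_bits (map s0 [0..<N1]))"
    using p[unfolded computes_def, rule_format, of s s0] by (auto simp: list_bits_def)
  have "\<forall>i<N2. s1 i = s0 i" using 1(2) s r by auto
  then obtain u s2 where 2: "exec C \<kappa> q s1 u s2" "\<forall>i<Suc r. s2 i = s1 i"
    "\<forall>j<length fs. s2 (Suc r + j) = (fs ! j) C s0"
    "u + list_bits (map (\<lambda>f. f C s0) fs) \<le> U (list_bits (map s0 [0..<N2]))"
    using q unfolding computes_def by blast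
  have "s2 (r + j) = ((f # fs) ! j) C s0" if "j < length (f # fs)" for j
    using that 1(3) 2(2,3) by (cases j) auto
  moreover have "t + u + list_bits (map (\<lambda>f. f C s0) (f # fs))
      \<le> T (list_bits (map s0 [0..<max N1 N2])) + U (list_bits (map s0 [0..<max N1 N2]))"
    using 1(4) 2(4) poly_bounded_mono[OF T list_bits_upt_mono[of N1 "max N1 N2" s0]]
      poly_bounded_mono[OF U list_bits_upt_mono[of N2 "max N1 N2" s0]] by auto
  ultimately show "\<exists>t s'. exec C \<kappa> (Seq p q) s t s' \<and> (\<forall>i<r. s' i = s i) \<and>
    (\<forall>j<length (f # fs). s' (r + j) = ((f # fs) ! j) C s0) \<and>
    t + list_bits (map (\<lambda>f. f C s0) (f # fs))
      \<le> T (list_bits (map s0 [0..<max N1 N2])) + U (list_bits (map s0 [0..<max N1 N2]))"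
    using exec.Seq[OF 1(1) 2(1)] 1(2) 2(2) by (intro exI[of _ "t + u"] exI[of _ s2]) auto
qed

lemma polytime_list_Cons:
  assumes "polytime f" "polytime_list fs"
  shows "polytime_list (f # fs)"
proof -
  obtain N1 where N1: "\<And>r. r \<ge> N1 \<Longrightarrow> \<exists>p. \<forall>C \<kappa>. poly_cost \<kappa> \<longrightarrow>
     (\<exists>T. poly_bounded T \<and> computes C \<kappa> p N1 r [f] T)"
    using assms(1) unfolding polytime_def polytime_list_def by blast
  obtain N2 where N2: "\<And>r. r \<ge> N2 \<Longrightarrow> \<exists>p. \<forall>C \<kappa>. poly_cost \<kappa> \<longrightarrow>
     (\<exists>T. poly_bounded T \<and> computes C \<kappa> p N2 r fs T)"
    using assms(2) unfolding polytime_list_def by blast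
  show ?thesis
    unfolding polytime_list_def
  proof (intro exI[of _ "max N1 N2"] allI impI)
    fix r assume r: "max N1 N2 \<le> r"
    obtain p q where
      "\<And>C \<kappa>. poly_cost \<kappa> \<Longrightarrow> \<exists>T. poly_bounded T \<and> computes C \<kappa> p N1 r [f] T"
      "\<And>C \<kappa>. poly_cost \<kappa> \<Longrightarrow> \<exists>T. poly_bounded T \<and> computes C \<kappa> q N2 (Suc r) fs T"
      using N1[of r] N2[of "Suc r"] r by (metis Suc_leD max.boundedE not_less_eq_eq nat_le_linear)
    then have "\<exists>T. poly_bounded T \<and> computes C \<kappa> (Seq p q) (max N1 N2) r (f # fs) T"
      if "poly_cost \<kappa>" for C \<kappa>
      using that computes_Seq_Cons[OF _ _ _ _ r] poly_bounded_add by blast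
    then show "\<exists>p. \<forall>C \<kappa>. poly_cost \<kappa> \<longrightarrow>
        (\<exists>T. poly_bounded T \<and> computes C \<kappa> p (max N1 N2) r (f # fs) T)"
      by blast
  qed
qed

lemma polytime_list_if_polytime: "(\<And>f. f \<in> set fs \<Longrightarrow> polytime f) \<Longrightarrow> polytime_list fs"
  by (induction fs) (auto intro: polytime_list_Nil polytime_list_Cons)

lemma computes_Seq_applies:
  assumes p: "computes C \<kappa> p N r fs T" and q: "applies C \<kappa> q r (length fs) g U"
    and U: "poly_bounded U"
  shows "computes C \<kappa> (Seq p q) N r [\<lambda>C s. g C (map (\<lambda>f. f C s) fs)] (\<lambda>x. T x + U (T x))"
  unfolding computes_def
proof (intro allI impI)
  fix s s0 :: state assume s: "\<forall>i<N. s i = s0 i"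
  let ?vs = "map (\<lambda>f. f C s0) fs" and ?b = "list_bits (map s0 [0..<N])"
  obtain t s1 where 1: "exec C \<kappa> p s t s1" "\<forall>i<r. s1 i = s i"
    "\<forall>j<length fs. s1 (r + j) = (fs ! j) C s0" "t + list_bits ?vs \<le> T ?b"
    using p s unfolding computes_def by blast
  have vs: "map s1 [r..<r + length fs] = ?vs"
    using 1(3) by (auto intro: nth_equalityI)
  obtain u s2 where 2: "exec C \<kappa> q s1 u s2" "\<forall>i<r. s2 i = s1 i" "s2 r = g C ?vs"
    "u + bits (s2 r) \<le> U (list_bits ?vs)"
    using q vs unfolding applies_def by metis
  have "U (list_bits ?vs) \<le> U (T ?b)" using 1(4) poly_bounded_mono[OF U] by auto
  with exec.Seq[OF 1(1) 2(1)] 1(2,4) 2(2-4)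
  show "\<exists>t s'. exec C \<kappa> (Seq p q) s t s' \<and> (\<forall>i<r. s' i = s i) \<and>
    (\<forall>j<length [\<lambda>C s. g C (map (\<lambda>f. f C s) fs)].
       s' (r + j) = ([\<lambda>C s. g C (map (\<lambda>f. f C s) fs)] ! j) C s0) \<and>
    t + list_bits (map (\<lambda>f. f C s0) [\<lambda>C s. g C (map (\<lambda>f. f C s) fs)]) \<le> T ?b + U (T ?b)"
    by (intro exI[of _ "t + u"] exI[of _ s2]) auto
qed

text \<open>
  Closure under composition: compute the arguments side by side, then apply the operation.  All
  further closure properties are instances of this one.
\<close>

lemma polytime_register_op:
  assumes g: "register_op (length fs) g" and fs: "\<And>f. f \<in> set fs \<Longrightarrow> polytime f"
  shows "polytime (\<lambda>C s. g C (map (\<lambda>f. f C s) fs))"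
proof -
  obtain N where N: "\<And>r. r \<ge> N \<Longrightarrow> \<exists>p. \<forall>C \<kappa>. poly_cost \<kappa> \<longrightarrow>
     (\<exists>T. poly_bounded T \<and> computes C \<kappa> p N r fs T)"
    using polytime_list_if_polytime[of fs] fs unfolding polytime_list_def by blast
  show ?thesis
    unfolding polytime_def polytime_list_def
  proof (intro exI[of _ N] allI impI)
    fix r assume "N \<le> r"
    then obtain p q where
      "\<And>C \<kappa>. poly_cost \<kappa> \<Longrightarrow> \<exists>T. poly_bounded T \<and> computes C \<kappa> p N r fs T"
      "\<And>C \<kappa>. poly_cost \<kappa> \<Longrightarrow> \<exists>T. poly_bounded T \<and> applies C \<kappa> q r (length fs) g T"
      using N[of r] g unfolding register_op_def by blast
    then have "\<exists>T. poly_bounded T \<and>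
        computes C \<kappa> (Seq p q) N r [\<lambda>C s. g C (map (\<lambda>f. f C s) fs)] T" if "poly_cost \<kappa>" for C \<kappa>
      using that computes_Seq_applies[of C \<kappa> p N r fs _ q g] poly_bounded_add poly_bounded_comp
      by meson
    then show "\<exists>p. \<forall>C \<kappa>. poly_cost \<kappa> \<longrightarrow>
        (\<exists>T. poly_bounded T \<and> computes C \<kappa> p N r [\<lambda>C s. g C (map (\<lambda>f. f C s) fs)] T)"
      by blast
  qed
qed

section \<open>Elementary operations\<close>

fun while_free :: "com \<Rightarrow> bool" where
  "while_free (While_pos x p) = False"
| "while_free (Seq p q) = (while_free p \<and> while_free q)"
| "while_free (If_pos x p q) = (while_free p \<and> while_free q)"
| "while_free p = True"

text \<open>
  With this function, running a concrete program without loops becomes a matter of rewriting.  The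
  value at a loop is a dummy.
\<close>

fun outcome :: "real \<Rightarrow> (int list \<Rightarrow> nat) \<Rightarrow> com \<Rightarrow> state \<Rightarrow> nat \<times> state" where
  "outcome C \<kappa> Skip s = (1, s)"
| "outcome C \<kappa> (Const x n) s = (bits n, s(x := n))"
| "outcome C \<kappa> (Plus x y z) s = (bits (s y) + bits (s z), s(x := s y + s z))"
| "outcome C \<kappa> (Minus x y z) s = (bits (s y) + bits (s z), s(x := s y - s z))"
| "outcome C \<kappa> (Times x y z) s = (bits (s y) * bits (s z), s(x := s y * s z))"
| "outcome C \<kappa> (Div x y z) s = (bits (s y) * bits (s z), s(x := s y div s z))"
| "outcome C \<kappa> (Sign x ys) s = (1 + list_bits (map s ys) + \<kappa> (map s ys),
     s(x := (if eval_at C (map s ys) > 0 then 1 else if eval_at C (map s ys) < 0 then - 1 else 0)))"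
| "outcome C \<kappa> (Seq p q) s =
     (case outcome C \<kappa> p s of (t, s') \<Rightarrow> case outcome C \<kappa> q s' of (u, s'') \<Rightarrow> (t + u, s''))"
| "outcome C \<kappa> (If_pos x p q) s =
     (case outcome C \<kappa> (if s x > 0 then p else q) s of (t, s') \<Rightarrow> (bits (s x) + t, s'))"
| "outcome C \<kappa> (While_pos x p) s = (0, s)"

lemma exec_while_free:
  "while_free p \<Longrightarrow> outcome C \<kappa> p s = (t, s') \<Longrightarrow> exec C \<kappa> p s t s'"
proof (induction p arbitrary: s t s')
  case (Sign x ys)
  then show ?case using exec.Sign[of C \<kappa> x ys s] by simp
next
  case (Seq p q)
  then show ?case by (auto split: prod.splits intro!: exec.Seq)
next
  case (If_pos x p q)
  then show ?case by (cases "s x > 0") (auto split: prod.splits intro: exec.If_true exec.If_false)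
next
  case Skip
  then show ?case using exec.Skip[of C \<kappa> s] by simp
qed (auto intro: exec.intros)

lemma register_op_while_free:
  assumes "\<And>r. while_free (p r)"
    and "\<And>C \<kappa> r s i. i < r \<Longrightarrow> snd (outcome C \<kappa> (p r) s) i = s i"
    and "\<And>C \<kappa> r s. snd (outcome C \<kappa> (p r) s) r = g C (map s [r..<r + n])"
    and "\<And>C \<kappa>. poly_cost \<kappa> \<Longrightarrow> \<exists>T. poly_bounded T \<and> (\<forall>r s.
           fst (outcome C \<kappa> (p r) s) + bits (snd (outcome C \<kappa> (p r) s) r)
             \<le> T (list_bits (map s [r..<r + n])))"
  shows "register_op n g"
  unfolding register_op_def
proof
  fix r
  have "\<exists>T. poly_bounded T \<and> applies C \<kappa> (p r) r n g T" if \<kappa>: "poly_cost \<kappa>" for C \<kappa>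
  proof -
    obtain T where "poly_bounded T" and T: "\<And>s.
           fst (outcome C \<kappa> (p r) s) + bits (snd (outcome C \<kappa> (p r) s) r)
             \<le> T (list_bits (map s [r..<r + n]))"
      using assms(4)[OF \<kappa>] by blast
    moreover have "applies C \<kappa> (p r) r n g T"
      unfolding applies_def
      using assms(1-3) T exec_while_free[of "p r" C \<kappa> _ "fst (outcome C \<kappa> (p r) _)" "snd (outcome C \<kappa> (p r) _)"]
      by (metis prod.collapse)
    ultimately show ?thesis by blast
  qed
  then show "\<exists>p. \<forall>C \<kappa>. poly_cost \<kappa> \<longrightarrow> (\<exists>T. poly_bounded T \<and> applies C \<kappa> p r n g T)"
    by blast
qed

lemma register_op_add: "register_op 2 (\<lambda>C xs. xs ! 0 + xs ! 1)"
proof (rule register_op_while_free[where p = "\<lambda>r. Plus r r (Suc r)"])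
  show "\<exists>T. poly_bounded T \<and> (\<forall>r s. fst (outcome C \<kappa> (Plus r r (Suc r)) s) +
      bits (snd (outcome C \<kappa> (Plus r r (Suc r)) s) r) \<le> T (list_bits (map s [r..<r + 2])))" for C \<kappa>
    by (rule exI[of _ "\<lambda>x. x + x"])
       (auto intro: poly_bounded_intros bits_add simp: numeral_2_eq_2)
qed (auto simp: numeral_2_eq_2)

lemma register_op_diff: "register_op 2 (\<lambda>C xs. xs ! 0 - xs ! 1)"
proof (rule register_op_while_free[where p = "\<lambda>r. Minus r r (Suc r)"])
  show "\<exists>T. poly_bounded T \<and> (\<forall>r s. fst (outcome C \<kappa> (Minus r r (Suc r)) s) +
      bits (snd (outcome C \<kappa> (Minus r r (Suc r)) s) r) \<le> T (list_bits (map s [r..<r + 2])))" for C \<kappa>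
    by (rule exI[of _ "\<lambda>x. x + x"])
       (auto intro: poly_bounded_intros bits_diff simp: numeral_2_eq_2)
qed (auto simp: numeral_2_eq_2)

lemma register_op_mult: "register_op 2 (\<lambda>C xs. xs ! 0 * xs ! 1)"
proof (rule register_op_while_free[where p = "\<lambda>r. Times r r (Suc r)"])
  show "\<exists>T. poly_bounded T \<and> (\<forall>r s. fst (outcome C \<kappa> (Times r r (Suc r)) s) +
      bits (snd (outcome C \<kappa> (Times r r (Suc r)) s) r) \<le> T (list_bits (map s [r..<r + 2])))" for C \<kappa>
    by (rule exI[of _ "\<lambda>x. x * x + x"])
       (auto intro!: poly_bounded_intros add_mono mult_le_mono bits_mult simp: numeral_2_eq_2)
qed (auto simp: numeral_2_eq_2)

lemma register_op_div: "register_op 2 (\<lambda>C xs. xs ! 0 div xs ! 1)"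
proof (rule register_op_while_free[where p = "\<lambda>r. Div r r (Suc r)"])
  show "\<exists>T. poly_bounded T \<and> (\<forall>r s. fst (outcome C \<kappa> (Div r r (Suc r)) s) +
      bits (snd (outcome C \<kappa> (Div r r (Suc r)) s) r) \<le> T (list_bits (map s [r..<r + 2])))" for C \<kappa>
    by (intro exI[of _ "\<lambda>x. x * x + x"] conjI poly_bounded_intros)
       (auto intro!: add_mono mult_le_mono intro: le_trans[OF bits_div] simp: numeral_2_eq_2)
qed (auto simp: numeral_2_eq_2)

lemma register_op_const: "register_op 0 (\<lambda>C xs. k)"
proof (rule register_op_while_free[where p = "\<lambda>r. Const r k"])
  show "\<exists>T. poly_bounded T \<and> (\<forall>r s. fst (outcome C \<kappa> (Const r k) s) +
      bits (snd (outcome C \<kappa> (Const r k) s) r) \<le> T (list_bits (map s [r..<r + 0])))" for C \<kappa>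
    by (rule exI[of _ "\<lambda>x. 2 * bits k"]) (auto intro: poly_bounded_intros)
qed auto

lemma register_op_if: "register_op 3 (\<lambda>C xs. if xs ! 0 > 0 then xs ! 1 else xs ! 2)"
proof (rule register_op_while_free[where
      p = "\<lambda>r. If_pos r (Seq (Const r 0) (Plus r r (r + 1))) (Seq (Const r 0) (Plus r r (r + 2)))"])
  show "\<exists>T. poly_bounded T \<and> (\<forall>r s.
      fst (outcome C \<kappa> (If_pos r (Seq (Const r 0) (Plus r r (r + 1)))
        (Seq (Const r 0) (Plus r r (r + 2)))) s) +
      bits (snd (outcome C \<kappa> (If_pos r (Seq (Const r 0) (Plus r r (r + 1)))
        (Seq (Const r 0) (Plus r r (r + 2)))) s) r) \<le> T (list_bits (map s [r..<r + 3])))" for C \<kappa>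
    by (intro exI[of _ "\<lambda>x. x + x + 2"] conjI poly_bounded_intros)
       (auto simp: numeral_3_eq_3)
qed (auto simp: numeral_3_eq_3)

text \<open>
  This is the only place where the price \<open>\<kappa>\<close> of a sign test, and hence its polynomial bound,
  enters.
\<close>

lemma register_op_sign:
  "register_op n (\<lambda>C xs. if eval_at C xs > 0 then 1 else if eval_at C xs < 0 then - 1 else 0)"
proof (rule register_op_while_free[where p = "\<lambda>r. Sign r [r..<r + n]"])
  fix C \<kappa> assume "poly_cost \<kappa>"
  then obtain T where T: "poly_bounded T" "\<And>ys. \<kappa> ys \<le> T (list_bits ys)"
    by (metis poly_cost_bounded)
  have bits: "bits 1 = 2" "bits (- 1) = 2" by (simp_all add: bits_def floorlog_def)
  show "\<exists>T. poly_bounded T \<and> (\<forall>r s. fst (outcome C \<kappa> (Sign r [r..<r + n]) s) +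
      bits (snd (outcome C \<kappa> (Sign r [r..<r + n]) s) r) \<le> T (list_bits (map s [r..<r + n])))"
    by (intro exI[of _ "\<lambda>x. x + T x + 3"] conjI poly_bounded_intros T(1))
       (auto simp: bits intro: le_SucI T(2))
qed auto

named_theorems polytime_intros

lemma polytime_var [polytime_intros]: "polytime (\<lambda>C s. s i)"
  unfolding polytime_def polytime_list_def
proof (intro exI[of _ "Suc i"] allI impI)
  fix r assume r: "Suc i \<le> r"
  have "computes C \<kappa> (Seq (Const r 0) (Plus r r i)) (Suc i) r [\<lambda>C s. s i] (\<lambda>x. x + x + 2)" for C \<kappa>
    unfolding computes_def
  proof (intro allI impI)
    fix s s0 :: state assume s: "\<forall>j<Suc i. s j = s0 j"
    have "exec C \<kappa> (Seq (Const r 0) (Plus r r i)) s (2 + bits (s i)) (s(r := s i))"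
      using r by (intro exec_while_free) auto
    then show "\<exists>t s'. exec C \<kappa> (Seq (Const r 0) (Plus r r i)) s t s' \<and> (\<forall>i<r. s' i = s i) \<and>
       (\<forall>j<length [\<lambda>C s. s i]. s' (r + j) = ([\<lambda>C s. s i] ! j) C s0) \<and>
       t + list_bits (map (\<lambda>f. f C s0) [\<lambda>C s. s i])
         \<le> list_bits (map s0 [0..<Suc i]) + list_bits (map s0 [0..<Suc i]) + 2"
      using s by (intro exI[of _ "2 + bits (s i)"] exI[of _ "s(r := s i)"]) auto
  qed
  then show "\<exists>p. \<forall>C \<kappa>. poly_cost \<kappa> \<longrightarrow>
      (\<exists>T. poly_bounded T \<and> computes C \<kappa> p (Suc i) r [\<lambda>C s. s i] T)"
    using poly_bounded_add[OF poly_bounded_add[OF poly_bounded_id poly_bounded_id] poly_bounded_const]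
    by blast
qed

lemma polytime_const [polytime_intros]: "polytime (\<lambda>C s. k)"
  using polytime_register_op[of "[]" "\<lambda>C xs. k"] register_op_const[of k] by simp

lemma polytime_binary:
  assumes "register_op 2 (\<lambda>C xs. h (xs ! 0) (xs ! 1))" "polytime f" "polytime g"
  shows "polytime (\<lambda>C s. h (f C s) (g C s))"
  using polytime_register_op[of "[f, g]" "\<lambda>C xs. h (xs ! 0) (xs ! 1)"] assms
  by (auto simp: numeral_2_eq_2)

lemmas polytime_add [polytime_intros] = polytime_binary[OF register_op_add]
lemmas polytime_diff [polytime_intros] = polytime_binary[OF register_op_diff]
lemmas polytime_mult [polytime_intros] = polytime_binary[OF register_op_mult]
lemmas polytime_div [polytime_intros] = polytime_binary[OF register_op_div]

lemma polytime_minus [polytime_intros]: "polytime f \<Longrightarrow> polytime (\<lambda>C s. - f C s)"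
  using polytime_diff[OF polytime_const[of 0]] by simp

lemma polytime_if_pos:
  assumes "polytime c" "polytime f" "polytime g"
  shows "polytime (\<lambda>C s. if c C s > 0 then f C s else g C s)"
proof -
  have "polytime (\<lambda>C s. (\<lambda>C xs. if xs ! 0 > 0 then xs ! 1 else xs ! 2) C (map (\<lambda>f. f C s) [c, f, g]))"
    using assms register_op_if by (intro polytime_register_op) (auto simp: numeral_3_eq_3)
  then show ?thesis by (simp add: numeral_2_eq_2 cong: if_cong)
qed

lemma polytime_sign:
  assumes "\<And>f. f \<in> set fs \<Longrightarrow> polytime f"
  shows "polytime (\<lambda>C s. if eval_at C (map (\<lambda>f. f C s) fs) > 0 then 1
           else if eval_at C (map (\<lambda>f. f C s) fs) < 0 then - 1 else 0)"
  using polytime_register_op[OF register_op_sign[of "length fs"] assms] .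

section \<open>Loops: greatest common divisors and integer square roots\<close>

text \<open>
  If the measure drops in every round and a round costs at most \<open>c\<close>, the loop costs at most
  \<open>c\<close> times the initial measure plus one.  The measures used below are bit lengths, so the number
  of rounds is linear in the length of the input.
\<close>

lemma exec_while_measure:
  assumes step: "\<And>s. I s \<Longrightarrow> s x > 0 \<Longrightarrow>
      \<exists>t s'. exec C \<kappa> p s t s' \<and> I s' \<and> m s' < m s \<and> bits (s x) + t \<le> c"
    and stop: "\<And>s. I s \<Longrightarrow> bits (s x) \<le> c"
    and "I s"
  shows "\<exists>t s'. exec C \<kappa> (While_pos x p) s t s' \<and> I s' \<and> \<not> s' x > 0 \<and> t \<le> c * (m s + 1)"
  using \<open>I s\<close>
proof (induction "m s" arbitrary: s rule: less_induct)
  case less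
  show ?case
  proof (cases "s x > 0")
    case True
    then obtain t s1 where 1: "exec C \<kappa> p s t s1" "I s1" "m s1 < m s" "bits (s x) + t \<le> c"
      using step less.prems by blast
    then obtain u s2 where 2: "exec C \<kappa> (While_pos x p) s1 u s2" "I s2" "\<not> s2 x > 0"
      "u \<le> c * (m s1 + 1)"
      using less.hyps by blast
    have "c * (m s1 + 1) + c \<le> c * (m s + 1)"
      using mult_le_mono2[of "m s1 + 2" "m s + 1" c] 1(3) by (simp add: algebra_simps)
    with 1 2 show ?thesis
      by (intro exI[of _ "bits (s x) + t + u"] exI[of _ s2])
         (auto intro!: exec.While_true[where s' = s1] simp: True)
  next
    case False
    with less.prems stop[of s] show ?thesis
      by (intro exI[of _ "bits (s x)"] exI[of _ s]) (auto intro: exec.While_false)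
  qed
qed

lemma floorlog_less:
  assumes "2 * a \<le> b" "0 < b"
  shows "floorlog 2 a < floorlog 2 b"
proof -
  have "floorlog 2 b = Suc (floorlog 2 (b div 2))"
    using assms compute_floorlog[of 2 b] by simp
  moreover have "floorlog 2 a \<le> floorlog 2 (b div 2)"
    using assms by (intro floorlog_mono) simp
  ultimately show ?thesis by simp
qed

text \<open>
  One division step \<open>(x, y) := (y, x mod y)\<close> on the registers \<open>r\<close> and \<open>r + 1\<close>.  Register
  \<open>r + 3\<close> holds 0, because copying is addition of 0.
\<close>

definition euclid_step :: "nat \<Rightarrow> com" where
  "euclid_step r = Seq (Div (r + 2) r (r + 1)) (Seq (Times (r + 2) (r + 2) (r + 1))
     (Seq (Minus (r + 2) r (r + 2)) (Seq (Plus r (r + 1) (r + 3)) (Plus (r + 1) (r + 2) (r + 3)))))"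

text \<open>
  For \<open>0 < y < x\<close> the remainder is less than half of \<open>x\<close>, so the product of the two numbers is
  halved in each step and its bit length decreases.  Only the first step can start with
  \<open>x \<le> y\<close>; the second case of the definition accounts for it.
\<close>

definition euclid_measure :: "int \<Rightarrow> int \<Rightarrow> nat" where
  "euclid_measure x y = (if y \<le> 0 then 0 else if y < x then floorlog 2 (nat (x * y))
     else Suc (floorlog 2 (nat (y * y))))"

lemma euclid_measure_less:
  assumes "0 < y"
  shows "euclid_measure y (x mod y) < euclid_measure x y"
proof (cases "y < x")
  case True
  let ?z = "x mod y"
  have z: "0 \<le> ?z" "?z < y" using assms by simp_all
  have "1 \<le> x div y" using True assms by (simp add: pos_imp_zdiv_pos_iff int_one_le_iff_zero_less)
  then have "1 * y \<le> x div y * y" using assms by (intro mult_right_mono) auto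
  then have "2 * ?z \<le> x" using z div_mult_mod_eq[of x y] by linarith
  then have "y * (2 * ?z) \<le> y * x" using assms by (intro mult_left_mono) auto
  then have "nat (2 * (y * ?z)) \<le> nat (x * y)" by (intro nat_mono) (simp add: algebra_simps)
  then have "2 * nat (y * ?z) \<le> nat (x * y)" by (simp add: nat_mult_distrib)
  then have "floorlog 2 (nat (y * ?z)) < floorlog 2 (nat (x * y))"
    using assms True by (intro floorlog_less) auto
  with True z assms show ?thesis by (simp add: euclid_measure_def)
next
  case False
  have z: "0 \<le> x mod y" "x mod y < y" using assms by simp_all
  then have "floorlog 2 (nat (y * (x mod y))) \<le> floorlog 2 (nat (y * y))"
    using assms by (intro floorlog_mono nat_mono mult_left_mono) (auto simp: less_imp_le)
  with False z assms show ?thesis by (simp add: euclid_measure_def)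
qed

text \<open>
  The default value for a nonpositive second argument is what the loop returns when it is not
  entered.
\<close>

lemma register_op_gcd: "register_op 2 (\<lambda>C xs. if xs ! 1 \<le> 0 then xs ! 0 else gcd (xs ! 0) (xs ! 1))"
  unfolding register_op_def
proof (intro allI exI impI conjI)
  fix r C \<kappa>
  \<comment> \<open>A round takes at most \<open>2 B\<^sup>2 + 8 B\<close> bit operations, and there are at most \<open>2 B + 1\<close> rounds.\<close>
  let ?T = "\<lambda>B::nat. 2 + (2 * (B * B) + 8 * B) * (2 * B + 2) + B"
  show "poly_bounded ?T" by (intro poly_bounded_intros)
  show "applies C \<kappa> (Seq (Const (r + 3) 0) (While_pos (r + 1) (euclid_step r))) r 2
      (\<lambda>C xs. if xs ! 1 \<le> 0 then xs ! 0 else gcd (xs ! 0) (xs ! 1)) ?T"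
    unfolding applies_def
  proof
    fix s :: state
    define a b where "a = s r" "b = s (r + 1)"
    \<comment> \<open>The numbers \<open>x\<close> and \<open>y\<close> never exceed \<open>M\<close> in absolute value.\<close>
    define M where "M = \<bar>a\<bar> + \<bar>b\<bar>"
    define B where "B = bits M"
    define I where "I s' \<longleftrightarrow> (\<forall>i<r. s' i = s i) \<and> s' (r + 3) = 0 \<and> \<bar>s' r\<bar> \<le> M \<and> s' (r + 1) \<le> M \<and>
       (if b \<le> 0 then s' r = a \<and> s' (r + 1) = b
        else 0 \<le> s' (r + 1) \<and> gcd (s' r) (s' (r + 1)) = gcd a b \<and> (s' (r + 1) = 0 \<longrightarrow> 0 \<le> s' r))"
      for s' :: state
    define m where "m s' = euclid_measure (s' r) (s' (r + 1))" for s' :: state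
    have small: "bits x \<le> B" if "\<bar>x\<bar> \<le> M" for x
      unfolding B_def by (rule bits_mono) (use that in auto)
    have step: "\<exists>t s2. exec C \<kappa> (euclid_step r) s1 t s2 \<and> I s2 \<and> m s2 < m s1 \<and>
        bits (s1 (r + 1)) + t \<le> 2 * (B * B) + 8 * B" if I: "I s1" and pos: "s1 (r + 1) > 0" for s1
    proof -
      define x y where "x = s1 r" "y = s1 (r + 1)"
      note xy = this
      have y: "0 < y" and xM: "\<bar>x\<bar> \<le> M" "y \<le> M" and b: "0 < b"
        using I pos by (auto simp: I_def xy a_b_def split: if_splits)
      have z: "0 \<le> x mod y" "x mod y < y" using y by simp_all
      define s2 where "s2 = s1(r + 2 := x mod y, r := y, r + 1 := x mod y)"
      define t where "t = bits x * bits y + (bits (x div y) * bits y + (bits x + bits (x div y * y)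
        + (bits y + bits 0 + (bits (x mod y) + bits 0))))"
      have "s1 (r + 3) = 0" using I by (simp add: I_def)
      then have "outcome C \<kappa> (euclid_step r) s1 = (t, s2)"
        by (simp add: euclid_step_def s2_def t_def xy minus_div_mult_eq_mod)
      then have "exec C \<kappa> (euclid_step r) s1 t s2"
        by (intro exec_while_free) (auto simp: euclid_step_def)
      moreover have "I s2"
      proof -
        have "gcd y (x mod y) = gcd a b" "\<forall>i<r. s1 i = s i"
          using I b gcd_red_int[of x y] by (auto simp: I_def xy)
        with \<open>s1 (r + 3) = 0\<close> b y z xM show ?thesis by (simp add: I_def s2_def)
      qed
      moreover have "m s2 < m s1"
        using euclid_measure_less[OF y, of x] by (simp add: m_def s2_def xy)
      moreover have "bits y + t \<le> 2 * (B * B) + 8 * B"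
      proof -
        have 1: "bits x \<le> B" "bits y \<le> B" "bits (x div y) \<le> B" "bits (x mod y) \<le> B"
          using xM y z abs_div_le[of x y] by (auto intro!: small)
        have "bits (x div y * y) \<le> B + B" using bits_mult[of "x div y" y] 1 by linarith
        moreover have "bits x * bits y \<le> B * B" "bits (x div y) * bits y \<le> B * B"
          using 1 by (auto intro: mult_le_mono)
        moreover have "1 \<le> B" unfolding B_def by (rule bits_pos)
        ultimately show ?thesis using 1 unfolding t_def by simp
      qed
      ultimately show ?thesis unfolding xy by blast
    qed
    have stop: "bits (s1 (r + 1)) \<le> 2 * (B * B) + 8 * B" if "I s1" for s1
    proof -
      have "\<bar>s1 (r + 1)\<bar> \<le> M" using that by (auto simp: I_def M_def split: if_splits)
      then show ?thesis using small[of "s1 (r + 1)"] by simp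
    qed
    let ?s = "s(r + 3 := 0)"
    have "I ?s" by (auto simp: I_def a_b_def M_def)
    with exec_while_measure[of I "r + 1" C \<kappa> "euclid_step r" m "2 * (B * B) + 8 * B" ?s] step stop
    obtain t s' where 1: "exec C \<kappa> (While_pos (r + 1) (euclid_step r)) ?s t s'" "I s'"
      "\<not> s' (r + 1) > 0" "t \<le> (2 * (B * B) + 8 * B) * (m ?s + 1)" by blast
    have res: "s' r = (if b \<le> 0 then a else gcd a b)"
      using 1(2,3) by (auto simp: I_def split: if_splits)
    have frame: "\<forall>i<r. s' i = s i" using 1(2) by (simp add: I_def)
    have m: "m ?s \<le> 2 * B + 1"
    proof -
      have *: "floorlog 2 (nat (x * y)) \<le> 2 * B" if "\<bar>x\<bar> \<le> M" "\<bar>y\<bar> \<le> M" for x y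
      proof (cases "x * y \<le> 0")
        case True then show ?thesis by (simp add: floorlog_def)
      next
        case False
        then have "floorlog 2 (nat (x * y)) \<le> bits (x * y)" by (simp add: bits_def)
        also have "\<dots> \<le> 2 * B" using bits_mult[of x y] small that by (metis add_mono le_trans mult_2)
        finally show ?thesis .
      qed
      show ?thesis
        unfolding m_def euclid_measure_def using *[of a b] *[of b b]
        by (auto simp: a_b_def M_def)
    qed
    let ?L = "list_bits (map s [r..<r + 2])"
    have inputs: "map s [r..<r + 2] = [a, b]" by (simp add: a_b_def numeral_2_eq_2)
    then have L: "?L = bits a + bits b" by simp
    have BL: "B \<le> ?L" unfolding B_def M_def L using bits_add[of "\<bar>a\<bar>" "\<bar>b\<bar>"] by simp
    have resM: "\<bar>s' r\<bar> \<le> M" using 1(2) by (auto simp: I_def)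
    have "t \<le> (2 * (?L * ?L) + 8 * ?L) * (2 * ?L + 2)"
    proof (rule le_trans[OF 1(4)], rule mult_le_mono)
      show "2 * (B * B) + 8 * B \<le> 2 * (?L * ?L) + 8 * ?L"
        using BL by (intro add_mono mult_le_mono) auto
      show "m ?s + 1 \<le> 2 * ?L + 2" using m BL by linarith
    qed
    then have "1 + t + bits (s' r) \<le> ?T ?L"
      using small[OF resM] BL by linarith
    moreover have "exec C \<kappa> (Seq (Const (r + 3) 0) (While_pos (r + 1) (euclid_step r))) s (1 + t) s'"
      using exec.Seq[OF exec.Const[of C \<kappa> "r + 3" 0 s] 1(1)] by simp
    ultimately show "\<exists>t s'. exec C \<kappa> (Seq (Const (r + 3) 0) (While_pos (r + 1) (euclid_step r))) s t s' \<and>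
       (\<forall>i<r. s' i = s i) \<and>
       s' r = (\<lambda>C xs. if xs ! 1 \<le> 0 then xs ! 0 else gcd (xs ! 0) (xs ! 1)) C (map s [r..<r + 2]) \<and>
       t + bits (s' r) \<le> ?T ?L"
      using res frame inputs by (intro exI[of _ "1 + t"] exI[of _ s'] conjI) auto
  qed
qed

text \<open>
  Register \<open>r\<close> holds \<open>n\<close>, the registers \<open>r + 1\<close> and \<open>r + 2\<close> the ends \<open>lo < hi\<close> of an interval
  with \<open>lo\<^sup>2 \<le> n < hi\<^sup>2\<close>, and \<open>r + 3\<close> the number \<open>hi - lo - 1\<close> that controls the loop.  The
  constants 2, 0 and 1 are kept in \<open>r + 4\<close>, \<open>r + 7\<close> and \<open>r + 8\<close>.
\<close>

definition bisection_step :: "nat \<Rightarrow> com" where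
  "bisection_step r = Seq (Plus (r + 5) (r + 1) (r + 2)) (Seq (Div (r + 5) (r + 5) (r + 4))
     (Seq (Times (r + 6) (r + 5) (r + 5)) (Seq (Minus (r + 6) (r + 6) r)
     (Seq (If_pos (r + 6) (Plus (r + 2) (r + 5) (r + 7)) (Plus (r + 1) (r + 5) (r + 7)))
     (Seq (Minus (r + 3) (r + 2) (r + 1)) (Minus (r + 3) (r + 3) (r + 8)))))))"

definition bisection_init :: "nat \<Rightarrow> com" where
  "bisection_init r = Seq (Const (r + 1) 0) (Seq (Const (r + 4) 2) (Seq (Const (r + 7) 0)
     (Seq (Const (r + 8) 1) (Seq (Plus (r + 2) r (r + 8)) (Plus (r + 3) r (r + 7))))))"

text \<open>
  Bisection: the number \<open>hi - lo - 1\<close> of interior points of the interval is at least halved in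
  every round, and the loop ends with \<open>hi = lo + 1\<close>.
\<close>

lemma register_op_sqrt: "register_op 1 (\<lambda>C xs. if xs ! 0 < 0 then 0 else \<lfloor>sqrt (real_of_int (xs ! 0))\<rfloor>)"
  unfolding register_op_def
proof (intro allI exI impI conjI)
  fix r C \<kappa>
  let ?p = "Seq (bisection_init r) (Seq (While_pos (r + 3) (bisection_step r)) (Plus r (r + 1) (r + 7)))"
  \<comment> \<open>A round takes at most \<open>30 (L + 2)\<^sup>2\<close> bit operations, and there are at most \<open>L + 2\<close> rounds.\<close>
  let ?T = "\<lambda>L::nat. 20 + 20 * L + 30 * (L + 2) * (L + 2) * (L + 3)"
  show "poly_bounded ?T" by (intro poly_bounded_intros)
  show "applies C \<kappa> ?p r 1 (\<lambda>C xs. if xs ! 0 < 0 then 0 else \<lfloor>sqrt (real_of_int (xs ! 0))\<rfloor>) ?T"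
    unfolding applies_def
  proof
    fix s :: state
    define n where "n = s r"
    define M where "M = \<bar>n\<bar> + 1"
    define B where "B = bits M"
    define I where "I s' \<longleftrightarrow> (\<forall>i<r. s' i = s i) \<and> s' r = n \<and> s' (r + 4) = 2 \<and> s' (r + 7) = 0 \<and>
       s' (r + 8) = 1 \<and> 0 \<le> s' (r + 1) \<and> s' (r + 3) = s' (r + 2) - s' (r + 1) - 1 \<and>
       (if n < 0 then s' (r + 1) = 0 \<and> s' (r + 2) = n + 1 else
        s' (r + 1) < s' (r + 2) \<and> s' (r + 2) \<le> M \<and> (s' (r + 1))\<^sup>2 \<le> n \<and> n < (s' (r + 2))\<^sup>2)"
      for s' :: state
    define m where "m s' = floorlog 2 (nat (s' (r + 3)))" for s' :: state
    have small: "bits x \<le> B" if "\<bar>x\<bar> \<le> M" for x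
      unfolding B_def by (rule bits_mono) (use that in auto)
    have B1: "1 \<le> B" unfolding B_def by (rule bits_pos)
    have B2: "bits 2 = 3" "bits 1 = 2" by (simp_all add: bits_def floorlog_def)
    have step: "\<exists>t s2. exec C \<kappa> (bisection_step r) s1 t s2 \<and> I s2 \<and> m s2 < m s1 \<and>
        bits (s1 (r + 3)) + t \<le> 30 * (B * B)" if I: "I s1" and pos: "s1 (r + 3) > 0" for s1
    proof -
      define lo hi where "lo = s1 (r + 1)" "hi = s1 (r + 2)"
      define mid where "mid = (lo + hi) div 2"
      note lh = lo_hi_def
      have n: "0 \<le> n" using I pos by (auto simp: I_def split: if_splits)
      have h: "0 \<le> lo" "lo + 1 < hi" "hi \<le> M" "lo\<^sup>2 \<le> n" "n < hi\<^sup>2"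
        using I pos n by (auto simp: I_def lh)
      have md: "lo < mid" "mid < hi" using h unfolding mid_def by linarith+
      define lo' hi' where "lo' = (if mid * mid - n > 0 then lo else mid)"
        "hi' = (if mid * mid - n > 0 then mid else hi)"
      define s2 where "s2 = s1(r + 5 := mid, r + 6 := mid * mid - n, r + 2 := hi', r + 1 := lo',
        r + 3 := hi' - lo' - 1)"
      define t where "t = bits lo + bits hi + (bits (lo + hi) * bits 2 + (bits mid * bits mid +
        (bits (mid * mid) + bits n + (bits (mid * mid - n) + (bits mid + bits 0) +
        (bits hi' + bits lo' + (bits (hi' - lo') + bits 1))))))"
      have "s1 r = n" "s1 (r + 4) = 2" "s1 (r + 7) = 0" "s1 (r + 8) = 1"
        using I by (simp_all add: I_def)
      then have "outcome C \<kappa> (bisection_step r) s1 = (t, s2)"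
        by (auto simp: bisection_step_def s2_def t_def lh lo'_hi'_def mid_def fun_eq_iff)
      then have "exec C \<kappa> (bisection_step r) s1 t s2"
        by (intro exec_while_free) (auto simp: bisection_step_def)
      moreover have "I s2"
        using I n h md by (auto simp: I_def s2_def lo'_hi'_def lh power2_eq_square)
      moreover have "m s2 < m s1"
      proof -
        have "2 * (hi' - lo' - 1) \<le> hi - lo - 1" using h md unfolding lo'_hi'_def mid_def by auto
        moreover have "s1 (r + 3) = hi - lo - 1" using I by (simp add: I_def lh)
        ultimately show ?thesis
          using pos unfolding m_def by (intro floorlog_less) (auto simp: s2_def)
      qed
      moreover have "bits (s1 (r + 3)) + t \<le> 30 * (B * B)"
      proof -
        have lo'hi': "0 \<le> lo'" "lo' < hi'" "hi' \<le> M" using h md by (auto simp: lo'_hi'_def)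
        have s13: "s1 (r + 3) = hi - lo - 1" using I by (simp add: I_def lh)
        have 1: "bits lo \<le> B" "bits hi \<le> B" "bits mid \<le> B" "bits n \<le> B" "bits lo' \<le> B"
           "bits hi' \<le> B" "bits (hi' - lo') \<le> B" "bits (s1 (r + 3)) \<le> B"
          using h md lo'hi' n unfolding s13 by (auto intro!: small simp: M_def)
        have 2: "bits (lo + hi) \<le> 2 * B" using bits_add[of lo hi] 1 by linarith
        have 3: "bits (mid * mid) \<le> 2 * B" using bits_mult[of mid mid] 1 by linarith
        have 4: "bits (mid * mid - n) \<le> 3 * B" using bits_diff[of "mid * mid" n] 3 1 by linarith
        have 5: "bits mid * bits mid \<le> B * B" using 1 by (intro mult_le_mono)
        have 6: "B \<le> B * B" by simp
        show ?thesis using 1 2 3 4 5 6 B1 unfolding t_def B2 bits_0 by linarith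
      qed
      ultimately show ?thesis by blast
    qed
    have stop: "bits (s1 (r + 3)) \<le> 30 * (B * B)" if "I s1" for s1
    proof -
      have "\<bar>s1 (r + 3)\<bar> \<le> M" using that by (auto simp: I_def M_def split: if_splits)
      then have "bits (s1 (r + 3)) \<le> B" by (rule small)
      also have "B \<le> B * B" by simp
      finally show ?thesis by linarith
    qed
    define s1 where "s1 = s(r + 1 := 0, r + 4 := 2, r + 7 := 0, r + 8 := 1, r + 2 := n + 1, r + 3 := n)"
    have init: "exec C \<kappa> (bisection_init r) s (1 + (3 + (1 + (2 + (bits n + 2 + (bits n + 1)))))) s1"
      by (rule exec_while_free) (auto simp: bisection_init_def s1_def n_def B2 fun_eq_iff)
    have sq: "n < (n + 1)\<^sup>2" if "0 \<le> n"
    proof -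
      have "n < 1 * (n + 1)" by simp
      also have "\<dots> \<le> (n + 1) * (n + 1)" using that by (intro mult_right_mono) auto
      finally show ?thesis by (simp only: power2_eq_square)
    qed
    have s1: "s1 (r + 1) = 0" "s1 (r + 2) = n + 1" "s1 (r + 3) = n" "s1 (r + 4) = 2"
        "s1 (r + 7) = 0" "s1 (r + 8) = 1" "s1 r = n" "\<forall>i<r. s1 i = s i"
      by (simp_all add: s1_def n_def)
    have "I s1" unfolding I_def s1 using sq by (auto simp: s1 M_def)
    with exec_while_measure[of I "r + 3" C \<kappa> "bisection_step r" m "30 * (B * B)" s1] step stop
    obtain t s' where 1: "exec C \<kappa> (While_pos (r + 3) (bisection_step r)) s1 t s'" "I s'"
      "\<not> s' (r + 3) > 0" "t \<le> (30 * (B * B)) * (m s1 + 1)" by blast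
    have res: "s' (r + 1) = (if n < 0 then 0 else \<lfloor>sqrt (real_of_int n)\<rfloor>)"
    proof (cases "n < 0")
      case False
      then have "s' (r + 2) = s' (r + 1) + 1" using 1(2,3) unfolding I_def by auto
      with False have h: "0 \<le> s' (r + 1)" "(s' (r + 1))\<^sup>2 \<le> n" "n < (s' (r + 1) + 1)\<^sup>2"
        using 1(2) unfolding I_def by auto
      have "real_of_int (s' (r + 1)) \<le> sqrt n"
        using h(1,2) by (intro real_le_rsqrt) (simp flip: of_int_power)
      moreover have "sqrt n < real_of_int (s' (r + 1)) + 1"
      proof (rule real_less_lsqrt)
        have "real_of_int n < real_of_int ((s' (r + 1) + 1)\<^sup>2)" using h(3) by (simp only: of_int_less_iff)
        then show "real_of_int n < (real_of_int (s' (r + 1)) + 1)\<^sup>2" by simp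
      qed (use h False in auto)
      ultimately show ?thesis using False by (simp add: floor_eq_iff[THEN iffD2])
    qed (use 1(2) in \<open>auto simp: I_def\<close>)
    have resM: "\<bar>s' (r + 1)\<bar> \<le> M"
      using 1(2) by (auto simp: I_def M_def split: if_splits)
    have m: "m s1 \<le> B"
    proof -
      have "m s1 \<le> floorlog 2 (nat \<bar>n\<bar>)"
        unfolding m_def s1 by (intro floorlog_mono nat_mono) simp
      also have "\<dots> \<le> bits n" by (simp add: bits_def)
      also have "\<dots> \<le> B" by (rule small) (simp add: M_def)
      finally show ?thesis .
    qed
    have frame: "\<forall>i<r. s' i = s i" using 1(2) by (simp add: I_def)
    let ?L = "list_bits (map s [r..<r + 1])"
    have L: "?L = bits n" by (simp add: n_def)
    have BL: "B \<le> ?L + 2" unfolding B_def M_def L using bits_add[of "\<bar>n\<bar>" 1] B2 by simp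
    have "t \<le> 30 * (?L + 2) * (?L + 2) * (?L + 3)"
      using 1(4) by (rule le_trans) (unfold mult.assoc, intro mult_le_mono; use m BL in auto)
    then have bound: "10 + 2 * bits n + t + bits (s' (r + 1)) + 1 + bits (s' (r + 1)) \<le> ?T ?L"
      using small[OF resM] BL unfolding L by linarith
    have fin: "exec C \<kappa> (Plus r (r + 1) (r + 7)) s' (bits (s' (r + 1)) + 1) (s'(r := s' (r + 1)))"
      by (rule exec_while_free) (use 1(2) in \<open>auto simp: I_def\<close>)
    have "1 + (3 + (1 + (2 + (bits n + 2 + (bits n + 1))))) + (t + (bits (s' (r + 1)) + 1))
        = 10 + 2 * bits n + t + bits (s' (r + 1)) + 1" by simp
    with exec.Seq[OF init exec.Seq[OF 1(1) fin]]
    have "exec C \<kappa> ?p s (10 + 2 * bits n + t + bits (s' (r + 1)) + 1) (s'(r := s' (r + 1)))"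
      by (simp only:)
    then show "\<exists>t s'. exec C \<kappa> ?p s t s' \<and> (\<forall>i<r. s' i = s i) \<and>
       s' r = (\<lambda>C xs. if xs ! 0 < 0 then 0 else \<lfloor>sqrt (real_of_int (xs ! 0))\<rfloor>) C (map s [r..<r + 1]) \<and>
       t + bits (s' r) \<le> ?T ?L"
      using res frame bound
      by (intro exI[of _ "10 + 2 * bits n + t + bits (s' (r + 1)) + 1"]
          exI[of _ "s'(r := s' (r + 1))"] conjI) (simp_all add: n_def)
  qed
qed

section \<open>Decidable conditions and real numbers with a computable sign\<close>

text \<open>
  Conditions are treated as functions with values 0 and 1, which makes them available both for
  branching and, as factors, for case distinctions inside arithmetic expressions.
\<close>

definition decidable :: "(real \<Rightarrow> state \<Rightarrow> bool) \<Rightarrow> bool" where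
  "decidable P \<longleftrightarrow> polytime (\<lambda>C s. of_bool (P C s))"

lemma polytime_if [polytime_intros]:
  assumes "decidable P" "polytime f" "polytime g"
  shows "polytime (\<lambda>C s. if P C s then f C s else g C s)"
  using polytime_if_pos[of "\<lambda>C s. of_bool (P C s)" f g] assms
  by (simp add: decidable_def)

lemma polytime_of_bool [polytime_intros]: "decidable P \<Longrightarrow> polytime (\<lambda>C s. of_bool (P C s))"
  by (simp add: decidable_def)

lemma decidable_pos: "polytime f \<Longrightarrow> decidable (\<lambda>C s. 0 < f C s)"
  unfolding decidable_def using polytime_if_pos[of f "\<lambda>C s. 1" "\<lambda>C s. 0"]
  by (simp add: polytime_const of_bool_def)

lemma decidable_const [polytime_intros]: "decidable (\<lambda>C s. b)"
  unfolding decidable_def by (rule polytime_const)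

lemma decidable_not [polytime_intros]:
  assumes "decidable P"
  shows "decidable (\<lambda>C s. \<not> P C s)"
  unfolding decidable_def of_bool_not_iff using assms by (intro polytime_intros)

lemma decidable_and [polytime_intros]:
  assumes "decidable P" "decidable Q"
  shows "decidable (\<lambda>C s. P C s \<and> Q C s)"
  unfolding decidable_def of_bool_conj using assms by (intro polytime_intros)

lemma decidable_or [polytime_intros]:
  assumes "decidable P" "decidable Q"
  shows "decidable (\<lambda>C s. P C s \<or> Q C s)"
  using decidable_not[OF decidable_and[OF assms[THEN decidable_not]]] by simp

lemma decidable_imp [polytime_intros]:
  assumes "decidable P" "decidable Q"
  shows "decidable (\<lambda>C s. P C s \<longrightarrow> Q C s)"
  unfolding imp_conv_disj by (rule decidable_or[OF decidable_not[OF assms(1)] assms(2)])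

lemma polytime_abs [polytime_intros]:
  assumes "polytime f"
  shows "polytime (\<lambda>C s. \<bar>f C s\<bar>)"
  unfolding abs_if using assms polytime_const[of 0]
    decidable_pos[of "\<lambda>C s. 0 - f C s"] polytime_minus[OF assms]
  by (intro polytime_if) (auto intro: polytime_intros)

lemma polytime_cong:
  assumes "polytime f" "\<And>C s. f C s = g C s"
  shows "polytime g"
proof -
  have "f = g" using assms(2) by (intro ext)
  with assms(1) show ?thesis by simp
qed

lemma polytime_gcd [polytime_intros]:
  assumes "polytime f" "polytime g"
  shows "polytime (\<lambda>C s. gcd (f C s) (g C s))"
proof -
  have "polytime (\<lambda>C s. if \<bar>g C s\<bar> \<le> 0 then \<bar>f C s\<bar> else gcd \<bar>f C s\<bar> \<bar>g C s\<bar>)"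
    by (rule polytime_binary[OF register_op_gcd]) (intro polytime_abs assms)+
  then show ?thesis by (rule polytime_cong) auto
qed

lemma polytime_sqrt [polytime_intros]:
  assumes "polytime f"
  shows "polytime (\<lambda>C s. \<lfloor>sqrt \<bar>real_of_int (f C s)\<bar>\<rfloor>)"
proof -
  have "polytime (\<lambda>C s. (\<lambda>C xs. if xs ! 0 < 0 then 0 else \<lfloor>sqrt (real_of_int (xs ! 0))\<rfloor>) C
      (map (\<lambda>f. f C s) [\<lambda>C s. \<bar>f C s\<bar>]))"
    using register_op_sqrt polytime_abs[OF assms] by (intro polytime_register_op) auto
  then show ?thesis by (rule polytime_cong) auto
qed

text \<open>
  The absolute value gives \<open>root_discr s * root_discr s = \<bar>s 0\<bar>\<close> and
  \<open>root_discr s \<ge> 0\<close> in every state, not only in those that encode an input.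
\<close>

definition root_discr :: "state \<Rightarrow> real" where
  "root_discr s = sqrt \<bar>real_of_int (s 0)\<bar>"

text \<open>
  The elements of \<open>\<int>[C]\<close> whose coefficients are computable in polynomial time, in Horner form.
  Written with their coefficients they are what the sign test of the machine accepts.
\<close>

inductive int_poly :: "(real \<Rightarrow> state \<Rightarrow> real) \<Rightarrow> bool" where
  zero: "int_poly (\<lambda>C s. 0)"
| step: "polytime f \<Longrightarrow> int_poly F \<Longrightarrow> int_poly (\<lambda>C s. real_of_int (f C s) + C * F C s)"

lemma int_poly_eval:
  assumes "int_poly F"
  obtains fs where "\<And>f. f \<in> set fs \<Longrightarrow> polytime f" "\<And>C s. F C s = eval_at C (map (\<lambda>f. f C s) fs)"
  using assms
proof (induction arbitrary: thesis)
  case zero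
  show ?case by (rule zero[of "[]"]) (auto simp: eval_at_def)
next
  case (step f F)
  obtain fs where fs: "\<And>f. f \<in> set fs \<Longrightarrow> polytime f"
    "\<And>C s. F C s = eval_at C (map (\<lambda>f. f C s) fs)" using step.IH by blast
  have "real_of_int (f C s) + C * F C s = eval_at C (map (\<lambda>f. f C s) (f # fs))" for C s
    unfolding eval_at_def fs(2) list.map length_Cons sum.lessThan_Suc_shift
    by (simp add: eval_at_def sum_distrib_left algebra_simps)
  with fs(1) step(1) show ?case by (intro step.prems[of "f # fs"]) auto
qed

lemma int_poly_of_int:
  assumes "polytime f"
  shows "int_poly (\<lambda>C s. real_of_int (f C s))"
  using int_poly.step[OF assms int_poly.zero] by simp

lemma int_poly_var: "int_poly (\<lambda>C s. C)"
  using int_poly.step[OF polytime_const[of 0] int_poly_of_int[OF polytime_const[of 1]]] by simp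

lemma int_poly_add: "int_poly F \<Longrightarrow> int_poly G \<Longrightarrow> int_poly (\<lambda>C s. F C s + G C s)"
proof (induction arbitrary: G rule: int_poly.induct)
  case (step f F)
  note outer = step
  from step.prems show ?case
  proof cases
    case zero
    with int_poly.step[OF outer(1,2)] show ?thesis by simp
  next
    case (step g H)
    have "int_poly (\<lambda>C s. real_of_int (f C s + g C s) + C * (F C s + H C s))"
      using outer step by (intro int_poly.step polytime_add) auto
    then show ?thesis unfolding step(1) by (simp add: algebra_simps)
  qed
qed simp

lemma int_poly_scale: "int_poly G \<Longrightarrow> polytime f \<Longrightarrow> int_poly (\<lambda>C s. real_of_int (f C s) * G C s)"
proof (induction rule: int_poly.induct)
  case (step g G)
  have "int_poly (\<lambda>C s. real_of_int (f C s * g C s) + C * (real_of_int (f C s) * G C s))"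
    using step by (intro int_poly.step polytime_mult) auto
  then show ?case by (simp add: algebra_simps)
qed (simp add: int_poly.zero)

lemma int_poly_mult: "int_poly F \<Longrightarrow> int_poly G \<Longrightarrow> int_poly (\<lambda>C s. F C s * G C s)"
proof (induction rule: int_poly.induct)
  case (step f F)
  have "int_poly (\<lambda>C s. real_of_int (f C s) * G C s + (real_of_int 0 + C * (F C s * G C s)))"
    using step by (intro int_poly_add int_poly_scale int_poly.step[of "\<lambda>C s. 0"] polytime_const) auto
  then show ?case by (simp add: algebra_simps)
qed (simp add: int_poly.zero)

lemma int_poly_minus: "int_poly F \<Longrightarrow> int_poly (\<lambda>C s. - F C s)"
  using int_poly_scale[of F "\<lambda>C s. - 1"] by (simp add: polytime_const)

lemma int_poly_diff: "int_poly F \<Longrightarrow> int_poly G \<Longrightarrow> int_poly (\<lambda>C s. F C s - G C s)"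
  using int_poly_add[OF _ int_poly_minus] by simp

lemma decidable_int_poly_pos:
  assumes "int_poly F"
  shows "decidable (\<lambda>C s. 0 < F C s)"
proof -
  obtain fs where fs: "\<And>f. f \<in> set fs \<Longrightarrow> polytime f"
    "\<And>C s. F C s = eval_at C (map (\<lambda>f. f C s) fs)"
    using int_poly_eval[OF assms] by blast
  from decidable_pos[OF polytime_sign[OF fs(1)]]
  have "decidable (\<lambda>C s. 0 < (if F C s > 0 then 1 else if F C s < 0 then - 1 else (0::int)))"
    unfolding fs(2) by simp
  moreover have "0 < (if x > 0 then 1 else if x < 0 then - 1 else (0::int)) \<longleftrightarrow> 0 < x" for x :: real
    by simp
  ultimately show ?thesis by simp
qed

text \<open>
  The ring \<open>\<int>[C] + \<surd>\<Delta> \<int>[C]\<close>.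
\<close>

definition quad_poly :: "(real \<Rightarrow> state \<Rightarrow> real) \<Rightarrow> bool" where
  "quad_poly F \<longleftrightarrow> (\<exists>G H. int_poly G \<and> int_poly H \<and> F = (\<lambda>C s. G C s + root_discr s * H C s))"

lemma quad_poly_int_poly: "int_poly F \<Longrightarrow> quad_poly F"
  unfolding quad_poly_def by (intro exI[of _ F] exI[of _ "\<lambda>C s. 0"]) (simp add: int_poly.zero)

lemma quad_poly_root_discr: "quad_poly (\<lambda>C s. root_discr s)"
  unfolding quad_poly_def
  using int_poly_of_int[OF polytime_const[of 1]]
  by (intro exI[of _ "\<lambda>C s. 0"] exI[of _ "\<lambda>C s. 1"]) (simp add: int_poly.zero)

lemma quad_poly_add: "quad_poly F \<Longrightarrow> quad_poly G \<Longrightarrow> quad_poly (\<lambda>C s. F C s + G C s)"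
proof -
  assume "quad_poly F" "quad_poly G"
  then obtain F1 F2 G1 G2 where "int_poly F1" "int_poly F2" "int_poly G1" "int_poly G2"
    and F: "F = (\<lambda>C s. F1 C s + root_discr s * F2 C s)"
    and G: "G = (\<lambda>C s. G1 C s + root_discr s * G2 C s)"
    unfolding quad_poly_def by blast
  then have "int_poly (\<lambda>C s. F1 C s + G1 C s)" "int_poly (\<lambda>C s. F2 C s + G2 C s)"
    by (auto intro: int_poly_add)
  then show ?thesis unfolding quad_poly_def F G
    by (intro exI conjI) (assumption, assumption, simp add: fun_eq_iff algebra_simps)
qed

lemma root_discr_square: "root_discr s * root_discr s = real_of_int \<bar>s 0\<bar>"
  by (simp add: root_discr_def)

lemma quad_poly_mult: "quad_poly F \<Longrightarrow> quad_poly G \<Longrightarrow> quad_poly (\<lambda>C s. F C s * G C s)"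
proof -
  assume "quad_poly F" "quad_poly G"
  then obtain F1 F2 G1 G2 where *: "int_poly F1" "int_poly F2" "int_poly G1" "int_poly G2"
    and F: "F = (\<lambda>C s. F1 C s + root_discr s * F2 C s)"
    and G: "G = (\<lambda>C s. G1 C s + root_discr s * G2 C s)"
    unfolding quad_poly_def by blast
  have "int_poly (\<lambda>C s. F1 C s * G1 C s + real_of_int \<bar>s 0\<bar> * (F2 C s * G2 C s))"
    "int_poly (\<lambda>C s. F1 C s * G2 C s + F2 C s * G1 C s)"
    by (intro int_poly_add int_poly_mult int_poly_of_int polytime_abs polytime_var *)+
  moreover have "F C s * G C s = (F1 C s * G1 C s + real_of_int \<bar>s 0\<bar> * (F2 C s * G2 C s)) +
      root_discr s * (F1 C s * G2 C s + F2 C s * G1 C s)" for C s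
    unfolding F G root_discr_square[symmetric] by (simp add: algebra_simps)
  ultimately show ?thesis unfolding quad_poly_def by blast
qed

lemma quad_poly_minus: "quad_poly F \<Longrightarrow> quad_poly (\<lambda>C s. - F C s)"
  using quad_poly_mult[OF quad_poly_int_poly[OF int_poly_of_int[OF polytime_const[of "- 1"]]]]
  by simp

text \<open>
  The sign of \<open>a + w b\<close> is clear if \<open>a\<close> and \<open>b\<close> do not have opposite signs.  Otherwise it is
  decided by comparing \<open>a\<^sup>2\<close> with \<open>(w b)\<^sup>2\<close>, which no longer involves \<open>w\<close> itself but only
  \<open>w\<^sup>2\<close>.  The right-hand side uses no relation but positivity, which is the only test available.
\<close>

lemma quad_pos_iff:
  fixes a b w :: real
  assumes "0 \<le> w"
  shows "0 < a + w * b \<longleftrightarrow> 0 < a \<and> (\<not> 0 < - b \<or> 0 < a * a - w * w * (b * b)) \<or>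
    0 < b \<and> 0 < w * w * (b * b) - a * a"
proof -
  have wb: "w * w * (b * b) = (w * b)\<^sup>2" and aa: "a * a = a\<^sup>2"
    by (simp_all add: power2_eq_square algebra_simps)
  have cmp: "\<bar>x\<bar> < \<bar>y\<bar> \<longleftrightarrow> 0 < y\<^sup>2 - x\<^sup>2" for x y :: real
    using abs_le_square_iff[of y x] by auto
  show ?thesis
  proof (cases "0 \<le> b")
    case True
    then have "0 \<le> w * b" using assms by simp
    then show ?thesis unfolding wb aa cmp[symmetric] using True by (cases "0 < a"; cases "b = 0") auto
  next
    case False
    then have "w * b \<le> 0" using assms by (simp add: mult_nonneg_nonpos)
    then show ?thesis unfolding wb aa cmp[symmetric] using False by auto
  qed
qed

lemma decidable_quad_poly_pos:
  assumes "quad_poly F"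
  shows "decidable (\<lambda>C s. 0 < F C s)"
proof -
  obtain A B where *: "int_poly A" "int_poly B" and F: "F = (\<lambda>C s. A C s + root_discr s * B C s)"
    using assms unfolding quad_poly_def by blast
  have w: "0 \<le> root_discr s" for s by (simp add: root_discr_def)
  show ?thesis
    unfolding F quad_pos_iff[OF w] root_discr_square
    by (intro decidable_and decidable_or decidable_not decidable_int_poly_pos
        int_poly_minus int_poly_diff int_poly_mult int_poly_of_int polytime_abs polytime_var *)
qed

text \<open>
  Quotients of such elements.  The denominator must not vanish in any state, so that the class is
  closed under addition; division by zero is handled in \<open>sign_computable_inverse\<close>.
\<close>

definition sign_computable :: "(real \<Rightarrow> state \<Rightarrow> real) \<Rightarrow> bool" where
  "sign_computable F \<longleftrightarrow> (\<exists>P Q. quad_poly P \<and> quad_poly Q \<and> (\<forall>C s. Q C s \<noteq> 0) \<and>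
     F = (\<lambda>C s. P C s / Q C s))"

lemma quad_poly_of_int: "polytime f \<Longrightarrow> quad_poly (\<lambda>C s. real_of_int (f C s))"
  by (intro quad_poly_int_poly int_poly_of_int)

lemma quad_poly_one: "quad_poly (\<lambda>C s. 1)"
  using quad_poly_of_int[OF polytime_const[of 1]] by simp

lemma sign_computable_quad_poly: "quad_poly F \<Longrightarrow> sign_computable F"
  unfolding sign_computable_def
  by (intro exI[of _ F] exI[of _ "\<lambda>C s. 1"]) (simp add: quad_poly_one)

lemma sign_computable_of_int [polytime_intros]:
  "polytime f \<Longrightarrow> sign_computable (\<lambda>C s. real_of_int (f C s))"
  by (intro sign_computable_quad_poly quad_poly_of_int)

lemma sign_computable_numeral [polytime_intros]:
  "sign_computable (\<lambda>C s. numeral k)" "sign_computable (\<lambda>C s. 1)" "sign_computable (\<lambda>C s. 0)"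
  using sign_computable_of_int[OF polytime_const[of "numeral k"]]
    sign_computable_of_int[OF polytime_const[of 1]] sign_computable_of_int[OF polytime_const[of 0]]
  by simp_all

lemma sign_computable_parameter [polytime_intros]: "sign_computable (\<lambda>C s. C)"
  by (intro sign_computable_quad_poly quad_poly_int_poly int_poly_var)

lemma sign_computable_root_discr [polytime_intros]: "sign_computable (\<lambda>C s. root_discr s)"
  by (intro sign_computable_quad_poly quad_poly_root_discr)

lemma sign_computable_add [polytime_intros]:
  assumes "sign_computable F" "sign_computable G"
  shows "sign_computable (\<lambda>C s. F C s + G C s)"
proof -
  obtain P Q P' Q' where *: "quad_poly P" "quad_poly Q" "quad_poly P'" "quad_poly Q'"
    and Q: "\<And>C s. Q C s \<noteq> 0" "\<And>C s. Q' C s \<noteq> 0"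
    and F: "F = (\<lambda>C s. P C s / Q C s)" and G: "G = (\<lambda>C s. P' C s / Q' C s)"
    using assms unfolding sign_computable_def by blast
  have "quad_poly (\<lambda>C s. P C s * Q' C s + P' C s * Q C s)" "quad_poly (\<lambda>C s. Q C s * Q' C s)"
    using * by (auto intro!: quad_poly_add quad_poly_mult)
  then show ?thesis unfolding sign_computable_def F G
    by (intro exI conjI) (assumption, assumption, use Q in \<open>auto simp: fun_eq_iff field_simps\<close>)
qed

lemma sign_computable_mult [polytime_intros]:
  assumes "sign_computable F" "sign_computable G"
  shows "sign_computable (\<lambda>C s. F C s * G C s)"
proof -
  obtain P Q P' Q' where *: "quad_poly P" "quad_poly Q" "quad_poly P'" "quad_poly Q'"
    and Q: "\<And>C s. Q C s \<noteq> 0" "\<And>C s. Q' C s \<noteq> 0"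
    and F: "F = (\<lambda>C s. P C s / Q C s)" and G: "G = (\<lambda>C s. P' C s / Q' C s)"
    using assms unfolding sign_computable_def by blast
  have "quad_poly (\<lambda>C s. P C s * P' C s)" "quad_poly (\<lambda>C s. Q C s * Q' C s)"
    using * by (auto intro!: quad_poly_mult)
  then show ?thesis unfolding sign_computable_def F G
    by (intro exI conjI) (assumption, assumption, use Q in \<open>auto simp: fun_eq_iff\<close>)
qed

text \<open>
  To stay within the class for all states, an inverse \<open>Q / P\<close> with \<open>P = 0\<close> is represented as
  \<open>0 / 1\<close>: with the computable indicator \<open>z\<close> of \<open>P = 0\<close>, the fraction
  \<open>((1 - z) Q) / (P + z)\<close> has both forms.
\<close>

lemma sign_computable_inverse:
  assumes "sign_computable F"
  shows "sign_computable (\<lambda>C s. inverse (F C s))"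
proof -
  obtain P Q where *: "quad_poly P" "quad_poly Q" and Q: "\<And>C s. Q C s \<noteq> 0"
    and F: "F = (\<lambda>C s. P C s / Q C s)"
    using assms unfolding sign_computable_def by blast
  define z where "z C s = (of_bool (\<not> 0 < P C s \<and> \<not> 0 < - P C s) :: int)" for C s
  have z: "polytime z"
    unfolding z_def using * by (intro polytime_of_bool decidable_and decidable_not
        decidable_quad_poly_pos quad_poly_minus)
  have "quad_poly (\<lambda>C s. real_of_int (1 - z C s) * Q C s)" "quad_poly (\<lambda>C s. P C s + real_of_int (z C s))"
    by (intro quad_poly_add quad_poly_mult quad_poly_of_int polytime_diff polytime_const z *)+
  then show ?thesis unfolding sign_computable_def F
    by (intro exI conjI) (assumption, assumption, use Q in \<open>auto simp: z_def fun_eq_iff\<close>)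
qed

lemma sign_computable_minus [polytime_intros]:
  "sign_computable F \<Longrightarrow> sign_computable (\<lambda>C s. - F C s)"
  using sign_computable_mult[OF sign_computable_of_int[OF polytime_const[of "- 1"]]] by simp

lemma sign_computable_diff [polytime_intros]:
  "sign_computable F \<Longrightarrow> sign_computable G \<Longrightarrow> sign_computable (\<lambda>C s. F C s - G C s)"
  using sign_computable_add[OF _ sign_computable_minus] by simp

lemma sign_computable_divide [polytime_intros]:
  "sign_computable F \<Longrightarrow> sign_computable G \<Longrightarrow> sign_computable (\<lambda>C s. F C s / G C s)"
  unfolding divide_inverse by (intro sign_computable_mult sign_computable_inverse)

lemma sign_computable_power [polytime_intros]:
  "sign_computable F \<Longrightarrow> sign_computable (\<lambda>C s. F C s ^ n)"
  by (induction n) (auto intro: polytime_intros)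

lemma decidable_sign_pos:
  assumes "sign_computable F"
  shows "decidable (\<lambda>C s. 0 < F C s)"
proof -
  obtain P Q where *: "quad_poly P" "quad_poly Q" and F: "F = (\<lambda>C s. P C s / Q C s)"
    using assms unfolding sign_computable_def by blast
  have "decidable (\<lambda>C s. 0 < P C s * Q C s)"
    using * by (intro decidable_quad_poly_pos quad_poly_mult)
  then show ?thesis unfolding F by (simp add: zero_less_divide_iff zero_less_mult_iff)
qed

lemma decidable_less [polytime_intros]:
  "sign_computable F \<Longrightarrow> sign_computable G \<Longrightarrow> decidable (\<lambda>C s. F C s < G C s)"
  using decidable_sign_pos[OF sign_computable_diff, of G F] by simp

lemma decidable_le [polytime_intros]:
  "sign_computable F \<Longrightarrow> sign_computable G \<Longrightarrow> decidable (\<lambda>C s. F C s \<le> G C s)"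
  using decidable_not[OF decidable_less, of G F] by (simp add: not_less)

lemma decidable_eq_int [polytime_intros]:
  assumes "polytime f" "polytime g"
  shows "decidable (\<lambda>C s. f C s = g C s)"
proof -
  have "decidable (\<lambda>C s. real_of_int (f C s) \<le> real_of_int (g C s) \<and>
      real_of_int (g C s) \<le> real_of_int (f C s))"
    using assms by (intro polytime_intros)
  then show ?thesis unfolding of_int_le_iff by (simp add: eq_iff)
qed

lemma sign_computable_abs [polytime_intros]:
  assumes "sign_computable F"
  shows "sign_computable (\<lambda>C s. \<bar>F C s\<bar>)"
proof -
  have "sign_computable (\<lambda>C s. (1 - 2 * real_of_int (of_bool (F C s < 0))) * F C s)"
    using assms by (intro polytime_intros)
  moreover have "(1 - 2 * real_of_int (of_bool (x < 0))) * x = \<bar>x\<bar>" for x :: real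
    by simp
  ultimately show ?thesis by simp
qed

section \<open>Lists of candidates and the output\<close>

text \<open>
  The candidates depend on the input, but their number does not.  Quantification and search over
  them therefore unfold into finitely many decidable cases.
\<close>

inductive candidates :: "(real \<Rightarrow> state \<Rightarrow> (int \<times> int) list) \<Rightarrow> bool" where
  nil: "candidates (\<lambda>C s. [])"
| cons: "polytime a \<Longrightarrow> polytime b \<Longrightarrow> candidates L \<Longrightarrow> candidates (\<lambda>C s. (a C s, b C s) # L C s)"

definition decidable_pred :: "(real \<Rightarrow> state \<Rightarrow> int \<times> int \<Rightarrow> bool) \<Rightarrow> bool" where
  "decidable_pred Q \<longleftrightarrow> (\<forall>a b. polytime a \<longrightarrow> polytime b \<longrightarrow> decidable (\<lambda>C s. Q C s (a C s, b C s)))"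

lemma decidable_Ball:
  assumes "candidates L" "decidable_pred Q"
  shows "decidable (\<lambda>C s. \<forall>x\<in>set (L C s). Q C s x)"
  using assms(1)
proof induction
  case nil
  show ?case by (simp add: decidable_const)
next
  case (cons a b L)
  then have "decidable (\<lambda>C s. Q C s (a C s, b C s) \<and> (\<forall>x\<in>set (L C s). Q C s x))"
    using assms(2) unfolding decidable_pred_def by (intro decidable_and) auto
  then show ?case by simp
qed

text \<open>
  The length of the output depends on the run, while a program writes a fixed number of registers.
  The functions \<open>fs\<close> give the entries that are present; the others are arbitrary.
\<close>

definition polytime_entries :: "(real \<Rightarrow> state \<Rightarrow> int list) \<Rightarrow> bool" where
  "polytime_entries L \<longleftrightarrow> (\<exists>fs. (\<forall>f\<in>set fs. polytime f) \<and>
     (\<forall>C s. length (L C s) \<le> length fs \<and> (\<forall>i<length (L C s). L C s ! i = (fs ! i) C s)))"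

lemma polytime_entries_Nil: "polytime_entries (\<lambda>C s. [])"
  unfolding polytime_entries_def by (intro exI[of _ "[]"]) simp

lemma polytime_entries_Cons:
  assumes "polytime f" "polytime_entries L"
  shows "polytime_entries (\<lambda>C s. f C s # L C s)"
proof -
  obtain fs where "\<forall>f\<in>set fs. polytime f"
    "\<forall>C s. length (L C s) \<le> length fs \<and> (\<forall>i<length (L C s). L C s ! i = (fs ! i) C s)"
    using assms(2) unfolding polytime_entries_def by blast
  with assms(1) show ?thesis
    unfolding polytime_entries_def
    by (intro exI[of _ "f # fs"]) (auto simp: nth_Cons split: nat.splits)
qed

lemma polytime_entries_if:
  assumes "decidable P" "polytime_entries K" "polytime_entries L"
  shows "polytime_entries (\<lambda>C s. if P C s then K C s else L C s)"
proof -
  obtain fs where fs: "\<forall>f\<in>set fs. polytime f"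
    "\<forall>C s. length (K C s) \<le> length fs \<and> (\<forall>i<length (K C s). K C s ! i = (fs ! i) C s)"
    using assms(2) unfolding polytime_entries_def by blast
  obtain gs where gs: "\<forall>g\<in>set gs. polytime g"
    "\<forall>C s. length (L C s) \<le> length gs \<and> (\<forall>i<length (L C s). L C s ! i = (gs ! i) C s)"
    using assms(3) unfolding polytime_entries_def by blast
  define pad where "pad hs i = (if i < length hs then hs ! i else (\<lambda>C s. 0))"
    for hs :: "(real \<Rightarrow> state \<Rightarrow> int) list" and i
  have pad: "polytime (pad hs i)" if "\<forall>h\<in>set hs. polytime h" for hs i
    using that by (auto simp: pad_def intro: polytime_const)
  let ?hs = "map (\<lambda>i C s. if P C s then pad fs i C s else pad gs i C s)
    [0..<max (length fs) (length gs)]"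
  have "\<forall>h\<in>set ?hs. polytime h" using assms(1) fs gs pad by (auto intro!: polytime_if)
  moreover have "length (if P C s then K C s else L C s) \<le> length ?hs" for C s
    using fs(2) gs(2) by (auto simp: le_max_iff_disj)
  moreover have "(if P C s then K C s else L C s) ! i = (?hs ! i) C s"
    if "i < length (if P C s then K C s else L C s)" for C s i
  proof -
    have "i < (if P C s then length fs else length gs)"
      using that fs(2) gs(2) by (auto split: if_splits intro: less_le_trans)
    then show ?thesis using that fs(2) gs(2) by (auto simp: pad_def split: if_splits)
  qed
  ultimately show ?thesis unfolding polytime_entries_def by (intro exI[of _ ?hs]) auto
qed

lemma polytime_entries_pairs:
  assumes "candidates L" "polytime_entries K"
  shows "polytime_entries (\<lambda>C s. concat (map (\<lambda>x. pair_code (Some x)) (L C s)) @ K C s)"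
  using assms(1)
proof induction
  case (cons a b L)
  then have "polytime_entries (\<lambda>C s. a C s # b C s #
      concat (map (\<lambda>x. pair_code (Some x)) (L C s)) @ K C s)"
    by (intro polytime_entries_Cons)
  then show ?case by simp
qed (simp add: assms(2))

lemma polytime_entries_flags:
  assumes "candidates L" "decidable_pred Q" "polytime_entries K"
  shows "polytime_entries (\<lambda>C s. map (\<lambda>x. of_bool (Q C s x)) (L C s) @ K C s)"
  using assms(1)
proof induction
  case (cons a b L)
  then have "polytime_entries (\<lambda>C s. of_bool (Q C s (a C s, b C s)) #
      map (\<lambda>x. of_bool (Q C s x)) (L C s) @ K C s)"
    using assms(2) by (intro polytime_entries_Cons) (auto simp: decidable_pred_def decidable_def)
  then show ?case by simp
qed (simp add: assms(3))

lemma polytime_entries_find: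
  assumes "candidates L" "decidable_pred Q" "polytime_entries K"
  shows "polytime_entries (\<lambda>C s. pair_code (find (Q C s) (L C s)) @ K C s)"
proof -
  have *: "polytime (\<lambda>C s. pair_code (find (Q C s) (L C s)) ! 0) \<and>
        polytime (\<lambda>C s. pair_code (find (Q C s) (L C s)) ! 1)"
    using assms(1)
  proof induction
    case (cons a b L)
    have "decidable (\<lambda>C s. Q C s (a C s, b C s))"
      using assms(2) cons by (auto simp: decidable_pred_def)
    with cons have
      "polytime (\<lambda>C s. if Q C s (a C s, b C s) then a C s else pair_code (find (Q C s) (L C s)) ! 0)"
      "polytime (\<lambda>C s. if Q C s (a C s, b C s) then b C s else pair_code (find (Q C s) (L C s)) ! 1)"
      by (auto intro!: polytime_if)
    then show ?case by (simp add: if_distrib[of "\<lambda>x. pair_code x ! _"] cong: if_cong)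
  qed (simp add: polytime_const)
  have "pair_code x = [pair_code x ! 0, pair_code x ! 1]" for x
    by (cases x) auto
  then have "pair_code x @ ys = pair_code x ! 0 # pair_code x ! 1 # ys" for x ys
    by (metis append_Cons append_Nil)
  with * polytime_entries_Cons assms(3) show ?thesis by presburger
qed

fun copy_registers :: "nat \<Rightarrow> nat \<Rightarrow> nat \<Rightarrow> com" where
  "copy_registers r z 0 = Skip"
| "copy_registers r z (Suc k) = Seq (copy_registers r z k) (Plus k (r + k) z)"

text \<open>
  The results sit at \<open>r, r + 1, \<dots>\<close>, but the output is read from register 0 on.  As \<open>k \<le> r\<close>,
  no result is overwritten before it has been copied.
\<close>

lemma exec_copy_registers:
  assumes "k \<le> r" "r \<le> z" "s z = 0"
  shows "exec C \<kappa> (copy_registers r z k) s (1 + list_bits (map s [r..<r + k]) + k)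
    (\<lambda>i. if i < k then s (r + i) else s i)"
  using assms(1)
proof (induction k)
  case 0
  show ?case using exec.Skip[of C \<kappa> s] by simp
next
  case (Suc k)
  let ?s = "\<lambda>i. if i < k then s (r + i) else s i"
  have "exec C \<kappa> (Plus k (r + k) z) ?s (bits (s (r + k)) + 1) (?s(k := s (r + k)))"
    using exec.Plus[of C \<kappa> k "r + k" z ?s] Suc.prems assms(2,3) by simp
  moreover have "?s(k := s (r + k)) = (\<lambda>i. if i < Suc k then s (r + i) else s i)"
    by (auto simp: fun_eq_iff)
  ultimately show ?case using exec.Seq[OF Suc.IH] Suc.prems
    by (fastforce simp: algebra_simps)
qed

text \<open>
  The only place where the pieces become one program: compute all entries, then copy them to the
  front.
\<close>

lemma polytime_program:
  assumes "polytime_entries L"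
  obtains p N where "\<And>C \<kappa>. poly_cost \<kappa> \<Longrightarrow> \<exists>T. poly_bounded T \<and> (\<forall>s. \<exists>t s'.
    exec C \<kappa> p s t s' \<and> holds s' (L C s) \<and> t \<le> T (list_bits (map s [0..<N])))"
proof -
  obtain fs where fs: "\<forall>f\<in>set fs. polytime f"
    "\<And>C s. length (L C s) \<le> length fs" "\<And>C s i. i < length (L C s) \<Longrightarrow> L C s ! i = (fs ! i) C s"
    using assms unfolding polytime_entries_def by blast
  then obtain N where N: "\<And>r. r \<ge> N \<Longrightarrow> \<exists>p. \<forall>C \<kappa>. poly_cost \<kappa> \<longrightarrow>
     (\<exists>T. poly_bounded T \<and> computes C \<kappa> p N r fs T)"
    using polytime_list_if_polytime[of fs] unfolding polytime_list_def by blast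
  define k r where "k = length fs" "r = max N k"
  note kr = k_r_def
  obtain p where p: "\<And>C \<kappa>. poly_cost \<kappa> \<Longrightarrow> \<exists>T. poly_bounded T \<and> computes C \<kappa> p N r fs T"
    using N[of r] by (auto simp: kr)
  let ?p = "Seq p (Seq (Const (r + k) 0) (copy_registers r (r + k) k))"
  show ?thesis
  proof
    fix C \<kappa> assume "poly_cost \<kappa>"
    then obtain T where T: "poly_bounded T" "computes C \<kappa> p N r fs T" using p by blast
    show "\<exists>T. poly_bounded T \<and> (\<forall>s. \<exists>t s'.
      exec C \<kappa> ?p s t s' \<and> holds s' (L C s) \<and> t \<le> T (list_bits (map s [0..<N])))"
    proof (intro exI[of _ "\<lambda>x. T x + k + 2"] conjI allI)
      show "poly_bounded (\<lambda>x. T x + k + 2)" using T by (intro poly_bounded_intros)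
      fix s :: state
      let ?vs = "map (\<lambda>f. f C s) fs"
      obtain t s1 where 1: "exec C \<kappa> p s t s1"
        "\<forall>j<length fs. s1 (r + j) = (fs ! j) C s" "t + list_bits ?vs \<le> T (list_bits (map s [0..<N]))"
        using T(2) unfolding computes_def by blast
      let ?s1 = "s1(r + k := 0)" and ?s2 = "\<lambda>i. if i < k then s1 (r + i) else (s1(r + k := 0)) i"
      have "map ?s1 [r..<r + k] = ?vs"
        using 1(2) by (auto simp: kr intro: nth_equalityI)
      moreover have "(\<lambda>i. if i < k then ?s1 (r + i) else ?s1 i) = ?s2" by (auto simp: fun_eq_iff)
      ultimately have "exec C \<kappa> (copy_registers r (r + k) k) ?s1 (1 + list_bits ?vs + k) ?s2"
        using exec_copy_registers[of k r "r + k" ?s1 C \<kappa>] by (simp add: kr)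
      from exec.Seq[OF 1(1) exec.Seq[OF exec.Const[of C \<kappa> "r + k" 0 s1] this]]
      have "exec C \<kappa> ?p s (t + (1 + (1 + list_bits ?vs + k))) ?s2" by simp
      moreover have "holds ?s2 (L C s)"
        using 1(2) fs(2)[of C s] fs(3)[of _ C s] by (auto simp: holds_def kr)
      ultimately show "\<exists>t s'. exec C \<kappa> ?p s t s' \<and> holds s' (L C s) \<and>
          t \<le> T (list_bits (map s [0..<N])) + k + 2"
        using 1(3) by (intro exI[of _ "t + (1 + (1 + list_bits ?vs + k))"] exI[of _ ?s2]) auto
    qed
  qed
qed

section \<open>The lattice\<close>

definition cross :: "real \<times> real \<Rightarrow> real \<times> real \<Rightarrow> real" where
  "cross x y = fst x * snd y - snd x * fst y"

lemma Z_basis_alt: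
  "Z_basis I x y \<longleftrightarrow> I = range (comb x y) \<and> cross x y \<noteq> 0"
  unfolding Z_basis_def cross_def comb_def by (auto simp: image_def)

lemma comb_simps [simp]:
  "fst (comb x y st) = of_int (fst st) * fst x + of_int (snd st) * fst y"
  "snd (comb x y st) = of_int (fst st) * snd x + of_int (snd st) * snd y"
  by (simp_all add: comb_def)

text \<open>
  Two bases of a lattice express each other with integer coefficients, so their determinants are
  integer multiples of each other.  Thus the covolume does not depend on the basis.
\<close>

lemma Z_basis_cross_unique:
  assumes "Z_basis I x y" "Z_basis I x' y'"
  shows "\<bar>cross x y\<bar> = \<bar>cross x' y'\<bar>"
proof -
  have multiple: "\<exists>k::int. cross p q = k * cross x y" if b: "Z_basis I x y" and b': "Z_basis I p q"
    for x y p q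
  proof -
    have "p = comb p q (1, 0)" "q = comb p q (0, 1)" by (simp_all add: comb_def)
    then have "p \<in> I" "q \<in> I" using b' unfolding Z_basis_alt by (metis rangeI)+
    then obtain a c where "p = comb x y a" "q = comb x y c"
      using b unfolding Z_basis_alt by blast
    then have "cross p q = of_int (fst a * snd c - snd a * fst c) * cross x y"
      by (simp add: cross_def algebra_simps)
    then show ?thesis by blast
  qed
  obtain k l :: int where k: "cross x' y' = k * cross x y" and l: "cross x y = l * cross x' y'"
    using multiple assms by metis
  have nz: "cross x y \<noteq> 0" using assms by (simp add: Z_basis_alt)
  have "cross x y = of_int (l * k) * cross x y" using l unfolding k by simp
  then have "real_of_int (l * k) = 1" using nz mult_cancel_right1[of "cross x y"] by blast
  then have "l * k = 1" by linarith
  then have "\<bar>k\<bar> = 1" by (metis abs_1 abs_mult zmult_eq_1_iff abs_minus_cancel)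
  then have "\<bar>real_of_int k\<bar> = 1" by linarith
  with k show ?thesis by (simp add: abs_mult)
qed

lemma abs_of_rat: "\<bar>of_rat a :: real\<bar> = of_rat \<bar>a\<bar>"
  by (simp add: abs_if of_rat_minus)

lemma cross_elt:
  fixes v v' :: "rat^2"
  assumes "0 < field_discr d"
  shows "cross (elt d v) (elt d v') =
    - real_of_rat (v $ 1 * v' $ 2 - v $ 2 * v' $ 1) * sqrt (of_int (field_discr d))"
  by (simp add: cross_def elt_def Let_def of_rat_diff of_rat_mult field_simps)

text \<open>
  The norm can be read off from any basis, in particular from the LLL-reduced one, because the
  covolume of \<open>I\<close> is \<open>\<surd>\<Delta>\<close> times the coordinate determinant.
\<close>

lemma ideal_norm_basis:
  fixes v1 v2 :: "rat^2"
  assumes "0 < field_discr d" "Z_basis I (elt d v1) (elt d v2)"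
  shows "ideal_norm d I = \<bar>v1 $ 1 * v2 $ 2 - v1 $ 2 * v2 $ 1\<bar>"
proof -
  have detM: "det M = column 1 M $ 1 * column 2 M $ 2 - column 1 M $ 2 * column 2 M $ 1"
    for M :: "rat^2^2" by (simp add: det_2 column_def)
  show ?thesis
    unfolding ideal_norm_def
  proof (rule the_equality)
    define M :: "rat^2^2" where "M = (\<chi> i j. if j = 1 then v1 $ i else v2 $ i)"
    have "column 1 M = v1" "column 2 M = v2" by (simp_all add: M_def column_def vec_eq_iff)
    with assms show "\<exists>M. represents d M I \<and> \<bar>v1 $ 1 * v2 $ 2 - v1 $ 2 * v2 $ 1\<bar> = \<bar>det M\<bar>"
      by (intro exI[of _ M]) (simp add: represents_def detM)
  next
    fix r assume "\<exists>M. represents d M I \<and> r = \<bar>det M\<bar>"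
    then obtain M where M: "Z_basis I (elt d (column 1 M)) (elt d (column 2 M))" "r = \<bar>det M\<bar>"
      by (auto simp: represents_def)
    from Z_basis_cross_unique[OF M(1) assms(2)]
    have "\<bar>real_of_rat (det M)\<bar> = \<bar>real_of_rat (v1 $ 1 * v2 $ 2 - v1 $ 2 * v2 $ 1)\<bar>"
      using assms(1) unfolding cross_elt[OF assms(1)] detM by (simp add: abs_mult)
    then show "r = \<bar>v1 $ 1 * v2 $ 2 - v1 $ 2 * v2 $ 1\<bar>"
      unfolding M(2) by (simp add: abs_of_rat)
  qed
qed

lemma S1_uminus [simp]: "- g \<in> S1 C \<longleftrightarrow> g \<in> S1 C"
  by (cases g) (simp add: S1_def)

lemma S1_if_short:
  assumes "0 < C" "(fst g)\<^sup>2 + (snd g)\<^sup>2 < 1 / C\<^sup>2"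
  shows "g \<in> S1 C"
proof -
  have "\<bar>x\<bar> \<le> 1 / C" if "x\<^sup>2 \<le> 1 / C\<^sup>2" for x
    using that assms(1) abs_le_square_iff[of x "1 / C"] by (simp add: power_divide)
  moreover have "(fst g)\<^sup>2 \<le> 1 / C\<^sup>2" "(snd g)\<^sup>2 \<le> 1 / C\<^sup>2"
    using assms(2) zero_le_power2[of "fst g"] zero_le_power2[of "snd g"] by linarith+
  moreover have "1 / C\<^sup>2 \<le> 2 / C\<^sup>2" by (simp add: divide_right_mono)
  ultimately show ?thesis using assms(2) by (cases g) (auto simp: S1_def)
qed

text \<open>
  The component \<open>y - \<mu> x\<close> of \<open>y\<close> orthogonal to \<open>x\<close> has length \<open>\<bar>cross x y\<bar> / norm x\<close>.  With
  \<open>\<mu>\<^sup>2 \<le> 1/4\<close> the Lovasz condition says that its square is at least half the square of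
  \<open>norm x\<close>.
\<close>

lemma LLL_reduced_bounds:
  assumes "LLL_reduced x y" "cross x y \<noteq> 0"
  shows "2 * \<bar>y \<bullet> x\<bar> \<le> x \<bullet> x" "(x \<bullet> x)\<^sup>2 \<le> 2 * (cross x y)\<^sup>2"
proof -
  define \<mu> where "\<mu> = (y \<bullet> x) / (x \<bullet> x)"
  have "x \<noteq> 0" using assms(2) by (auto simp: cross_def)
  then have X: "0 < x \<bullet> x" by simp
  have mu: "\<bar>\<mu>\<bar> \<le> 1 / 2" and star: "(3 / 4 - \<mu>\<^sup>2) * (norm x)\<^sup>2 \<le> (norm (y - \<mu> *\<^sub>R x))\<^sup>2"
    using assms(1) by (simp_all add: LLL_reduced_def Let_def \<mu>_def)
  show "2 * \<bar>y \<bullet> x\<bar> \<le> x \<bullet> x"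
    using mu X by (simp add: \<mu>_def abs_divide field_simps)
  have z: "y \<bullet> x = \<mu> * (x \<bullet> x)" using X by (simp add: \<mu>_def)
  have "(x \<bullet> x) * (norm (y - \<mu> *\<^sub>R x))\<^sup>2 = (x \<bullet> x) * (y \<bullet> y) - (y \<bullet> x)\<^sup>2"
    unfolding power2_norm_eq_inner
    by (simp add: inner_diff_left inner_diff_right inner_commute[of x y] z power2_eq_square algebra_simps)
  also have "\<dots> = (cross x y)\<^sup>2"
    by (cases x; cases y) (simp add: cross_def power2_eq_square algebra_simps)
  finally have c: "(cross x y)\<^sup>2 = (x \<bullet> x) * (norm (y - \<mu> *\<^sub>R x))\<^sup>2" by simp
  have "\<mu>\<^sup>2 \<le> (1 / 2)\<^sup>2" using mu abs_le_square_iff[of \<mu> "1 / 2"] by simp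
  then have "1 / 2 \<le> 3 / 4 - \<mu>\<^sup>2" by (simp add: power2_eq_square)
  then have "1 / 2 * (x \<bullet> x) \<le> (norm (y - \<mu> *\<^sub>R x))\<^sup>2"
    using star X mult_right_mono[of "1 / 2" "3 / 4 - \<mu>\<^sup>2" "x \<bullet> x"]
    unfolding power2_norm_eq_inner[of x] by linarith
  then have "(x \<bullet> x) * (1 / 2 * (x \<bullet> x)) \<le> (cross x y)\<^sup>2"
    unfolding c using X by (intro mult_left_mono) auto
  then show "(x \<bullet> x)\<^sup>2 \<le> 2 * (cross x y)\<^sup>2" by (simp add: power2_eq_square)
qed

text \<open>
  The search in Step 3 is finite: if the covolume exceeds \<open>1 / C\<^sup>2\<close>, which Step 1 ensures, only
  four lattice vectors have to be tested.  For \<open>h = s x + t y\<close> in \<open>S1 C\<close> the component of \<open>h\<close>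
  orthogonal to \<open>x\<close> is \<open>t\<close> times that of \<open>y\<close>, which is too long for \<open>\<bar>t\<bar> \<ge> 2\<close>.  For \<open>t = 0\<close>
  the vector \<open>x\<close> is itself in \<open>S1 C\<close>, as this set is star-shaped.  For \<open>\<bar>t\<bar> = 1\<close> either \<open>x\<close>
  is in \<open>S1 C\<close> or it has length at least \<open>1 / C\<close>, and then the component of \<open>h\<close> along \<open>x\<close>
  leaves only \<open>\<bar>s\<bar> \<le> 1\<close>.
\<close>

lemma S1_meets_reduced_lattice:
  assumes C: "0 < C" and red: "LLL_reduced x y" and covol: "1 / C\<^sup>2 < \<bar>cross x y\<bar>"
    and st: "(s, t) \<noteq> (0, 0)" and g: "comb x y (s, t) \<in> S1 C"
  shows "\<exists>st\<in>{(1, 0), (- 1, 1), (0, 1), (1, 1)}. comb x y st \<in> S1 C"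
proof -
  define X where "X = x \<bullet> x"
  define z where "z = y \<bullet> x"
  define c where "c = cross x y"
  define h where "h = comb x y (s, t)"
  have C2: "0 < 1 / C\<^sup>2" using C by simp
  then have c0: "c \<noteq> 0" "0 < \<bar>c\<bar>" using covol by (auto simp: c_def)
  have z: "2 * \<bar>z\<bar> \<le> X" and Xc: "X\<^sup>2 \<le> 2 * c\<^sup>2"
    using LLL_reduced_bounds[OF red] c0 by (simp_all add: X_def z_def c_def)
  have "x \<noteq> 0" using c0 by (auto simp: cross_def c_def)
  then have X: "0 < X" by (simp add: X_def)
  have hh: "h \<bullet> h < 2 / C\<^sup>2"
    using g by (cases h) (auto simp: S1_def h_def power2_eq_square)
  have lagrange: "X * (h \<bullet> h) = (s * X + t * z)\<^sup>2 + t\<^sup>2 * c\<^sup>2"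
    by (cases x; cases y)
       (simp add: h_def X_def z_def c_def cross_def comb_def power2_eq_square algebra_simps)
  have Xh: "X * (h \<bullet> h) < X * (2 / C\<^sup>2)" using X hh by (rule mult_strict_left_mono[rotated])
  show ?thesis
  proof (cases "t = 0")
    case True
    then have s: "1 \<le> \<bar>real_of_int s\<bar>" using st by auto
    have le: "\<bar>a\<bar> \<le> \<bar>s * a\<bar>" for a :: real
      using mult_right_mono[OF s, of "\<bar>a\<bar>"] by (simp add: abs_mult)
    have sq: "a\<^sup>2 \<le> (s * a)\<^sup>2" for a :: real using le[of a] abs_le_square_iff by blast
    have "x \<in> S1 C"
      using g True le[of "fst x"] le[of "snd x"] sq[of "fst x"] sq[of "snd x"]
      by (cases x) (auto simp: S1_def comb_def)
    then show ?thesis by (auto simp: comb_def)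
  next
    case False
    have t1: "\<bar>t\<bar> = 1"
    proof (rule ccontr)
      assume "\<bar>t\<bar> \<noteq> 1"
      with False have "2 \<le> \<bar>real_of_int t\<bar>" by linarith
      then have "2\<^sup>2 \<le> (real_of_int t)\<^sup>2" using abs_le_square_iff[of 2 "real_of_int t"] by simp
      then have "4 * c\<^sup>2 \<le> (real_of_int t)\<^sup>2 * c\<^sup>2" by (intro mult_right_mono) auto
      also have "\<dots> \<le> X * (h \<bullet> h)" unfolding lagrange by simp
      also have "\<dots> < X * (2 / C\<^sup>2)" by (rule Xh)
      also have "\<dots> \<le> X * (2 * \<bar>c\<bar>)" using X covol by (intro mult_left_mono) (auto simp: c_def)
      finally have "(2 * \<bar>c\<bar>) * \<bar>c\<bar> < X * \<bar>c\<bar>" by (simp add: power2_eq_square mult.assoc)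
      then have "2 * \<bar>c\<bar> < X" using c0 mult_less_cancel_right_pos by blast
      then have "(2 * \<bar>c\<bar>)\<^sup>2 < X\<^sup>2" by (intro power_strict_mono) auto
      moreover have "(2 * \<bar>c\<bar>)\<^sup>2 = 4 * c\<^sup>2" by (simp add: power_mult_distrib)
      ultimately show False using Xc zero_le_power2[of c] by linarith
    qed
    show ?thesis
    proof (cases "x \<in> S1 C")
      case True
      then show ?thesis by (auto simp: comb_def)
    next
      case notin: False
      have XC: "1 / C\<^sup>2 \<le> X"
      proof (rule ccontr)
        assume "\<not> 1 / C\<^sup>2 \<le> X"
        then have "x \<in> S1 C"
          using C by (intro S1_if_short) (auto simp: X_def inner_prod_def power2_eq_square)
        with notin show False by simp
      qed
      have "(s * X + t * z)\<^sup>2 \<le> X * (h \<bullet> h)" unfolding lagrange by simp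
      also have "\<dots> < X * (2 * X)"
        using Xh mult_left_mono[of "2 / C\<^sup>2" "2 * X" X] XC X by linarith
      also have "\<dots> \<le> (3 / 2 * X)\<^sup>2" by (simp add: power2_eq_square)
      finally have "\<bar>s * X + t * z\<bar> < 3 / 2 * X"
        using X abs_le_square_iff[of "3 / 2 * X" "s * X + t * z"] by (auto simp: not_le[symmetric])
      moreover have "\<bar>t * z\<bar> \<le> X / 2" using z t1 by (simp add: abs_mult flip: of_int_abs)
      ultimately have "\<bar>s * X\<bar> < 2 * X" by linarith
      then have "\<bar>real_of_int s\<bar> * X < 2 * X" using X by (simp add: abs_mult)
      then have "\<bar>real_of_int s\<bar> < 2" using X by simp
      then have s: "s = - 1 \<or> s = 0 \<or> s = 1" by linarith
      have "comb x y (- s, - t) = - comb x y (s, t)" by (simp add: comb_def)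
      with g have "comb x y (- s, - t) \<in> S1 C" by simp
      moreover have "t = 1 \<or> t = - 1" using t1 by linarith
      ultimately show ?thesis using g s by auto
    qed
  qed
qed

section \<open>Integers near a quadratic irrational\<close>

text \<open>
  The number \<open>b \<surd>n\<close> for \<open>n \<ge> 0\<close>, rounded towards 0.
\<close>

definition approx_root :: "int \<Rightarrow> int \<Rightarrow> int" where
  "approx_root n b =
    (if b < 0 then - \<lfloor>sqrt \<bar>real_of_int (b * b * n)\<bar>\<rfloor> else \<lfloor>sqrt \<bar>real_of_int (b * b * n)\<bar>\<rfloor>)"

lemma approx_root:
  assumes "0 < n"
  shows "\<bar>of_int b * sqrt (of_int n) - of_int (approx_root n b)\<bar> < 1"
proof -
  have "sqrt \<bar>real_of_int (b * b * n)\<bar> = \<bar>of_int b\<bar> * sqrt (of_int n)"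
    using assms by (simp add: real_sqrt_mult abs_mult)
  then show ?thesis
    unfolding approx_root_def by (cases "b < 0") (simp_all, linarith+)
qed

text \<open>
  Replacing \<open>b \<surd>n\<close> by an integer shifts the quotient by less than \<open>1 / \<bar>q\<bar> \<le> 1\<close>, and the
  division with remainder rounds down by less than 1.  Together with the distance of \<open>t\<close> this
  leaves four integers.
\<close>

lemma near_quotient:
  fixes a b q n t :: int
  assumes n: "0 < n" and q: "q \<noteq> 0"
    and t: "\<bar>of_int t - (of_int a + of_int b * sqrt (of_int n)) / of_int q\<bar> < 1"
  shows "t \<in> {(a + approx_root n b) div q - 1 .. (a + approx_root n b) div q + 2}"
proof -
  define e where "e = a + approx_root n b"
  have q1: "1 \<le> \<bar>real_of_int q\<bar>" using q by linarith
  define \<delta> where "\<delta> = of_int b * sqrt (of_int n) - of_int (approx_root n b)"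
  have "\<bar>\<delta>\<bar> < 1" using approx_root[OF n, of b] by (simp add: \<delta>_def)
  then have "\<bar>\<delta> / of_int q\<bar> < 1" using q1 by (simp add: abs_divide divide_less_eq)
  moreover have "(of_int a + of_int b * sqrt (of_int n)) / of_int q = of_int e / of_int q + \<delta> / of_int q"
    by (simp add: e_def \<delta>_def flip: add_divide_distrib)
  ultimately have "\<bar>of_int t - of_int e / real_of_int q\<bar> < 2" using t by linarith
  moreover have "e div q = \<lfloor>of_int e / real_of_int q\<rfloor>" by (simp add: floor_divide_of_int_eq)
  ultimately show ?thesis unfolding e_def[symmetric] by (simp; linarith)
qed

definition first_near :: "(int \<Rightarrow> bool) \<Rightarrow> int \<Rightarrow> int" where
  "first_near P f = (if P (f - 1) then f - 1 else if P f then f else if P (f + 1) then f + 1 else f + 2)"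

definition last_near :: "(int \<Rightarrow> bool) \<Rightarrow> int \<Rightarrow> int" where
  "last_near P f = (if P (f + 2) then f + 2 else if P (f + 1) then f + 1 else if P f then f else f - 1)"

lemma Min_Max_near:
  fixes f :: int
  assumes "Z \<subseteq> {f - 1..f + 2}" "Z \<noteq> {}"
  shows "Min Z = first_near (\<lambda>t. t \<in> Z) f" "Max Z = last_near (\<lambda>t. t \<in> Z) f"
proof -
  have fin: "finite Z" using assms(1) finite_subset by blast
  have sub: "{f - 1..f + 2} = {f - 1, f, f + 1, f + 2}" by auto
  have *: "t = f - 1 \<or> t = f \<or> t = f + 1 \<or> t = f + 2" if "t \<in> Z" for t
    using that assms(1) unfolding sub by blast
  obtain z where z: "z \<in> Z" using assms(2) by blast
  show "Min Z = first_near (\<lambda>t. t \<in> Z) f"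
  proof (rule Min_eqI[OF fin])
    show "first_near (\<lambda>t. t \<in> Z) f \<le> y" if "y \<in> Z" for y
      using *[OF that] that by (auto simp: first_near_def)
    show "first_near (\<lambda>t. t \<in> Z) f \<in> Z"
      using *[OF z] z by (auto simp: first_near_def)
  qed
  show "Max Z = last_near (\<lambda>t. t \<in> Z) f"
  proof (rule Max_eqI[OF fin])
    show "y \<le> last_near (\<lambda>t. t \<in> Z) f" if "y \<in> Z" for y
      using *[OF that] that by (auto simp: last_near_def)
    show "last_near (\<lambda>t. t \<in> Z) f \<in> Z"
      using *[OF z] z by (auto simp: last_near_def)
  qed
qed

lemma ints_between_iff:
  assumes "\<beta> \<noteq> 0"
  shows "t \<in> ints_between ((- 1 / C - \<gamma>) / \<beta>) ((1 / C - \<gamma>) / \<beta>) \<longleftrightarrow> \<bar>of_int t * \<beta> + \<gamma>\<bar> \<le> \<bar>1 / C\<bar>"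
proof -
  have "min ((- 1 / C - \<gamma>) / \<beta>) ((1 / C - \<gamma>) / \<beta>) \<le> x \<and> x \<le> max ((- 1 / C - \<gamma>) / \<beta>) ((1 / C - \<gamma>) / \<beta>) \<longleftrightarrow>
      \<bar>x * \<beta> + \<gamma>\<bar> \<le> \<bar>1 / C\<bar>" for x
  proof (cases "0 < \<beta>")
    case True
    then have cmp: "u / \<beta> \<le> x \<longleftrightarrow> u \<le> x * \<beta>" "x \<le> u / \<beta> \<longleftrightarrow> x * \<beta> \<le> u" for u
      by (simp_all add: field_simps)
    show ?thesis
      unfolding min_le_iff_disj le_max_iff_disj cmp minus_divide_left[symmetric] by linarith
  next
    case False
    then have cmp: "u / \<beta> \<le> x \<longleftrightarrow> x * \<beta> \<le> u" "x \<le> u / \<beta> \<longleftrightarrow> u \<le> x * \<beta>" for u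
      using assms by (simp_all add: field_simps)
    show ?thesis
      unfolding min_le_iff_disj le_max_iff_disj cmp minus_divide_left[symmetric] by linarith
  qed
  then show ?thesis by (simp add: ints_between_def)
qed

text \<open>
  A \<open>t\<close> in the range of Step 4 satisfies \<open>\<bar>t \<beta> + \<gamma>\<bar> \<le> 1 / C < \<bar>\<beta>\<bar>\<close>, so it is at distance less
  than 1 from \<open>- \<gamma> / \<beta>\<close>.  The range is not empty: it contains the integer nearest to
  \<open>- \<gamma> / \<beta>\<close>, because \<open>\<bar>\<beta>\<bar> / 2 < 1 / C\<close>.
\<close>

lemma t_range:
  fixes a b q n :: int
  assumes C: "0 < C" and \<beta>: "1 / C < \<bar>\<beta>\<bar>" "\<bar>\<beta>\<bar> < sqrt 2 / C"
    and n: "0 < n" and q: "q \<noteq> 0" and r: "- \<gamma> / \<beta> = (of_int a + of_int b * sqrt (of_int n)) / of_int q"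
  defines "Z \<equiv> ints_between ((- 1 / C - \<gamma>) / \<beta>) ((1 / C - \<gamma>) / \<beta>)"
    and "f \<equiv> (a + approx_root n b) div q"
  shows "Min Z = first_near (\<lambda>t. \<bar>of_int t * \<beta> + \<gamma>\<bar> \<le> 1 / C) f"
    "Max Z = last_near (\<lambda>t. \<bar>of_int t * \<beta> + \<gamma>\<bar> \<le> 1 / C) f"
proof -
  have pos: "0 < 1 / C" using C by simp
  then have \<beta>0: "\<beta> \<noteq> 0" using \<beta> by auto
  have mem: "t \<in> Z \<longleftrightarrow> \<bar>of_int t * \<beta> + \<gamma>\<bar> \<le> 1 / C" for t
    using ints_between_iff[OF \<beta>0] pos unfolding Z_def by simp
  have dist: "\<bar>of_int t * \<beta> + \<gamma>\<bar> = \<bar>\<beta>\<bar> * \<bar>of_int t - (- \<gamma> / \<beta>)\<bar>" for t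
    using \<beta>0 by (simp flip: abs_mult add: algebra_simps)
  have "Z \<subseteq> {f - 1..f + 2}"
  proof
    fix t assume "t \<in> Z"
    then have "\<bar>\<beta>\<bar> * \<bar>of_int t - (- \<gamma> / \<beta>)\<bar> < \<bar>\<beta>\<bar> * 1" using mem dist \<beta>(1) by fastforce
    then have "\<bar>of_int t - (- \<gamma> / \<beta>)\<bar> < 1" using \<beta>0 by (simp add: mult_less_cancel_left)
    then show "t \<in> {f - 1..f + 2}" unfolding f_def using near_quotient[OF n q, of t a b] r by simp
  qed
  moreover have "round (- \<gamma> / \<beta>) \<in> Z"
  proof -
    have "\<bar>of_int (round (- \<gamma> / \<beta>)) - (- \<gamma> / \<beta>)\<bar> \<le> 1 / 2" by (rule of_int_round_abs_le)
    then have "\<bar>\<beta>\<bar> * \<bar>of_int (round (- \<gamma> / \<beta>)) - (- \<gamma> / \<beta>)\<bar> \<le> \<bar>\<beta>\<bar> * (1 / 2)"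
      by (intro mult_left_mono) auto
    moreover have "sqrt 2 / C \<le> 2 / C"
      using C sqrt2_less_2 by (intro divide_right_mono) auto
    ultimately show ?thesis unfolding mem dist using \<beta>(2) by (simp; linarith)
  qed
  then have "Z \<noteq> {}" by blast
  ultimately show "Min Z = first_near (\<lambda>t. \<bar>of_int t * \<beta> + \<gamma>\<bar> \<le> 1 / C) f"
    "Max Z = last_near (\<lambda>t. \<bar>of_int t * \<beta> + \<gamma>\<bar> \<le> 1 / C) f"
    using Min_Max_near[of Z f] unfolding mem by blast+
qed

section \<open>Comparing the values of B\<close>

text \<open>
  The fourth power of \<open>B g\<close> whenever \<open>B g\<close> is a positive real number.  In general \<open>root 4\<close> is
  extended to negative numbers as an odd function and is strictly increasing on all of \<open>\<real>\<close>, so that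
  \<open>B\<close> and this quotient always compare alike.
\<close>

definition B_pow4 :: "real \<Rightarrow> real \<times> real \<Rightarrow> real" where
  "B_pow4 C g = - ((C\<^sup>2 * (fst g)\<^sup>2 - 1) / (C\<^sup>2 * (snd g)\<^sup>2 - 1))"

lemma Bval_le_iff: "Bval C g \<le> Bval C h \<longleftrightarrow> B_pow4 C g \<le> B_pow4 C h"
  unfolding Bval_def B_pow4_def by simp

lemma default_roots:
  assumes "1 \<le> C"
  shows "1 / (2 * sqrt C) = root 4 (1 / (16 * C\<^sup>2))" "2 * sqrt C = root 4 (16 * C\<^sup>2)"
proof -
  have "(2 * sqrt C) ^ 4 = 16 * (sqrt C ^ 2) ^ 2" by (simp add: power_mult_distrib flip: power_mult)
  then have 4: "(2 * sqrt C) ^ 4 = 16 * C\<^sup>2" using assms by simp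
  then show "2 * sqrt C = root 4 (16 * C\<^sup>2)"
    using assms real_root_power_cancel[of 4 "2 * sqrt C"] by simp
  have "(1 / (2 * sqrt C)) ^ 4 = 1 / (16 * C\<^sup>2)" unfolding power_divide 4 by simp
  then show "1 / (2 * sqrt C) = root 4 (1 / (16 * C\<^sup>2))"
    using assms real_root_power_cancel[of 4 "1 / (2 * sqrt C)"] by simp
qed

lemma Bmin_le_iff:
  assumes "finite X"
  shows "Bmin C X \<le> y \<longleftrightarrow> ((\<forall>g\<in>X. \<not> (fst g)\<^sup>2 < 1 / C\<^sup>2) \<longrightarrow> 1 / (2 * sqrt C) \<le> y) \<and>
    (\<forall>g\<in>X. (fst g)\<^sup>2 < 1 / C\<^sup>2 \<longrightarrow> Bval C g \<le> y)"
  using assms by (auto simp: Bmin_def Let_def)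

lemma le_Bmax_iff:
  assumes "finite X"
  shows "x \<le> Bmax C X \<longleftrightarrow> ((\<forall>g\<in>X. \<not> (snd g)\<^sup>2 < 1 / C\<^sup>2) \<longrightarrow> x \<le> 2 * sqrt C) \<and>
    (\<forall>g\<in>X. (snd g)\<^sup>2 < 1 / C\<^sup>2 \<longrightarrow> x \<le> Bval C g)"
  using assms by (auto simp: Bmax_def Let_def)

lemma Bval_eq_Bmin_iff:
  assumes "finite X" "g \<in> X" "(fst g)\<^sup>2 < 1 / C\<^sup>2"
  shows "Bval C g = Bmin C X \<longleftrightarrow> (\<forall>h\<in>X. (fst h)\<^sup>2 < 1 / C\<^sup>2 \<longrightarrow> B_pow4 C h \<le> B_pow4 C g)"
proof -
  have "Bval C g \<le> Bmin C X" using Bmin_le_iff[OF assms(1), of C "Bmin C X"] assms by blast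
  then have "Bval C g = Bmin C X \<longleftrightarrow> Bmin C X \<le> Bval C g" by auto
  moreover have "\<not> (\<forall>h\<in>X. \<not> (fst h)\<^sup>2 < 1 / C\<^sup>2)" using assms by blast
  ultimately show ?thesis unfolding Bmin_le_iff[OF assms(1)] Bval_le_iff by simp
qed

lemma Bval_eq_Bmax_iff:
  assumes "finite X" "g \<in> X" "(snd g)\<^sup>2 < 1 / C\<^sup>2"
  shows "Bval C g = Bmax C X \<longleftrightarrow> (\<forall>h\<in>X. (snd h)\<^sup>2 < 1 / C\<^sup>2 \<longrightarrow> B_pow4 C g \<le> B_pow4 C h)"
proof -
  have "Bmax C X \<le> Bval C g" using le_Bmax_iff[OF assms(1), of "Bmax C X" C] assms by blast
  then have "Bval C g = Bmax C X \<longleftrightarrow> Bval C g \<le> Bmax C X" by auto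
  moreover have "\<not> (\<forall>h\<in>X. \<not> (snd h)\<^sup>2 < 1 / C\<^sup>2)" using assms by blast
  ultimately show ?thesis unfolding le_Bmax_iff[OF assms(1)] Bval_le_iff by simp
qed

text \<open>
  The final comparison without maxima, minima and roots.  Of the four combinations of empty and
  nonempty sets, the one with two default values always gives \<open>Bmin \<le> Bmax\<close>.
\<close>

lemma Bmin_le_Bmax_iff:
  assumes "1 \<le> C" "finite X"
  shows "Bmin C X \<le> Bmax C X \<longleftrightarrow>
    ((\<forall>g\<in>X. \<not> (fst g)\<^sup>2 < 1 / C\<^sup>2) \<longrightarrow>
      (\<forall>h\<in>X. (snd h)\<^sup>2 < 1 / C\<^sup>2 \<longrightarrow> 1 / (16 * C\<^sup>2) \<le> B_pow4 C h)) \<and>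
    ((\<forall>h\<in>X. \<not> (snd h)\<^sup>2 < 1 / C\<^sup>2) \<longrightarrow>
      (\<forall>g\<in>X. (fst g)\<^sup>2 < 1 / C\<^sup>2 \<longrightarrow> B_pow4 C g \<le> 16 * C\<^sup>2)) \<and>
    (\<forall>g\<in>X. (fst g)\<^sup>2 < 1 / C\<^sup>2 \<longrightarrow> (\<forall>h\<in>X. (snd h)\<^sup>2 < 1 / C\<^sup>2 \<longrightarrow> B_pow4 C g \<le> B_pow4 C h))"
proof -
  have "1 / (16 * C\<^sup>2) \<le> 16 * C\<^sup>2"
  proof -
    have "1 \<le> C\<^sup>2" using assms(1) by simp
    then have "1 / (16 * C\<^sup>2) \<le> 1" by (intro divide_le_eq_1_pos[THEN iffD2]) linarith+
    with \<open>1 \<le> C\<^sup>2\<close> show ?thesis by linarith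
  qed
  then have "root 4 (1 / (16 * C\<^sup>2)) \<le> root 4 (16 * C\<^sup>2)" by simp
  then have "1 / (2 * sqrt C) \<le> 2 * sqrt C" using default_roots[OF assms(1)] by (simp only:)
  moreover have "1 / (2 * sqrt C) \<le> Bval C h \<longleftrightarrow> 1 / (16 * C\<^sup>2) \<le> B_pow4 C h" for h
    unfolding default_roots(1)[OF assms(1)] Bval_def B_pow4_def by simp
  moreover have "Bval C g \<le> 2 * sqrt C \<longleftrightarrow> B_pow4 C g \<le> 16 * C\<^sup>2" for g
    unfolding default_roots(2)[OF assms(1)] Bval_def B_pow4_def by simp
  ultimately show ?thesis
    unfolding Bmin_le_iff[OF assms(2)] le_Bmax_iff[OF assms(2)] Bval_le_iff by blast
qed

section \<open>Algorithm A on registers\<close>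

definition rat_at :: "nat \<Rightarrow> state \<Rightarrow> real" where
  "rat_at i s = of_int (s i) / of_int (s (i + 1))"

text \<open>
  The element of \<open>F\<close> that is encoded in the four registers from \<open>i\<close> on.  The reduced basis of an
  encoded input is \<open>elt_at 9\<close>, \<open>elt_at 13\<close>.
\<close>

definition elt_at :: "nat \<Rightarrow> state \<Rightarrow> real \<times> real" where
  "elt_at i s =
    (rat_at i s + rat_at (i + 2) s * ((of_int (s 0) + root_discr s) / 2),
     rat_at i s + rat_at (i + 2) s * ((of_int (s 0) - root_discr s) / 2))"

lemma sign_computable_elt_at [polytime_intros]:
  "sign_computable (\<lambda>C s. rat_at i s)"
  "sign_computable (\<lambda>C s. fst (elt_at i s))" "sign_computable (\<lambda>C s. snd (elt_at i s))"
  unfolding elt_at_def rat_at_def fst_conv snd_conv by (intro polytime_intros)+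

text \<open>
  Numerator and denominator of the coordinate determinant of the reduced basis, over the product
  of the four denominators.
\<close>

definition det_num :: "state \<Rightarrow> int" where
  "det_num s = s 9 * s 15 * s 12 * s 14 - s 11 * s 13 * s 10 * s 16"

definition det_den :: "state \<Rightarrow> int" where
  "det_den s = s 10 * s 12 * s 14 * s 16"

text \<open>
  By Cramer's rule, \<open>one_num1 s / det_num s\<close> and \<open>one_num2 s / det_num s\<close> are the coefficients
  of 1 with respect to the reduced basis.
\<close>

definition one_num1 :: "state \<Rightarrow> int" where
  "one_num1 s = s 15 * s 10 * s 12 * s 14"

definition one_num2 :: "state \<Rightarrow> int" where
  "one_num2 s = - (s 11 * s 10 * s 14 * s 16)"

text \<open>
  Over a common denominator, an element of \<open>F\<close> is \<open>(A + B \<surd>\<Delta>) / q\<close> with integers \<open>A\<close>, \<open>B\<close>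
  and \<open>q\<close>.
\<close>

definition trace_part :: "nat \<Rightarrow> state \<Rightarrow> int" where
  "trace_part i s = 2 * s i * s (i + 3) + s (i + 2) * s (i + 1) * s 0"

definition root_part :: "nat \<Rightarrow> state \<Rightarrow> int" where
  "root_part i s = s (i + 2) * s (i + 1)"

definition common_den :: "nat \<Rightarrow> state \<Rightarrow> int" where
  "common_den i s = 2 * s (i + 1) * s (i + 3)"

text \<open>
  Multiplying numerator and denominator of \<open>- b\<^sub>2\<^sub>2 / b\<^sub>1\<^sub>2\<close> with the conjugate of \<open>b\<^sub>1\<^sub>2\<close> makes
  the denominator rational.  The result is \<open>(a + b \<surd>\<Delta>) / q\<close> with the following integers.
\<close>

definition ratio_a :: "state \<Rightarrow> int" where
  "ratio_a s =
    - (common_den 9 s * (trace_part 9 s * trace_part 13 s - root_part 9 s * root_part 13 s * s 0))"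

definition ratio_b :: "state \<Rightarrow> int" where
  "ratio_b s =
    - (common_den 9 s * (trace_part 13 s * root_part 9 s - trace_part 9 s * root_part 13 s))"

definition ratio_q :: "state \<Rightarrow> int" where
  "ratio_q s =
    common_den 13 s * (trace_part 9 s * trace_part 9 s - root_part 9 s * root_part 9 s * s 0)"

text \<open>
  The sign \<open>e\<close> selects the embedding: 1 for the second, \<open>- 1\<close> for the first, where the quotient is
  the conjugate one.
\<close>

definition t_guess :: "int \<Rightarrow> state \<Rightarrow> int" where
  "t_guess e s = (ratio_a s + approx_root (s 0) (e * ratio_b s)) div ratio_q s"

definition in_strip :: "real \<Rightarrow> real \<Rightarrow> real \<Rightarrow> int \<Rightarrow> bool" where
  "in_strip C \<beta> \<gamma> t \<longleftrightarrow> \<bar>of_int t * \<beta> + \<gamma>\<bar> \<le> 1 / C"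

definition survivor1 :: "real \<Rightarrow> (int \<times> int \<Rightarrow> real \<times> real) \<Rightarrow> int \<times> int \<Rightarrow> bool" where
  "survivor1 C g x \<longleftrightarrow> star_star C (g x) \<and> (fst (g x))\<^sup>2 < 1 / C\<^sup>2"

definition survivor2 :: "real \<Rightarrow> (int \<times> int \<Rightarrow> real \<times> real) \<Rightarrow> int \<times> int \<Rightarrow> bool" where
  "survivor2 C g x \<longleftrightarrow> star_star C (g x) \<and> (snd (g x))\<^sup>2 < 1 / C\<^sup>2"

text \<open>
  The condition \<open>Bmin \<le> Bmax\<close> in terms of the survivors of Step 5, in the form of
  \<open>Bmin_le_Bmax_iff\<close>.
\<close>

definition accepts :: "real \<Rightarrow> (int \<times> int \<Rightarrow> real \<times> real) \<Rightarrow> (int \<times> int) list \<Rightarrow> bool" where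
  "accepts C g L \<longleftrightarrow>
    ((\<forall>x\<in>set L. \<not> survivor1 C g x) \<longrightarrow>
      (\<forall>y\<in>set L. survivor2 C g y \<longrightarrow> 1 / (16 * C\<^sup>2) \<le> B_pow4 C (g y))) \<and>
    ((\<forall>y\<in>set L. \<not> survivor2 C g y) \<longrightarrow>
      (\<forall>x\<in>set L. survivor1 C g x \<longrightarrow> B_pow4 C (g x) \<le> 16 * C\<^sup>2)) \<and>
    (\<forall>x\<in>set L. survivor1 C g x \<longrightarrow> (\<forall>y\<in>set L. survivor2 C g y \<longrightarrow> B_pow4 C (g x) \<le> B_pow4 C (g y)))"

text \<open>
  The code of a completed run in which the maxima and minima are expressed by quantifiers over the
  list of candidates, whose tests are all decidable.
\<close>

definition completed_code :: "real \<Rightarrow> (int \<times> int \<Rightarrow> real \<times> real) \<Rightarrow> (int \<times> int) list \<Rightarrow> int list" where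
  "completed_code C g L = [of_bool (accepts C g L), 6] @ concat (map (\<lambda>x. pair_code (Some x)) L)
     @ map (\<lambda>x. of_bool (star_star C (g x))) L
     @ pair_code (find (\<lambda>x. survivor1 C g x \<and>
         (\<forall>y\<in>set L. survivor1 C g y \<longrightarrow> B_pow4 C (g y) \<le> B_pow4 C (g x))) L)
     @ pair_code (find (\<lambda>x. survivor2 C g x \<and>
         (\<forall>y\<in>set L. survivor2 C g y \<longrightarrow> B_pow4 C (g x) \<le> B_pow4 C (g y))) L)"

lemma find_filter: "find Q (filter P xs) = find (\<lambda>x. P x \<and> Q x) xs"
  by (induction xs) auto

text \<open>
  Searching \<open>G5\<close> for an element that attains \<open>Bmin\<close> amounts to searching all of \<open>G3\<close> for a
  survivor whose value no other survivor exceeds; likewise for \<open>Bmax\<close>.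
\<close>

lemma completed_code:
  fixes g :: "int \<times> int \<Rightarrow> real \<times> real" and G3 :: "(int \<times> int) list"
  assumes "1 \<le> C"
  defines "G5 \<equiv> filter (\<lambda>x. star_star C (g x)) G3"
  defines "X \<equiv> g ` set G5"
  shows "run_code (Completed G3 G5
      (find (\<lambda>x. (fst (g x))\<^sup>2 < 1 / C\<^sup>2 \<and> Bval C (g x) = Bmin C X) G5)
      (find (\<lambda>x. (snd (g x))\<^sup>2 < 1 / C\<^sup>2 \<and> Bval C (g x) = Bmax C X) G5)
      (Bmin C X \<le> Bmax C X)) = completed_code C g G3"
proof -
  have fin: "finite X" by (simp add: X_def)
  have ball: "(\<forall>h\<in>X. P h) \<longleftrightarrow> (\<forall>x\<in>set G3. star_star C (g x) \<longrightarrow> P (g x))" for P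
    by (auto simp: X_def G5_def)
  have acc: "Bmin C X \<le> Bmax C X \<longleftrightarrow> accepts C g G3"
    unfolding Bmin_le_Bmax_iff[OF assms(1) fin] ball accepts_def survivor1_def survivor2_def by blast
  have min: "(star_star C (g x) \<and> (fst (g x))\<^sup>2 < 1 / C\<^sup>2 \<and> Bval C (g x) = Bmin C X) \<longleftrightarrow>
      (survivor1 C g x \<and> (\<forall>y\<in>set G3. survivor1 C g y \<longrightarrow> B_pow4 C (g y) \<le> B_pow4 C (g x)))"
    if "x \<in> set G3" for x
  proof (cases "survivor1 C g x")
    case True
    then have "g x \<in> X" using that by (auto simp: X_def G5_def survivor1_def)
    from Bval_eq_Bmin_iff[OF fin this, of C] True show ?thesis
      unfolding ball survivor1_def by blast
  qed (auto simp: survivor1_def)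
  have max: "(star_star C (g x) \<and> (snd (g x))\<^sup>2 < 1 / C\<^sup>2 \<and> Bval C (g x) = Bmax C X) \<longleftrightarrow>
      (survivor2 C g x \<and> (\<forall>y\<in>set G3. survivor2 C g y \<longrightarrow> B_pow4 C (g x) \<le> B_pow4 C (g y)))"
    if "x \<in> set G3" for x
  proof (cases "survivor2 C g x")
    case True
    then have "g x \<in> X" using that by (auto simp: X_def G5_def survivor2_def)
    from Bval_eq_Bmax_iff[OF fin this, of C] True show ?thesis
      unfolding ball survivor2_def by blast
  qed (auto simp: survivor2_def)
  have flags: "map (\<lambda>x. of_bool (x \<in> set G5)) G3 = map (\<lambda>x. of_bool (star_star C (g x)) :: int) G3"
    by (simp add: G5_def)
  have "find (\<lambda>x. (fst (g x))\<^sup>2 < 1 / C\<^sup>2 \<and> Bval C (g x) = Bmin C X) G5 =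
      find (\<lambda>x. survivor1 C g x \<and> (\<forall>y\<in>set G3. survivor1 C g y \<longrightarrow> B_pow4 C (g y) \<le> B_pow4 C (g x))) G3"
    unfolding G5_def find_filter by (rule find_cong[OF refl]) (rule min)
  moreover have "find (\<lambda>x. (snd (g x))\<^sup>2 < 1 / C\<^sup>2 \<and> Bval C (g x) = Bmax C X) G5 =
      find (\<lambda>x. survivor2 C g x \<and> (\<forall>y\<in>set G3. survivor2 C g y \<longrightarrow> B_pow4 C (g x) \<le> B_pow4 C (g y))) G3"
    unfolding G5_def find_filter by (rule find_cong[OF refl]) (rule max)
  ultimately show ?thesis
    unfolding completed_code_def run_code.simps acc flags by simp
qed

text \<open>
  The bounds with \<open>\<surd>2\<close> are squared, since \<open>\<surd>2\<close> need not be a rational function of \<open>C\<close> and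
  \<open>\<surd>\<Delta>\<close>.
\<close>

definition step4_code :: "real \<Rightarrow> state \<Rightarrow> int list" where
  "step4_code C s = (let b1 = elt_at 9 s; b2 = elt_at 13 s; g = comb b1 b2 in
    if 2 / C\<^sup>2 \<le> (fst b1)\<^sup>2 + (snd b1)\<^sup>2 then [1, 4]
    else if 0 < fst b1 \<and> fst b1 < 1 / C \<and> 1 / C < \<bar>snd b1\<bar> \<and> (snd b1)\<^sup>2 < 2 / C\<^sup>2 then
      completed_code C g ((1, 0) # (first_near (in_strip C (snd b1) (snd b2)) (t_guess 1 s), 1) #
        (last_near (in_strip C (snd b1) (snd b2)) (t_guess 1 s), 1) # map (\<lambda>t. (t, 1)) [- 2..2])
    else if 1 / C < fst b1 \<and> (fst b1)\<^sup>2 < 2 / C\<^sup>2 \<and> 0 < \<bar>snd b1\<bar> \<and> \<bar>snd b1\<bar> < 1 / C then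
      completed_code C g ((1, 0) # (first_near (in_strip C (fst b1) (fst b2)) (t_guess (- 1) s), 1) #
        (last_near (in_strip C (fst b1) (fst b2)) (t_guess (- 1) s), 1) # map (\<lambda>t. (t, 1)) [- 2..2])
    else completed_code C g ((1, 0) # map (\<lambda>t. (t, 1)) [- 2..2]))"

text \<open>
  Steps 1 to 3 with the quantifiers over the ideal and over all \<open>k\<close> replaced by finitely many
  tests.
\<close>

definition algorithm_code :: "real \<Rightarrow> state \<Rightarrow> int list" where
  "algorithm_code C s =
    (let m = one_num1 s div det_num s; n = one_num2 s div det_num s; g = comb (elt_at 9 s) (elt_at 13 s) in
    if \<not> (m * det_num s = one_num1 s \<and> n * det_num s = one_num2 s \<and>
          1 / \<bar>of_int (det_num s) / of_int (det_den s)\<bar> < C\<^sup>2 * root_discr s) then [0, 1]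
    else if \<not> gcd m n = 1 then [0, 2]
    else if g (1, 0) \<in> S1 C \<or> g (- 1, 1) \<in> S1 C \<or> g (0, 1) \<in> S1 C \<or> g (1, 1) \<in> S1 C then [0, 3]
    else step4_code C s)"

section \<open>Running time\<close>

lemma sign_computable_comb [polytime_intros]:
  assumes "polytime a" "polytime b"
  shows "sign_computable (\<lambda>C s. fst (comb (elt_at i s) (elt_at j s) (a C s, b C s)))"
    "sign_computable (\<lambda>C s. snd (comb (elt_at i s) (elt_at j s) (a C s, b C s)))"
  unfolding comb_simps fst_conv snd_conv by (intro polytime_intros assms)+

lemma S1_iff: "g \<in> S1 C \<longleftrightarrow> \<bar>fst g\<bar> \<le> 1 / C \<and> \<bar>snd g\<bar> \<le> 1 / C \<and> (fst g)\<^sup>2 + (snd g)\<^sup>2 < 2 / C\<^sup>2"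
  by (cases g) (simp add: S1_def)

lemma decidable_S1 [polytime_intros]:
  assumes "polytime a" "polytime b"
  shows "decidable (\<lambda>C s. comb (elt_at i s) (elt_at j s) (a C s, b C s) \<in> S1 C)"
  unfolding S1_iff using assms by (intro polytime_intros)

lemma decidable_survivors [polytime_intros]:
  assumes "polytime a" "polytime b"
  shows "decidable (\<lambda>C s. star_star C (comb (elt_at i s) (elt_at j s) (a C s, b C s)))"
    "decidable (\<lambda>C s. survivor1 C (comb (elt_at i s) (elt_at j s)) (a C s, b C s))"
    "decidable (\<lambda>C s. survivor2 C (comb (elt_at i s) (elt_at j s)) (a C s, b C s))"
  unfolding star_star_def survivor1_def survivor2_def by (intro polytime_intros assms)+

lemma sign_computable_B_pow4 [polytime_intros]:
  assumes "polytime a" "polytime b"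
  shows "sign_computable (\<lambda>C s. B_pow4 C (comb (elt_at i s) (elt_at j s) (a C s, b C s)))"
  unfolding B_pow4_def using assms by (intro polytime_intros)

lemma decidable_predI:
  "(\<And>a b. polytime a \<Longrightarrow> polytime b \<Longrightarrow> decidable (\<lambda>C s. Q C s (a C s, b C s))) \<Longrightarrow> decidable_pred Q"
  by (simp add: decidable_pred_def)

lemma polytime_entries_completed_code:
  assumes L: "candidates L"
  shows "polytime_entries (\<lambda>C s. completed_code C (comb (elt_at i s) (elt_at j s)) (L C s))"
proof -
  let ?g = "\<lambda>s. comb (elt_at i s) (elt_at j s)"
  have ball: "decidable (\<lambda>C s. \<forall>x\<in>set (L C s). Q C s x)" if
      "\<And>a b. polytime a \<Longrightarrow> polytime b \<Longrightarrow> decidable (\<lambda>C s. Q C s (a C s, b C s))" for Q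
    using that by (intro decidable_Ball[OF L] decidable_predI)
  have acc: "decidable (\<lambda>C s. accepts C (?g s) (L C s))"
    unfolding accepts_def by (intro polytime_intros ball)
  have flag: "decidable_pred (\<lambda>C s x. star_star C (?g s x))"
    by (intro decidable_predI polytime_intros)
  have min: "decidable_pred (\<lambda>C s x. survivor1 C (?g s) x \<and>
         (\<forall>y\<in>set (L C s). survivor1 C (?g s) y \<longrightarrow> B_pow4 C (?g s y) \<le> B_pow4 C (?g s x)))"
    by (intro decidable_predI polytime_intros ball)
  have max: "decidable_pred (\<lambda>C s x. survivor2 C (?g s) x \<and>
         (\<forall>y\<in>set (L C s). survivor2 C (?g s) y \<longrightarrow> B_pow4 C (?g s x) \<le> B_pow4 C (?g s y)))"
    by (intro decidable_predI polytime_intros ball)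
  have "polytime_entries (\<lambda>C s. of_bool (accepts C (?g s) (L C s)) # 6 #
     concat (map (\<lambda>x. pair_code (Some x)) (L C s))
     @ map (\<lambda>x. of_bool (star_star C (?g s x))) (L C s)
     @ pair_code (find (\<lambda>x. survivor1 C (?g s) x \<and>
         (\<forall>y\<in>set (L C s). survivor1 C (?g s) y \<longrightarrow> B_pow4 C (?g s y) \<le> B_pow4 C (?g s x))) (L C s))
     @ pair_code (find (\<lambda>x. survivor2 C (?g s) x \<and>
         (\<forall>y\<in>set (L C s). survivor2 C (?g s) y \<longrightarrow> B_pow4 C (?g s x) \<le> B_pow4 C (?g s y))) (L C s)) @ [])"
    by (intro polytime_entries_Cons polytime_of_bool acc polytime_const polytime_entries_pairs[OF L]
        polytime_entries_flags[OF L flag] polytime_entries_find[OF L min]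
        polytime_entries_find[OF L max] polytime_entries_Nil)
  then show ?thesis by (simp add: completed_code_def)
qed

lemma polytime_approx_root [polytime_intros]:
  assumes "polytime f" "polytime g"
  shows "polytime (\<lambda>C s. approx_root (f C s) (g C s))"
proof -
  have "decidable (\<lambda>C s. real_of_int (g C s) < real_of_int 0)"
    using assms by (intro polytime_intros)
  then have "decidable (\<lambda>C s. g C s < 0)" unfolding of_int_less_iff .
  with assms show ?thesis unfolding approx_root_def by (intro polytime_intros)
qed

lemma polytime_t_guess [polytime_intros]: "polytime (\<lambda>C s. t_guess e s)"
  unfolding t_guess_def ratio_a_def ratio_b_def ratio_q_def trace_part_def root_part_def common_den_def
  by (intro polytime_intros)

lemma polytime_near [polytime_intros]:
  assumes "sign_computable F" "sign_computable G" "polytime f"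
  shows "polytime (\<lambda>C s. first_near (in_strip C (F C s) (G C s)) (f C s))"
    "polytime (\<lambda>C s. last_near (in_strip C (F C s) (G C s)) (f C s))"
  unfolding first_near_def last_near_def in_strip_def by (intro polytime_intros assms)+

lemma candidates_range: "candidates (\<lambda>C s. map (\<lambda>t. (t, 1)) [- 2..2])"
  by (simp add: upto.simps) (intro candidates.intros polytime_const)

lemma polytime_entries_const: "polytime_entries (\<lambda>C s. [a, b])"
  by (intro polytime_entries_Cons polytime_entries_Nil polytime_const)

lemma polytime_entries_algorithm_code: "polytime_entries algorithm_code"
proof -
  have 4: "polytime_entries step4_code"
    unfolding step4_code_def Let_def
    by (intro polytime_entries_if polytime_entries_const polytime_entries_completed_code
        candidates.cons candidates_range polytime_intros)
  show ?thesis
    unfolding algorithm_code_def Let_def det_num_def det_den_def one_num1_def one_num2_def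
    by (intro polytime_entries_if polytime_entries_const 4 polytime_intros)
qed

section \<open>Agreement with Algorithm A\<close>

lemma comb_eq_0_iff:
  assumes "cross x y \<noteq> 0"
  shows "comb x y st = 0 \<longleftrightarrow> st = (0, 0)"
proof
  assume 0: "comb x y st = 0"
  have "of_int (fst st) * cross x y = fst (comb x y st) * snd y - snd (comb x y st) * fst y"
    "of_int (snd st) * cross x y = snd (comb x y st) * fst x - fst (comb x y st) * snd x"
    by (simp_all add: cross_def algebra_simps)
  from this[unfolded 0] assms show "st = (0, 0)" by (simp add: prod_eq_iff)
qed (simp add: comb_def)

lemma elt_at_conjugates:
  assumes "s (i + 1) \<noteq> 0" "s (i + 3) \<noteq> 0"
  shows "fst (elt_at i s) =
      (of_int (trace_part i s) + of_int (root_part i s) * root_discr s) / of_int (common_den i s)"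
    "snd (elt_at i s) =
      (of_int (trace_part i s) - of_int (root_part i s) * root_discr s) / of_int (common_den i s)"
  using assms
  by (simp_all add: elt_at_def rat_at_def trace_part_def root_part_def common_den_def field_simps numeral_eq_Suc)

text \<open>
  Here \<open>w\<close> may be either square root of \<open>D\<close>; the negative one gives the other embedding.
\<close>

lemma ratio_of_conjugates:
  fixes A1 B1 A2 B2 q1 q2 w D :: real
  assumes "w * w = D" "A1 + B1 * w \<noteq> 0" "A1 - B1 * w \<noteq> 0" "q1 \<noteq> 0" "q2 \<noteq> 0"
  shows "- ((A2 - B2 * w) / q2) / ((A1 - B1 * w) / q1) =
    (- (q1 * (A1 * A2 - B1 * B2 * D)) + - (q1 * (A2 * B1 - A1 * B2)) * w) / (q2 * (A1 * A1 - B1 * B1 * D))"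
proof -
  have "A1 * A1 - B1 * B1 * D = (A1 - B1 * w) * (A1 + B1 * w)"
    "- (q1 * (A1 * A2 - B1 * B2 * D)) + - (q1 * (A2 * B1 - A1 * B2)) * w
      = - (q1 * (A2 - B2 * w)) * (A1 + B1 * w)"
    by (simp_all add: assms(1)[symmetric] algebra_simps)
  moreover have "- (K / q2) / (M / q1) = - (q1 * K) * P / (q2 * (M * P))"
    if "P \<noteq> 0" "M \<noteq> 0" for K M P
    using that assms(4,5) by (simp add: field_simps)
  ultimately show ?thesis using assms(2,3) by (simp only:)
qed

lemma comb_scale: "comb x y (k * a, k * b) = of_int k *\<^sub>R comb x y (a, b)"
  by (simp add: comb_def scaleR_add_right)

text \<open>
  The facts about a state that encodes a basis of \<open>I\<close> by \<open>b\<^sub>1 = p + q \<omega>\<close>,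
  \<open>b\<^sub>2 = r + u \<omega>\<close>, with \<open>p, q, r, u\<close> given by the registers 9 to 16.
\<close>

locale encoded_basis =
  fixes s :: state and I :: "(real \<times> real) set"
  assumes discr: "0 < s 0"
    and den: "s 10 \<noteq> 0" "s 12 \<noteq> 0" "s 14 \<noteq> 0" "s 16 \<noteq> 0"
    and basis: "Z_basis I (elt_at 9 s) (elt_at 13 s)"
begin

abbreviation "b1 \<equiv> elt_at 9 s"
abbreviation "b2 \<equiv> elt_at 13 s"

definition coord_det :: real where
  "coord_det = rat_at 9 s * rat_at 15 s - rat_at 11 s * rat_at 13 s"

lemma root_discr: "root_discr s = sqrt (of_int (s 0))" "0 < root_discr s"
  using discr by (simp_all add: root_discr_def)

lemma det_nums:
  "of_int (det_num s) = coord_det * of_int (det_den s)"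
  "of_int (one_num1 s) = rat_at 15 s * of_int (det_den s)"
  "of_int (one_num2 s) = - rat_at 11 s * of_int (det_den s)"
  using den by (simp_all add: det_num_def det_den_def one_num1_def one_num2_def coord_det_def rat_at_def
      field_simps)

lemma cross_det: "cross b1 b2 = - coord_det * root_discr s"
  by (simp add: cross_def elt_at_def coord_det_def field_simps)

lemma nonzero: "coord_det \<noteq> 0" "det_num s \<noteq> 0" "det_den s \<noteq> 0"
proof -
  show "coord_det \<noteq> 0" using basis cross_det by (auto simp: Z_basis_alt)
  show "det_den s \<noteq> 0" using den by (simp add: det_den_def)
  with \<open>coord_det \<noteq> 0\<close> show "det_num s \<noteq> 0" using det_nums(1) by auto
qed

text \<open>
  The numbers 1 and \<open>\<omega>\<close> are linearly independent because \<open>\<omega>\<close> and its conjugate differ by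
  \<open>\<surd>\<Delta> > 0\<close>.  So the equation is a linear system in rational coordinates, which is solved by
  Cramer's rule.
\<close>

lemma one_eq_comb:
  "comb b1 b2 (m, n) = (1, 1) \<longleftrightarrow> m * det_num s = one_num1 s \<and> n * det_num s = one_num2 s"
proof -
  let ?p = "rat_at 9 s" and ?q = "rat_at 11 s" and ?r = "rat_at 13 s" and ?u = "rat_at 15 s"
  have "comb b1 b2 (m, n) = (1, 1) \<longleftrightarrow> m * ?p + n * ?r = 1 \<and> m * ?q + n * ?u = 0"
  proof -
    define x y where "x = m * ?p + n * ?r" "y = m * ?q + n * ?u"
    have "comb b1 b2 (m, n) = (x + y * ((of_int (s 0) + root_discr s) / 2),
        x + y * ((of_int (s 0) - root_discr s) / 2))"
      by (simp add: comb_def elt_at_def x_y_def algebra_simps)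
    moreover have "y = 0" if "x + y * ((of_int (s 0) + root_discr s) / 2) = 1"
      "x + y * ((of_int (s 0) - root_discr s) / 2) = 1"
    proof -
      have "y * root_discr s = (x + y * ((of_int (s 0) + root_discr s) / 2)) -
          (x + y * ((of_int (s 0) - root_discr s) / 2))" by (simp add: field_simps)
      then have "y * root_discr s = 0" unfolding that by simp
      then show ?thesis using root_discr(2) by simp
    qed
    ultimately have "comb b1 b2 (m, n) = (1, 1) \<longleftrightarrow> x = 1 \<and> y = 0" by auto
    then show ?thesis unfolding x_y_def .
  qed
  also have "\<dots> \<longleftrightarrow> m * coord_det = ?u \<and> n * coord_det = - ?q"
  proof
    assume 1: "m * ?p + n * ?r = 1 \<and> m * ?q + n * ?u = 0"
    have "m * coord_det = (m * ?p + n * ?r) * ?u - (m * ?q + n * ?u) * ?r"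
      "n * coord_det = (m * ?q + n * ?u) * ?p - (m * ?p + n * ?r) * ?q"
      by (simp_all add: coord_det_def algebra_simps)
    with 1 show "m * coord_det = ?u \<and> n * coord_det = - ?q" by simp
  next
    assume 2: "m * coord_det = ?u \<and> n * coord_det = - ?q"
    then have e: "m * coord_det = ?u" "n * coord_det = - ?q" by auto
    have "(m * ?p + n * ?r) * coord_det = (m * coord_det) * ?p + (n * coord_det) * ?r"
      "(m * ?q + n * ?u) * coord_det = (m * coord_det) * ?q + (n * coord_det) * ?u" by (simp_all add: algebra_simps)
    moreover have "?u * ?p + - ?q * ?r = coord_det" "?u * ?q + - ?q * ?u = 0"
      by (simp_all add: coord_det_def algebra_simps)
    ultimately have "(m * ?p + n * ?r) * coord_det = coord_det" "(m * ?q + n * ?u) * coord_det = 0"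
      unfolding e by simp_all
    then show "m * ?p + n * ?r = 1 \<and> m * ?q + n * ?u = 0" using nonzero(1) by simp
  qed
  also have "\<dots> \<longleftrightarrow> real_of_int (m * det_num s) = real_of_int (one_num1 s) \<and>
      real_of_int (n * det_num s) = real_of_int (one_num2 s)"
  proof -
    have e: "real_of_int (k * det_num s) = (k * coord_det) * of_int (det_den s)" for k
      by (simp add: det_nums)
    show ?thesis unfolding e det_nums(2,3) mult_cancel_right using nonzero(3) by simp
  qed
  finally show ?thesis by (simp only: of_int_eq_iff)
qed

lemma one_mem_iff:
  "(1, 1) \<in> I \<longleftrightarrow> (one_num1 s div det_num s) * det_num s = one_num1 s \<and>
    (one_num2 s div det_num s) * det_num s = one_num2 s"
proof -
  have "(1, 1) \<in> I \<longleftrightarrow> (\<exists>m n. comb b1 b2 (m, n) = (1, 1))"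
    using basis unfolding Z_basis_alt by (simp add: image_iff eq_commute[of "(1 :: real, 1 :: real)"])
  also have "\<dots> \<longleftrightarrow> det_num s dvd one_num1 s \<and> det_num s dvd one_num2 s"
    unfolding one_eq_comb by (auto simp: dvd_def) (metis mult.commute)+
  finally show ?thesis
    by (simp only: dvd_div_eq_mult[symmetric] dvd_eq_mod_eq_0)
      (metis div_mult_mod_eq add_cancel_right_right)
qed

text \<open>
  The element \<open>1 / k\<close> has the coefficients \<open>m / k\<close> and \<open>n / k\<close>, so it lies in \<open>I\<close> if and only
  if \<open>k\<close> divides both \<open>m\<close> and \<open>n\<close>.
\<close>

lemma primitive_iff:
  assumes "comb b1 b2 (m, n) = (1, 1)"
  shows "step2_ok I \<longleftrightarrow> gcd m n = 1"
proof -
  have mem: "(1, 1) \<in> I" using assms basis unfolding Z_basis_alt by (metis rangeI)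
  have frac: "(1 / of_int k, 1 / of_int k) \<in> I \<longleftrightarrow> k dvd m \<and> k dvd n" if "2 \<le> k" for k :: int
  proof
    assume "(1 / of_int k, 1 / of_int k) \<in> I"
    then obtain m' n' where "comb b1 b2 (m', n') = (1 / of_int k, 1 / of_int k)"
      using basis unfolding Z_basis_alt by (metis rangeE surj_pair)
    then have "comb b1 b2 (k * m', k * n') = (1, 1)"
      unfolding comb_scale using that by simp
    then have "m = k * m'" "n = k * n'"
      using assms nonzero(2) unfolding one_eq_comb by (metis mult_cancel_right)+
    then show "k dvd m \<and> k dvd n" by simp
  next
    assume "k dvd m \<and> k dvd n"
    then obtain m' n' where "m = k * m'" "n = k * n'" by (auto simp: dvd_def)
    with assms have "(1 / of_int k) *\<^sub>R (of_int k *\<^sub>R comb b1 b2 (m', n')) = (1 / of_int k, 1 / of_int k)"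
      by (simp add: comb_scale)
    then have "comb b1 b2 (m', n') = (1 / of_int k, 1 / of_int k)"
      using that by simp
    then show "(1 / of_int k, 1 / of_int k) \<in> I" using basis unfolding Z_basis_alt by (metis rangeI)
  qed
  show ?thesis
  proof
    assume "gcd m n = 1"
    then have "\<not> (k dvd m \<and> k dvd n)" if "2 \<le> k" for k
      using that zdvd_imp_le[of k 1] gcd_greatest[of k m n] by auto
    then show "step2_ok I" using mem frac by (simp add: step2_ok_def)
  next
    assume "step2_ok I"
    then have "\<not> 2 \<le> gcd m n" using frac unfolding step2_ok_def by (metis gcd_dvd1 gcd_dvd2)
    moreover have "gcd m n \<noteq> 0" using assms by (auto simp: comb_def prod_eq_iff)
    moreover have "0 \<le> gcd m n" by simp
    ultimately show "gcd m n = 1" by linarith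
  qed
qed

text \<open>
  The assumption \<open>vol\<close> is the inequality of Step 1; it says that the covolume exceeds \<open>1 / C\<^sup>2\<close>.
\<close>

lemma step3_iff:
  assumes C: "0 < C" and red: "LLL_reduced b1 b2"
    and vol: "1 / \<bar>of_int (det_num s) / of_int (det_den s)\<bar> < C\<^sup>2 * root_discr s"
  shows "\<not> step3_ok C I \<longleftrightarrow> comb b1 b2 (1, 0) \<in> S1 C \<or> comb b1 b2 (- 1, 1) \<in> S1 C \<or>
    comb b1 b2 (0, 1) \<in> S1 C \<or> comb b1 b2 (1, 1) \<in> S1 C"
proof -
  have nz: "cross b1 b2 \<noteq> 0" and I: "I = range (comb b1 b2)" using basis by (simp_all add: Z_basis_alt)
  have coord_det: "of_int (det_num s) / of_int (det_den s) = coord_det" using nonzero(3) by (simp add: det_nums)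
  have "1 / C\<^sup>2 < \<bar>coord_det\<bar> * root_discr s"
    using vol C nonzero(1) unfolding coord_det by (simp add: field_simps)
  then have vol': "1 / C\<^sup>2 < \<bar>cross b1 b2\<bar>" using root_discr(2) by (simp add: cross_det abs_mult)
  have "\<not> step3_ok C I \<longleftrightarrow> (\<exists>a b. (a, b) \<noteq> (0, 0) \<and> comb b1 b2 (a, b) \<in> S1 C)"
    unfolding step3_ok_def I using comb_eq_0_iff[OF nz] by auto
  also have "\<dots> \<longleftrightarrow> (\<exists>st\<in>{(1, 0), (- 1, 1), (0, 1), (1, 1)}. comb b1 b2 st \<in> S1 C)"
  proof
    assume "\<exists>a b. (a, b) \<noteq> (0, 0) \<and> comb b1 b2 (a, b) \<in> S1 C"
    then show "\<exists>st\<in>{(1, 0), (- 1, 1), (0, 1), (1, 1)}. comb b1 b2 st \<in> S1 C"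
      using S1_meets_reduced_lattice[OF C red vol'] by blast
  next
    assume "\<exists>st\<in>{(1, 0), (- 1, 1), (0, 1), (1, 1)}. comb b1 b2 st \<in> S1 C"
    then obtain st where "st \<in> {(1, 0), (- 1, 1), (0, 1), (1, 1)}" "comb b1 b2 st \<in> S1 C" by blast
    then show "\<exists>a b. (a, b) \<noteq> (0, 0) \<and> comb b1 b2 (a, b) \<in> S1 C"
      by (intro exI[of _ "fst st"] exI[of _ "snd st"]) auto
  qed
  finally show ?thesis by simp
qed

lemma ratio_eqs:
  assumes "fst b1 \<noteq> 0" "snd b1 \<noteq> 0"
  shows "- snd b2 / snd b1 =
      (of_int (ratio_a s) + of_int (1 * ratio_b s) * sqrt (of_int (s 0))) / of_int (ratio_q s)"
    "- fst b2 / fst b1 =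
      (of_int (ratio_a s) + of_int (- 1 * ratio_b s) * sqrt (of_int (s 0))) / of_int (ratio_q s)"
    "ratio_q s \<noteq> 0"
proof -
  let ?w = "root_discr s"
  have b: "fst b1 = (of_int (trace_part 9 s) + of_int (root_part 9 s) * ?w) / of_int (common_den 9 s)"
    "snd b1 = (of_int (trace_part 9 s) - of_int (root_part 9 s) * ?w) / of_int (common_den 9 s)"
    "fst b2 = (of_int (trace_part 13 s) + of_int (root_part 13 s) * ?w) / of_int (common_den 13 s)"
    "snd b2 = (of_int (trace_part 13 s) - of_int (root_part 13 s) * ?w) / of_int (common_den 13 s)"
    by (rule elt_at_conjugates; use den in simp)+
  have q: "real_of_int (common_den 9 s) \<noteq> 0" "real_of_int (common_den 13 s) \<noteq> 0"
    using den by (simp_all add: common_den_def)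
  have w: "?w * ?w = of_int (s 0)" "- ?w * - ?w = of_int (s 0)" using discr by (simp_all add: root_discr_square)
  have nz: "of_int (trace_part 9 s) + of_int (root_part 9 s) * ?w \<noteq> 0"
    "of_int (trace_part 9 s) - of_int (root_part 9 s) * ?w \<noteq> 0" using assms unfolding b by auto
  show "- snd b2 / snd b1 =
      (of_int (ratio_a s) + of_int (1 * ratio_b s) * sqrt (of_int (s 0))) / of_int (ratio_q s)"
    unfolding b ratio_of_conjugates[OF w(1) nz q] by (simp add: ratio_a_def ratio_b_def ratio_q_def root_discr)
  have nz': "of_int (trace_part 9 s) + of_int (root_part 9 s) * (- ?w) \<noteq> 0"
    "of_int (trace_part 9 s) - of_int (root_part 9 s) * (- ?w) \<noteq> 0" using nz by auto
  show "- fst b2 / fst b1 =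
      (of_int (ratio_a s) + of_int (- 1 * ratio_b s) * sqrt (of_int (s 0))) / of_int (ratio_q s)"
    using ratio_of_conjugates[OF w(2) nz' q, of "of_int (trace_part 13 s)" "of_int (root_part 13 s)"]
    unfolding b by (simp add: ratio_a_def ratio_b_def ratio_q_def root_discr)
  have "real_of_int (trace_part 9 s * trace_part 9 s - root_part 9 s * root_part 9 s * s 0) =
      (of_int (trace_part 9 s) + of_int (root_part 9 s) * ?w) *
      (of_int (trace_part 9 s) - of_int (root_part 9 s) * ?w)"
    by (simp add: w(1)[symmetric] algebra_simps)
  with nz have "real_of_int (trace_part 9 s * trace_part 9 s - root_part 9 s * root_part 9 s * s 0) \<noteq> 0"
    by simp
  with q show "ratio_q s \<noteq> 0" unfolding ratio_q_def by (simp del: of_int_mult of_int_diff)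
qed

lemma less_sqrt2_iff: "0 < C \<Longrightarrow> \<bar>x\<bar> < sqrt 2 / C \<longleftrightarrow> x\<^sup>2 < 2 / C\<^sup>2"
  using abs_le_square_iff[of "sqrt 2 / C" x] by (simp add: power_divide not_le[symmetric])

lemma step4_code_eq:
  assumes C: "1 \<le> C" and pos: "0 < fst b1"
  shows "step4_code C s = run_code (if norm b1 \<ge> sqrt 2 / C then Accepted_at_step4
     else
       (let G3 = G3_list C b1 b2;
            G5 = filter (\<lambda>st. star_star C (comb b1 b2 st)) G3;
            X = comb b1 b2 ` set G5;
            at_min = find (\<lambda>st. (fst (comb b1 b2 st))\<^sup>2 < 1 / C\<^sup>2 \<and> Bval C (comb b1 b2 st) = Bmin C X) G5;
            at_max = find (\<lambda>st. (snd (comb b1 b2 st))\<^sup>2 < 1 / C\<^sup>2 \<and> Bval C (comb b1 b2 st) = Bmax C X) G5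
        in Completed G3 G5 at_min at_max (Bmin C X \<le> Bmax C X)))"
proof -
  have C0: "0 < C" using C by simp
  have norm: "norm b1 \<ge> sqrt 2 / C \<longleftrightarrow> 2 / C\<^sup>2 \<le> (fst b1)\<^sup>2 + (snd b1)\<^sup>2"
    using less_sqrt2_iff[OF C0, of "norm b1", unfolded abs_norm_cancel]
    by (simp add: not_less[symmetric] norm_prod_def real_sqrt_pow2[OF sum_power2_ge_zero])
  have t: "first_near (in_strip C (snd b1) (snd b2)) (t_guess 1 s) =
        Min (ints_between ((- 1 / C - snd b2) / snd b1) ((1 / C - snd b2) / snd b1))"
    "last_near (in_strip C (snd b1) (snd b2)) (t_guess 1 s) =
        Max (ints_between ((- 1 / C - snd b2) / snd b1) ((1 / C - snd b2) / snd b1))"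
    if "1 / C < \<bar>snd b1\<bar>" "\<bar>snd b1\<bar> < sqrt 2 / C"
  proof -
    have nz: "fst b1 \<noteq> 0" "snd b1 \<noteq> 0" using pos that C0 by auto
    from t_range[OF C0 that discr ratio_eqs(3,1)[OF nz]]
    show "first_near (in_strip C (snd b1) (snd b2)) (t_guess 1 s) =
        Min (ints_between ((- 1 / C - snd b2) / snd b1) ((1 / C - snd b2) / snd b1))"
      "last_near (in_strip C (snd b1) (snd b2)) (t_guess 1 s) =
        Max (ints_between ((- 1 / C - snd b2) / snd b1) ((1 / C - snd b2) / snd b1))"
      unfolding t_guess_def in_strip_def by simp_all
  qed
  have t': "first_near (in_strip C (fst b1) (fst b2)) (t_guess (- 1) s) =
        Min (ints_between ((- 1 / C - fst b2) / fst b1) ((1 / C - fst b2) / fst b1))"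
    "last_near (in_strip C (fst b1) (fst b2)) (t_guess (- 1) s) =
        Max (ints_between ((- 1 / C - fst b2) / fst b1) ((1 / C - fst b2) / fst b1))"
    if "1 / C < \<bar>fst b1\<bar>" "\<bar>fst b1\<bar> < sqrt 2 / C" "0 < \<bar>snd b1\<bar>"
  proof -
    have nz: "fst b1 \<noteq> 0" "snd b1 \<noteq> 0" using pos that by auto
    from t_range[OF C0 that(1,2) discr ratio_eqs(3,2)[OF nz]]
    show "first_near (in_strip C (fst b1) (fst b2)) (t_guess (- 1) s) =
        Min (ints_between ((- 1 / C - fst b2) / fst b1) ((1 / C - fst b2) / fst b1))"
      "last_near (in_strip C (fst b1) (fst b2)) (t_guess (- 1) s) =
        Max (ints_between ((- 1 / C - fst b2) / fst b1) ((1 / C - fst b2) / fst b1))"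
      unfolding t_guess_def in_strip_def by simp_all
  qed
  have fst_abs: "fst b1 < sqrt 2 / C \<longleftrightarrow> (fst b1)\<^sup>2 < 2 / C\<^sup>2" using less_sqrt2_iff[OF C0, of "fst b1"] pos by simp
  have G3: "G3_list C b1 b2 =
      (if 0 < fst b1 \<and> fst b1 < 1 / C \<and> 1 / C < \<bar>snd b1\<bar> \<and> (snd b1)\<^sup>2 < 2 / C\<^sup>2 then
        (1, 0) # (first_near (in_strip C (snd b1) (snd b2)) (t_guess 1 s), 1) #
          (last_near (in_strip C (snd b1) (snd b2)) (t_guess 1 s), 1) # map (\<lambda>t. (t, 1)) [- 2..2]
       else if 1 / C < fst b1 \<and> (fst b1)\<^sup>2 < 2 / C\<^sup>2 \<and> 0 < \<bar>snd b1\<bar> \<and> \<bar>snd b1\<bar> < 1 / C then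
        (1, 0) # (first_near (in_strip C (fst b1) (fst b2)) (t_guess (- 1) s), 1) #
          (last_near (in_strip C (fst b1) (fst b2)) (t_guess (- 1) s), 1) # map (\<lambda>t. (t, 1)) [- 2..2]
       else (1, 0) # map (\<lambda>t. (t, 1)) [- 2..2])"
    unfolding G3_list_def t_list_def Let_def fst_abs less_sqrt2_iff[OF C0]
    using t t' pos unfolding less_sqrt2_iff[OF C0] by auto
  show ?thesis
    unfolding step4_code_def Let_def norm completed_code[OF C] if_distrib[of run_code] G3
    by (simp del: upto.simps)
qed

end

lemma encoded_input:
  fixes M :: "rat^2^2" and v1 v2 :: "rat^2"
  assumes "radicand d"
  defines "s \<equiv> load (input_code d M v1 v2)"
  shows "s 0 = field_discr d" "elt_at 9 s = elt d v1" "elt_at 13 s = elt d v2"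
    "s 10 \<noteq> 0" "s 12 \<noteq> 0" "s 14 \<noteq> 0" "s 16 \<noteq> 0"
proof -
  have d: "0 < field_discr d" using assms(1) by (simp add: field_discr_def radicand_def)
  have frac: "of_int (fst (quotient_of q)) / of_int (snd (quotient_of q)) = (of_rat q :: real)" for q
    using quotient_of_div[of q "fst (quotient_of q)" "snd (quotient_of q)"]
    by (metis of_rat_divide of_rat_of_int_eq prod.collapse)
  have pos: "snd (quotient_of q) \<noteq> 0" for q using quotient_of_denom_pos'[of q] by simp
  have regs: "s 0 = field_discr d" "s 9 = fst (quotient_of (v1 $ 1))" "s 10 = snd (quotient_of (v1 $ 1))"
    "s 11 = fst (quotient_of (v1 $ 2))" "s 12 = snd (quotient_of (v1 $ 2))"
    "s 13 = fst (quotient_of (v2 $ 1))" "s 14 = snd (quotient_of (v2 $ 1))"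
    "s 15 = fst (quotient_of (v2 $ 2))" "s 16 = snd (quotient_of (v2 $ 2))"
    unfolding s_def load_def input_code_def mat_code_def vec_code_def rat_code_def by simp_all
  show "s 0 = field_discr d" "s 10 \<noteq> 0" "s 12 \<noteq> 0" "s 14 \<noteq> 0" "s 16 \<noteq> 0"
    using regs pos by simp_all
  show "elt_at 9 s = elt d v1" "elt_at 13 s = elt d v2"
    using d by (simp_all add: elt_at_def rat_at_def elt_def Let_def root_discr_def regs frac)
qed

lemma algorithm_code_correct:
  assumes C: "1 \<le> C" and valid: "valid_input d I M v1 v2"
  shows "algorithm_code C (load (input_code d M v1 v2)) =
    run_code (algorithm_A C d I (elt d v1) (elt d v2))"
proof -
  define s where "s = load (input_code d M v1 v2)"
  have d: "radicand d" and fd: "0 < field_discr d" and fb: "Z_basis I (elt d v1) (elt d v2)"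
    and red: "LLL_reduced (elt d v1) (elt d v2)" and pos: "0 < fst (elt d v1)"
    using valid by (auto simp: valid_input_def field_discr_def radicand_def)
  note enc = encoded_input[OF d, of M v1 v2, folded s_def]
  interpret encoded_basis s I
    using enc fd fb by unfold_locales simp_all
  have norm: "inverse (of_rat (ideal_norm d I)) = 1 / \<bar>of_int (det_num s) / of_int (det_den s) :: real\<bar>"
  proof -
    have "coord_det = real_of_rat (v1 $ 1 * v2 $ 2 - v1 $ 2 * v2 $ 1)"
      using cross_det cross_elt[OF fd, of v1 v2] enc root_discr by simp
    then have "real_of_rat (ideal_norm d I) = \<bar>coord_det\<bar>"
      unfolding ideal_norm_basis[OF fd fb] abs_of_rat[symmetric] by simp
    also have "coord_det = of_int (det_num s) / of_int (det_den s)" using nonzero(3) by (simp add: det_nums)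
    finally show ?thesis by (simp add: inverse_eq_divide)
  qed
  define m n where "m = one_num1 s div det_num s" "n = one_num2 s div det_num s"
  have 1: "step1_ok C d I \<longleftrightarrow> m * det_num s = one_num1 s \<and> n * det_num s = one_num2 s \<and>
      1 / \<bar>of_int (det_num s) / of_int (det_den s)\<bar> < C\<^sup>2 * root_discr s"
    unfolding step1_ok_def one_mem_iff norm m_n_def using fd by (simp add: root_discr enc(1))
  have 2: "step2_ok I \<longleftrightarrow> gcd m n = 1" if "step1_ok C d I"
    using that one_eq_comb[of m n] unfolding 1 by (intro primitive_iff) simp
  have 3: "\<not> step3_ok C I \<longleftrightarrow> comb b1 b2 (1, 0) \<in> S1 C \<or> comb b1 b2 (- 1, 1) \<in> S1 C \<or>
      comb b1 b2 (0, 1) \<in> S1 C \<or> comb b1 b2 (1, 1) \<in> S1 C" if "step1_ok C d I"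
    using that C red unfolding 1 by (intro step3_iff) (simp_all add: enc)
  note 4 = step4_code_eq[OF C, unfolded enc, OF pos]
  show ?thesis
    unfolding s_def[symmetric] algorithm_code_def Let_def m_n_def[symmetric] algorithm_A_def
    using 1 2 3 4 unfolding enc by (auto simp: Let_def)
qed

text \<open>
  The least discriminant of a real quadratic field is 5.  That logarithms of discriminants are at
  least 1 allows them to absorb additive constants, and their powers increase with the exponent.
\<close>

lemma bits_le_ln:
  assumes "3 \<le> D"
  shows "1 \<le> ln (real_of_int D)" "real (bits D) \<le> 4 * ln (real_of_int D)"
proof -
  have "exp 1 \<le> real_of_int D" using exp_le assms by linarith
  then show ln1: "1 \<le> ln (real_of_int D)" using assms by (simp add: ln_ge_iff)
  have "real (bits D) = 2 + of_int \<lfloor>log 2 (real_of_int D)\<rfloor>"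
    using assms by (simp add: bits_def floorlog_def)
  also have "\<dots> \<le> 2 + log 2 (real_of_int D)" by simp
  also have "log 2 (real_of_int D) \<le> 2 * ln (real_of_int D)"
  proof -
    have "1 / 2 \<le> ln (2 :: real)" using ln2_ge_two_thirds by simp
    then show ?thesis using ln1 by (simp add: log_def field_simps)
  qed
  finally show "real (bits D) \<le> 4 * ln (real_of_int D)" using ln1 by linarith
qed

text \<open>
  The input length is at most \<open>bits \<Delta> + K1 (ln \<Delta>)\<^bsup>a1\<^esup> + K2 (ln \<Delta>)\<^bsup>a\<^esup>\<close>, and a power of it
  bounds the running time.
\<close>

theorem proposition4p3:
  shows "\<exists>P. \<forall>C::real. 1 \<le> C \<longrightarrow>
    (\<forall>\<kappa>. poly_cost \<kappa> \<longrightarrow>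
      (\<forall>(K1::real) (a1::nat) (K2::real) (a::nat). 0 < a \<longrightarrow>
        (\<exists>(K::real) (e::nat). \<forall>d I M v1 v2.
          valid_input d I M v1 v2 \<longrightarrow>
          real (list_bits (mat_code M)) \<le> K1 * ln \<bar>real_of_int (field_discr d)\<bar> ^ a1 \<longrightarrow>
          real (list_bits (vec_code v1 @ vec_code v2)) \<le> K2 * ln \<bar>real_of_int (field_discr d)\<bar> ^ a \<longrightarrow>
          (\<exists>t s. exec C \<kappa> P (load (input_code d M v1 v2)) t s \<and>
             holds s (run_code (algorithm_A C d I (elt d v1) (elt d v2))) \<and>
             real t \<le> K * ln \<bar>real_of_int (field_discr d)\<bar> ^ e))))"
proof -
  obtain P N where P: "\<And>C \<kappa>. poly_cost \<kappa> \<Longrightarrow> \<exists>T. poly_bounded T \<and> (\<forall>s. \<exists>t s'.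
      exec C \<kappa> P s t s' \<and> holds s' (algorithm_code C s) \<and> t \<le> T (list_bits (map s [0..<N])))"
    using polytime_program[OF polytime_entries_algorithm_code] by blast
  show ?thesis
  proof (intro exI[of _ P] allI impI)
    fix C :: real and \<kappa> :: "int list \<Rightarrow> nat" and K1 :: real and a1 :: nat and K2 :: real and a :: nat
    assume C: "1 \<le> C" and \<kappa>: "poly_cost \<kappa>"
    obtain T where T: "poly_bounded T" "\<And>s. \<exists>t s'.
        exec C \<kappa> P s t s' \<and> holds s' (algorithm_code C s) \<and> t \<le> T (list_bits (map s [0..<N]))"
      using P[OF \<kappa>] by blast
    obtain A k where A: "\<And>x. T x \<le> A * (1 + x) ^ k" using T(1) unfolding poly_bounded_def by blast
    \<comment> \<open>The length of the registers read is at most \<open>N\<close> plus the length of the whole input, hence at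
      most \<open>B\<close> times a power of the logarithm.\<close>
    define B where "B = 1 + real N + 4 + \<bar>K1\<bar> + \<bar>K2\<bar>"
    show "\<exists>(K::real) (e::nat). \<forall>d I M v1 v2.
          valid_input d I M v1 v2 \<longrightarrow>
          real (list_bits (mat_code M)) \<le> K1 * ln \<bar>real_of_int (field_discr d)\<bar> ^ a1 \<longrightarrow>
          real (list_bits (vec_code v1 @ vec_code v2)) \<le> K2 * ln \<bar>real_of_int (field_discr d)\<bar> ^ a \<longrightarrow>
          (\<exists>t s. exec C \<kappa> P (load (input_code d M v1 v2)) t s \<and>
             holds s (run_code (algorithm_A C d I (elt d v1) (elt d v2))) \<and>
             real t \<le> K * ln \<bar>real_of_int (field_discr d)\<bar> ^ e)"
    proof (rule exI[of _ "real A * B ^ k"], rule exI[of _ "(a1 + a + 1) * k"], intro allI impI)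
      fix d I M v1 v2
      assume valid: "valid_input d I M v1 v2"
        and M: "real (list_bits (mat_code M)) \<le> K1 * ln \<bar>real_of_int (field_discr d)\<bar> ^ a1"
        and v: "real (list_bits (vec_code v1 @ vec_code v2)) \<le> K2 * ln \<bar>real_of_int (field_discr d)\<bar> ^ a"
      define D where "D = field_discr d"
      define l where "l = ln (real_of_int D)"
      have D: "3 \<le> D"
      proof -
        have "1 < d" using valid by (simp add: valid_input_def radicand_def)
        moreover have "d \<noteq> 2 \<and> d \<noteq> 3" if "[d = 1] (mod 4)" using that by (auto simp: cong_def)
        ultimately show ?thesis unfolding D_def field_discr_def by auto
      qed
      have l: "1 \<le> l" "real (bits D) \<le> 4 * l" using bits_le_ln[OF D] by (simp_all add: l_def)
      have absD: "ln \<bar>real_of_int (field_discr d)\<bar> = l" using D by (simp add: l_def D_def)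
      let ?s = "load (input_code d M v1 v2)"
      let ?x = "list_bits (map ?s [0..<N])"
      have load: "list_bits (map (load xs) [0..<n]) \<le> list_bits xs + n" for xs n
      proof (induction n arbitrary: xs)
        case (Suc n)
        have "map (load xs) [0..<Suc n] = load xs 0 # map (load (tl xs)) [0..<n]"
          by (auto simp: load_def upt_conv_Cons map_Suc_upt[symmetric] nth_tl simp del: upt_Suc)
        moreover have "bits (load xs 0) + list_bits (tl xs) \<le> list_bits xs + 1"
          by (cases xs) (simp_all add: load_def)
        ultimately show ?case using Suc.IH[of "tl xs"] by simp
      qed simp
      have pow: "l ^ i \<le> l ^ (a1 + a + 1)" if "i \<le> a1 + a + 1" for i
        using that l(1) by (intro power_increasing) auto
      have *: "c * l ^ i \<le> \<bar>c\<bar> * l ^ (a1 + a + 1)" if "i \<le> a1 + a + 1" for c i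
        using pow[OF that] l(1) by (intro mult_mono) auto
      have "real (list_bits (input_code d M v1 v2)) = real (bits D) + real (list_bits (mat_code M)) +
          real (list_bits (vec_code v1 @ vec_code v2))"
        by (simp add: input_code_def D_def)
      also have "\<dots> \<le> 4 * l ^ 1 + K1 * l ^ a1 + K2 * l ^ a"
        using l(2) M v unfolding absD by simp
      also have "\<dots> \<le> \<bar>4\<bar> * l ^ (a1 + a + 1) + \<bar>K1\<bar> * l ^ (a1 + a + 1) + \<bar>K2\<bar> * l ^ (a1 + a + 1)"
        by (intro add_mono *) auto
      finally have "real (1 + ?x) \<le> 1 * l ^ 0 + real N * l ^ 0 + (\<bar>4\<bar> * l ^ (a1 + a + 1)
          + \<bar>K1\<bar> * l ^ (a1 + a + 1) + \<bar>K2\<bar> * l ^ (a1 + a + 1))"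
        using load[of "input_code d M v1 v2" N] by simp
      also have "\<dots> \<le> \<bar>1\<bar> * l ^ (a1 + a + 1) + \<bar>real N\<bar> * l ^ (a1 + a + 1) + (\<bar>4\<bar> * l ^ (a1 + a + 1)
          + \<bar>K1\<bar> * l ^ (a1 + a + 1) + \<bar>K2\<bar> * l ^ (a1 + a + 1))"
        by (intro add_mono * order_refl) auto
      also have "\<dots> = B * l ^ (a1 + a + 1)" by (simp add: B_def algebra_simps)
      finally have x: "real (1 + ?x) \<le> B * l ^ (a1 + a + 1)" .
      obtain t s' where t: "exec C \<kappa> P ?s t s'" "holds s' (algorithm_code C ?s)" "t \<le> T ?x"
        using T(2) by blast
      have "real t \<le> real (A * (1 + ?x) ^ k)" using t(3) A[of ?x] by linarith
      also have "\<dots> = real A * real (1 + ?x) ^ k" by simp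
      also have "\<dots> \<le> real A * (B * l ^ (a1 + a + 1)) ^ k"
        using x by (intro mult_left_mono power_mono) auto
      also have "\<dots> = real A * B ^ k * l ^ ((a1 + a + 1) * k)"
        by (simp only: power_mult_distrib power_mult mult.assoc)
      finally show "\<exists>t s. exec C \<kappa> P ?s t s \<and>
             holds s (run_code (algorithm_A C d I (elt d v1) (elt d v2))) \<and>
             real t \<le> real A * B ^ k * ln \<bar>real_of_int (field_discr d)\<bar> ^ ((a1 + a + 1) * k)"
        unfolding absD using t(1,2) algorithm_code_correct[OF C valid] by auto
    qed
  qed
qed

end
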